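(* Let $p,q,r$ be positive integers. Then $L(-1,q,r)$ is an alternating link, and $L(-p,q,r)$ has an almost alternating diagram.
   Context: For integers $p_1,\dots,p_n$, the $n$-pretzel link $L(p_1,\dots,p_n)\subset\mathbb S^3$ is the link given by the standard diagram consisting of $n$ boxes (columns) placed from left to right; the $i$-th box contains two vertical strands twisted around each other with $|p_i|$ half twists (crossings), the handedness of the half twists being determined by the sign of $p_i$. The top-right endpoint of box $i$ is joined to the top-left endpoint of box $i+1$, the bottom-right endpoint of box $i$ to the bottom-left endpoint of box $i+1$ ($1\le i<n$), and the top-left (bottom-left) endpoint of box $1$ is joined to the top-right (bottom-right) endpoint of box $n$ by an outer arc. A link is alternating if it has an alternating diagram (unlinks, including those with crossingless diagrams, count as alternating). An almost alternating diagram is a link diagram that becomes alternating after changing exactly one crossing. *)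

theory Defs
  imports "HOL-Analysis.Analysis"
begin

text \<open>
  Links are subsets of the unit sphere of Euclidean 4-space, considered up to ambient isotopy, and
  are presented by polygonal diagrams in the Euclidean plane.
\<close>

type_synonym plane = "real \<times> real"
type_synonym space3 = "plane \<times> real"
type_synonym space4 = "space3 \<times> real"

definition S3 :: "space4 set" where
  "S3 = sphere 0 1"

text \<open>Inverse stereographic projection from the north pole of \<^const>\<open>S3\<close>.\<close>

definition inv_stereographic :: "space3 \<Rightarrow> space4" where
  "inv_stereographic v =
     ((2 / ((norm v)\<^sup>2 + 1)) *\<^sub>R v, ((norm v)\<^sup>2 - 1) / ((norm v)\<^sup>2 + 1))"

definition ambient_isotopic :: "'a::topological_space set \<Rightarrow> 'a set \<Rightarrow> 'a set \<Rightarrow> bool" where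
  "ambient_isotopic X K L \<longleftrightarrow>
     (\<exists>H :: real \<Rightarrow> 'a \<Rightarrow> 'a.
        continuous_on ({0..1} \<times> X) (\<lambda>(t, x). H t x) \<and>
        (\<forall>t\<in>{0..1}. \<exists>g. homeomorphism X X (H t) g) \<and>
        (\<forall>x\<in>X. H 0 x = x) \<and>
        H 1 ` K = L)"

text \<open>
  A diagram is given by its edges, an edge being the set of the two endpoints of a line segment, and
  by those edges that form the over strand of a crossing.  Edges are subdivided so that each of them
  takes part in at most one crossing; this is no restriction on the curves drawn.
\<close>

record diagram =
  edges :: "plane set set"
  over :: "plane set set"

definition crosses :: "plane set \<Rightarrow> plane set \<Rightarrow> bool" where
  "crosses e f \<longleftrightarrow> e \<noteq> f \<and> (\<exists>c. convex hull e \<inter> convex hull f = {c} \<and> c \<notin> e \<and> c \<notin> f)"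

definition crossing_edge :: "diagram \<Rightarrow> plane set \<Rightarrow> bool" where
  "crossing_edge D e \<longleftrightarrow> e \<in> edges D \<and> (\<exists>f\<in>edges D. crosses e f)"

text \<open>
  The underlying curve is a finite union of closed polygons (every vertex has exactly two edges)
  whose only singularities are transverse double points in the interior of edges.
\<close>

definition link_diagram :: "diagram \<Rightarrow> bool" where
  "link_diagram D \<longleftrightarrow>
     finite (edges D) \<and>
     (\<forall>e\<in>edges D. card e = 2) \<and>
     (\<forall>v\<in>\<Union>(edges D). card {e \<in> edges D. v \<in> e} = 2) \<and>
     (\<forall>e\<in>edges D. \<forall>f\<in>edges D. e \<noteq> f \<longrightarrow>
        convex hull e \<inter> convex hull f = e \<inter> f \<or> crosses e f) \<and>
     (\<forall>e\<in>edges D. \<forall>f\<in>edges D. \<forall>g\<in>edges D. crosses e f \<and> crosses e g \<longrightarrow> f = g) \<and>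
     (\<forall>e\<in>over D. crossing_edge D e) \<and>
     (\<forall>e\<in>edges D. \<forall>f\<in>edges D. crosses e f \<longrightarrow> (e \<in> over D \<longleftrightarrow> f \<notin> over D))"

text \<open>
  The link of a diagram: the curve lies at height 0, except that each over edge is raised along its
  interior (by the distance to its endpoints) and thus passes above the edge it crosses.
\<close>

definition height :: "diagram \<Rightarrow> plane set \<Rightarrow> plane \<Rightarrow> real" where
  "height D e v = (if e \<in> over D then infdist v e else 0)"

definition link_of :: "diagram \<Rightarrow> space4 set" where
  "link_of D = inv_stereographic ` (\<Union>e\<in>edges D. (\<lambda>v. (v, height D e v)) ` (convex hull e))"

definition has_diagram :: "space4 set \<Rightarrow> diagram \<Rightarrow> bool" where
  "has_diagram K D \<longleftrightarrow> link_diagram D \<and> ambient_isotopic S3 K (link_of D)"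

text \<open>
  The list \<open>es\<close> below runs along a component from one passage through a crossing to the next one.
  The distinctness excludes turning back.  Arcs that return to the edge they started from do not
  occur: closed curves in the plane meeting transversely have an even number of common points, so a
  polygon that contains a crossing edge contains at least two of them.
\<close>

definition alternating_diagram :: "diagram \<Rightarrow> bool" where
  "alternating_diagram D \<longleftrightarrow>
     (\<forall>es. set es \<subseteq> edges D \<and> distinct es \<and> length es \<ge> 2 \<and>
           successively (\<lambda>e f. e \<inter> f \<noteq> {}) es \<and>
           crossing_edge D (hd es) \<and> crossing_edge D (last es) \<and>
           (\<forall>e\<in>set (butlast (tl es)). \<not> crossing_edge D e)
       \<longrightarrow> (hd es \<in> over D \<longleftrightarrow> last es \<notin> over D))"

text \<open>Interchange over and under at the crossing of the edges \<open>e\<close> and \<open>f\<close>.\<close>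

definition change_crossing :: "diagram \<Rightarrow> plane set \<Rightarrow> plane set \<Rightarrow> diagram" where
  "change_crossing D e f = D\<lparr>over := (over D - {e, f}) \<union> ({e, f} - over D)\<rparr>"

definition almost_alternating_diagram :: "diagram \<Rightarrow> bool" where
  "almost_alternating_diagram D \<longleftrightarrow>
     (\<exists>e\<in>edges D. \<exists>f\<in>edges D. crosses e f \<and> alternating_diagram (change_crossing D e f))"

definition alternating_link :: "space4 set \<Rightarrow> bool" where
  "alternating_link K \<longleftrightarrow> (\<exists>D. has_diagram K D \<and> alternating_diagram D)"

definition has_almost_alternating_diagram :: "space4 set \<Rightarrow> bool" where
  "has_almost_alternating_diagram K \<longleftrightarrow> (\<exists>D. has_diagram K D \<and> almost_alternating_diagram D)"

text \<open>
  The standard pretzel diagram of a nonempty list of integers.  Box \<open>i\<close> (counted from 0) is the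
  rectangle with \<open>2 i \<le> x \<le> 2 i + 1\<close> and \<open>0 \<le> y \<le> h\<close>, where \<open>h\<close> is \<open>box_height ps\<close>.  Its
  half twists are stacked from \<open>y = 0\<close> upwards, the \<open>k\<close>-th one between \<open>y = k\<close> and \<open>y = k + 1\<close>;
  above them the two strands are vertical.  In a positive (negative) box the over strands are those
  running from bottom left to top right (from top left to bottom right).
\<close>

definition box_height :: "int list \<Rightarrow> real" where
  "box_height ps = 1 + real_of_int (\<Sum>i<length ps. \<bar>ps ! i\<bar>)"

definition rising :: "nat \<Rightarrow> nat \<Rightarrow> plane set" where
  "rising i k = {(2 * real i, real k), (2 * real i + 1, real k + 1)}"

definition falling :: "nat \<Rightarrow> nat \<Rightarrow> plane set" where
  "falling i k = {(2 * real i + 1, real k), (2 * real i, real k + 1)}"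

definition twist_edges :: "int list \<Rightarrow> plane set set" where
  "twist_edges ps =
     (\<Union>i<length ps. \<Union>k<nat \<bar>ps ! i\<bar>. {rising i k, falling i k})"

definition vertical_edges :: "int list \<Rightarrow> plane set set" where
  "vertical_edges ps =
     (\<Union>i<length ps. \<Union>x\<in>{2 * real i, 2 * real i + 1}.
        {{(x, \<bar>real_of_int (ps ! i)\<bar>), (x, box_height ps)}})"

definition joining_edges :: "int list \<Rightarrow> plane set set" where
  "joining_edges ps =
     (\<Union>i<length ps - 1. \<Union>y\<in>{0, box_height ps}.
        {{(2 * real i + 1, y), (2 * real i + 2, y)}})"

definition outer_edges :: "int list \<Rightarrow> plane set set" where
  "outer_edges ps =
     (let m = 2 * real (length ps) - 1; h = box_height ps
      in {{(0, h), (0, h + 1)}, {(0, h + 1), (m, h + 1)}, {(m, h + 1), (m, h)},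
          {(0, 0), (0, - 1)}, {(0, - 1), (m, - 1)}, {(m, - 1), (m, 0)}})"

definition pretzel_diagram :: "int list \<Rightarrow> diagram" where
  "pretzel_diagram ps =
     \<lparr>edges = twist_edges ps \<union> vertical_edges ps \<union> joining_edges ps \<union> outer_edges ps,
      over = (\<Union>i<length ps. \<Union>k<nat \<bar>ps ! i\<bar>. {if ps ! i > 0 then rising i k else falling i k})\<rparr>"

definition pretzel_link :: "int list \<Rightarrow> space4 set" where
  "pretzel_link ps = link_of (pretzel_diagram ps)"

end

theory Submission
  imports Defs
begin

text \<open>
  Both claims are instances of one principle: an arc of a link diagram that is over at all its
  crossings can be taken off and laid down again along any other path with the same ends, provided
  that it is over at all its new crossings; likewise for arcs that are under everywhere.  The work
  lies in proving this for the polygonal links and ambient isotopies used here, and in checking that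
  three explicit replacements turn the pretzel diagrams into the required ones.

  \<^emph>\<open>The negative column.\<close>  In the standard diagram of \<open>L(-p, q, r)\<close> all columns alternate, and the
  arcs that do not alternate are the four leaving the first column.  Near the top, the strand over the
  highest crossing of the first column continues over the highest crossing of the third.  Instead of
  letting it run from the right end of that crossing of the first column over to the left and up, lead
  it from this end downwards between the first two columns, over the arc joining their bottoms, over
  the outer bottom arc, and up again on the left of everything.  The highest crossing of the first
  column is traded for two others, and now the four arcs that do not alternate are exactly those that
  meet at the crossing with the outer bottom arc.  So changing this crossing makes the diagram
  alternate.  If \<open>p = 1\<close> the crossing with the bottom join does not arise, and the rest of the
  argument is the same.

  \<^emph>\<open>A single crossing.\<close>  In \<open>L(-1, q, r)\<close> the strand over the single crossing of the first column is
  also over the lowest crossing of the second column and over the highest crossing of the third.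
  This overpass is replaced by one through the face between the second and the third column, which
  removes three crossings.  If \<open>q = 1\<close> or \<open>r = 1\<close>, all crossings left lie in one column, and the diagram
  alternates.  Otherwise the strand under the single crossing, which is also under the highest crossing
  of the second column and the lowest crossing of the third, is led through the same face, where it
  passes under the first one.  The outcome is the alternating diagram of \<open>L(1, q - 2, r - 2)\<close>.

  \<^emph>\<open>Isotopies.\<close>  The basic move (\<open>triangle_move\<close>) replaces one side of a triangle by the two others if
  the link does not meet the triangle elsewhere; it is realized by pushing along the lines parallel to
  one direction, with an explicit piecewise linear speed.  By such moves an overpass is raised to a
  fixed arch high above the rest of the link (\<open>raise_to_arch\<close>).  The arch depends on the ends
  only, so any two overpasses with the same ends give isotopic links (\<open>overpass_isotopic\<close>).  In terms
  of diagrams this is \<open>reroute_isotopic\<close>.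

  \<^emph>\<open>Diagrams.\<close>  Being a link diagram is checked once, for the standard pretzel diagrams, and is
  preserved by replacing arcs (\<open>plane_curve_reroute\<close>).  Alternation is checked locally, by means of a
  flow from overcrossings to undercrossings (\<open>alternating_if_flow\<close>).
\<close>

section \<open>Ambient isotopy is an equivalence relation\<close>

lemma ambient_isotopic_refl: "ambient_isotopic X K K"
  unfolding ambient_isotopic_def
proof (rule exI[of _ "\<lambda>t x. x"], intro conjI ballI)
  show "continuous_on ({0..1} \<times> X) (\<lambda>(t, x). (\<lambda>(t::real) x. x) t x)"
    by (simp add: case_prod_unfold continuous_on_snd continuous_on_id)
  show "\<exists>g. homeomorphism X X ((\<lambda>t x. x) t) g" for t :: real
    using homeomorphism_ident by blast
qed auto

text \<open>
  The two isotopies are performed at the same time rather than one after the other, so that there is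
  nothing to glue.
\<close>

lemma ambient_isotopic_trans:
  assumes "ambient_isotopic X K L" and "ambient_isotopic X L M"
  shows "ambient_isotopic X K M"
proof -
  obtain H where H: "continuous_on ({0..1::real} \<times> X) (\<lambda>(t, x). H t x)"
    "\<And>t. t \<in> {0..1} \<Longrightarrow> \<exists>g. homeomorphism X X (H t) g" "\<And>x. x \<in> X \<Longrightarrow> H 0 x = x" "H 1 ` K = L"
    using assms(1) unfolding ambient_isotopic_def by blast
  obtain G where G: "continuous_on ({0..1::real} \<times> X) (\<lambda>(t, x). G t x)"
    "\<And>t. t \<in> {0..1} \<Longrightarrow> \<exists>g. homeomorphism X X (G t) g" "\<And>x. x \<in> X \<Longrightarrow> G 0 x = x" "G 1 ` L = M"
    using assms(2) unfolding ambient_isotopic_def by blast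
  have HX: "H t x \<in> X" if "t \<in> {0..1}" "x \<in> X" for t x
    using H(2)[OF that(1)] that(2) by (auto simp: homeomorphism_def)
  show ?thesis
    unfolding ambient_isotopic_def
  proof (rule exI[of _ "\<lambda>t. G t \<circ> H t"], intro conjI ballI)
    have "continuous_on ({0..1} \<times> X) ((\<lambda>(t, x). G t x) \<circ> (\<lambda>z. (fst z, (\<lambda>(t, x). H t x) z)))"
      by (intro continuous_on_compose continuous_intros H(1) continuous_on_subset[OF G(1)])
        (use HX in auto)
    then show "continuous_on ({0..1} \<times> X) (\<lambda>(t, x). (\<lambda>t. G t \<circ> H t) t x)"
      by (simp add: o_def case_prod_unfold)
    show "\<exists>g. homeomorphism X X ((\<lambda>t. G t \<circ> H t) t) g" if "t \<in> {0..1}" for t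
      using H(2)[OF that] G(2)[OF that] homeomorphism_compose by blast
    show "(G 1 \<circ> H 1) ` K = M"
      using H(4) G(4) by (metis image_comp)
  qed (use H(3) G(3) in auto)
qed

text \<open>
  The inverse isotopy is \<open>H\<^bsub>1-t\<^esub> \<circ> H\<^bsub>1\<^esub>\<inverse>\<close>.  Unlike \<open>H\<^bsub>t\<^esub>\<inverse>\<close> it is visibly continuous in both arguments.
\<close>

lemma ambient_isotopic_sym:
  assumes "ambient_isotopic X K L" and "K \<subseteq> X"
  shows "ambient_isotopic X L K"
proof -
  obtain H where H: "continuous_on ({0..1::real} \<times> X) (\<lambda>(t, x). H t x)"
    "\<And>t. t \<in> {0..1} \<Longrightarrow> \<exists>g. homeomorphism X X (H t) g" "\<And>x. x \<in> X \<Longrightarrow> H 0 x = x" "H 1 ` K = L"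
    using assms(1) unfolding ambient_isotopic_def by blast
  obtain g where g: "homeomorphism X X (H 1) g"
    using H(2)[of 1] by auto
  have gX: "g x \<in> X" "H 1 (g x) = x" if "x \<in> X" for x
    using g that by (auto simp: homeomorphism_def)
  show ?thesis
    unfolding ambient_isotopic_def
  proof (rule exI[of _ "\<lambda>t. H (1 - t) \<circ> g"], intro conjI ballI)
    have "continuous_on ({0..1} \<times> X) ((\<lambda>(t, x). H t x) \<circ> (\<lambda>z. (1 - fst z, g (snd z))))"
    proof (intro continuous_on_compose continuous_intros continuous_on_subset[OF H(1)])
      show "continuous_on ({0..1} \<times> X) (\<lambda>z. g (snd z))"
        by (rule continuous_on_compose2[OF homeomorphism_cont2[OF g]])
          (auto intro: continuous_intros)
    qed (use gX in auto)
    then show "continuous_on ({0..1} \<times> X) (\<lambda>(t, x). (\<lambda>t. H (1 - t) \<circ> g) t x)"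
      by (simp add: o_def case_prod_unfold)
    show "\<exists>g'. homeomorphism X X ((\<lambda>t. H (1 - t) \<circ> g) t) g'" if "t \<in> {0..1}" for t :: real
    proof -
      have "1 - t \<in> {0..1}" using that by simp
      then obtain g' where "homeomorphism X X (H (1 - t)) g'"
        using H(2) by blast
      then show ?thesis
        using homeomorphism_compose[OF homeomorphism_symD[OF g]] by blast
    qed
    show "(H (1 - 1) \<circ> g) ` L = K"
    proof -
      have "g (H 1 x) = x" if "x \<in> X" for x
        using g that by (auto simp: homeomorphism_def)
      then have "H 0 (g (H 1 x)) = x" if "x \<in> K" for x
        using H(3) that assms(2) by auto
      then show ?thesis
        unfolding H(4)[symmetric] by (auto simp: image_image image_iff)
    qed
  qed (use gX in auto)
qed

lemma ambient_isotopic_image: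
  assumes "ambient_isotopic X K L" and "homeomorphism X X f f'" and "K \<subseteq> X"
  shows "ambient_isotopic X (f ` K) (f ` L)"
proof -
  obtain H where H: "continuous_on ({0..1::real} \<times> X) (\<lambda>(t, x). H t x)"
    "\<And>t. t \<in> {0..1} \<Longrightarrow> \<exists>g. homeomorphism X X (H t) g" "\<And>x. x \<in> X \<Longrightarrow> H 0 x = x" "H 1 ` K = L"
    using assms(1) unfolding ambient_isotopic_def by blast
  have f: "f x \<in> X" "f' x \<in> X" "f (f' x) = x" "f' (f x) = x" if "x \<in> X" for x
    using assms(2) that by (auto simp: homeomorphism_def)
  have HX: "H t x \<in> X" if "t \<in> {0..1}" "x \<in> X" for t x
    using H(2)[OF that(1)] that(2) by (auto simp: homeomorphism_def)
  show ?thesis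
    unfolding ambient_isotopic_def
  proof (rule exI[of _ "\<lambda>t. f \<circ> H t \<circ> f'"], intro conjI ballI)
    have "continuous_on ({0..1} \<times> X) (f \<circ> ((\<lambda>(t, x). H t x) \<circ> (\<lambda>z. (fst z, f' (snd z)))))"
    proof (intro continuous_on_compose continuous_intros continuous_on_subset[OF H(1)]
        continuous_on_subset[OF homeomorphism_cont1[OF assms(2)]])
      show "continuous_on ({0..1} \<times> X) (\<lambda>z. f' (snd z))"
        by (rule continuous_on_compose2[OF homeomorphism_cont2[OF assms(2)]])
          (auto intro: continuous_intros)
    qed (use f HX in auto)
    then show "continuous_on ({0..1} \<times> X) (\<lambda>(t, x). (\<lambda>t. f \<circ> H t \<circ> f') t x)"
      by (simp add: o_def case_prod_unfold)
    show "\<exists>g'. homeomorphism X X ((\<lambda>t. f \<circ> H t \<circ> f') t) g'" if t: "t \<in> {0..1}" for t :: real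
      using homeomorphism_compose[OF homeomorphism_symD[OF assms(2)]]
        homeomorphism_compose[OF _ assms(2)] H(2)[OF t] by (metis comp_assoc)
    show "(f \<circ> H 1 \<circ> f') ` (f ` K) = f ` L"
    proof -
      have "(f \<circ> H 1 \<circ> f') ` (f ` K) = (\<lambda>x. f (H 1 x)) ` K"
        unfolding image_image by (rule image_cong) (use f(4) assms(3) in auto)
      then show ?thesis
        unfolding H(4)[symmetric] by (simp add: image_image)
    qed
  qed (use f H(3) in auto)
qed

section \<open>From isotopies of 3-space to isotopies of the sphere\<close>

definition stereographic :: "space4 \<Rightarrow> space3" where
  "stereographic y = (1 / (1 - snd y)) *\<^sub>R fst y"

abbreviation north :: space4 where
  "north \<equiv> (0, 1)"

lemma inv_stereographic_in_S3: "inv_stereographic v \<in> S3"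
proof -
  define n where "n = (norm v)\<^sup>2"
  have n: "n \<ge> 0" unfolding n_def by simp
  have "(norm (inv_stereographic v))\<^sup>2 = (2 / (n + 1))\<^sup>2 * n + ((n - 1) / (n + 1))\<^sup>2"
    by (simp add: inv_stereographic_def norm_Pair n_def power_mult_distrib power_divide)
  also have "\<dots> = 1"
  proof -
    have "n + 1 \<noteq> 0" using n by simp
    have "(2 / (n + 1))\<^sup>2 * n + ((n - 1) / (n + 1))\<^sup>2 = (4 * n + (n - 1)\<^sup>2) / (n + 1)\<^sup>2"
      by (simp add: power_divide add_divide_distrib)
    also have "4 * n + (n - 1)\<^sup>2 = (n + 1)\<^sup>2"
      by (simp add: power2_eq_square algebra_simps)
    finally show ?thesis using \<open>n + 1 \<noteq> 0\<close> by simp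
  qed
  finally have "norm (inv_stereographic v) = 1"
    using norm_ge_zero[of "inv_stereographic v"] unfolding power2_eq_1_iff by linarith
  then show ?thesis by (simp add: S3_def)
qed

lemma snd_inv_stereographic_neq_1: "snd (inv_stereographic v) \<noteq> 1"
proof -
  have "(norm v)\<^sup>2 + 1 \<noteq> 0" by (rule order.strict_implies_not_eq[symmetric], simp add: add_nonneg_pos)
  then show ?thesis by (simp add: inv_stereographic_def divide_eq_1_iff)
qed

lemma stereographic_inverse: "stereographic (inv_stereographic v) = v"
proof -
  define n where "n = (norm v)\<^sup>2"
  have n: "n + 1 \<noteq> 0" unfolding n_def
    by (rule order.strict_implies_not_eq[symmetric], simp add: add_nonneg_pos)
  have "1 / (1 - (n - 1) / (n + 1)) * (2 / (n + 1)) = 1"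
    using n by (simp add: field_simps)
  then show ?thesis
    by (simp add: stereographic_def inv_stereographic_def n_def)
qed

lemma S3_norm: "y \<in> S3 \<Longrightarrow> (norm (fst y))\<^sup>2 = 1 - (snd y)\<^sup>2"
  by (cases y) (auto simp: S3_def norm_Pair)

lemma S3_snd_le_1: "y \<in> S3 \<Longrightarrow> snd y \<le> 1"
  using S3_norm[of y] zero_le_power2[of "norm (fst y)"] by (simp add: abs_square_le_1)

lemma S3_north: "y \<in> S3 \<Longrightarrow> snd y = 1 \<Longrightarrow> y = north"
  using S3_norm[of y] by (auto simp: prod_eq_iff)

lemma norm_stereographic:
  assumes "y \<in> S3" and "y \<noteq> north"
  shows "(norm (stereographic y))\<^sup>2 = (1 + snd y) / (1 - snd y)"
proof -
  have "snd y \<noteq> 1" using assms S3_north by blast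
  have "(norm (stereographic y))\<^sup>2 = (1 - (snd y)\<^sup>2) / (1 - snd y)\<^sup>2"
    using S3_norm[OF assms(1)] by (simp add: stereographic_def power_mult_distrib power_divide)
  also have "\<dots> = ((1 + snd y) * (1 - snd y)) / ((1 - snd y) * (1 - snd y))"
    by (simp add: algebra_simps power2_eq_square)
  finally show ?thesis using \<open>snd y \<noteq> 1\<close> by simp
qed

lemma inv_stereographic_inverse:
  assumes "y \<in> S3" and "y \<noteq> north"
  shows "inv_stereographic (stereographic y) = y"
proof -
  have s: "snd y \<noteq> 1" using assms S3_north by blast
  have n: "(norm (stereographic y))\<^sup>2 + 1 = 2 / (1 - snd y)"
    unfolding norm_stereographic[OF assms] using s by (simp add: field_simps)
  have m: "(norm (stereographic y))\<^sup>2 - 1 = 2 * snd y / (1 - snd y)"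
    unfolding norm_stereographic[OF assms] using s by (simp add: field_simps)
  show ?thesis
    unfolding inv_stereographic_def n m using s
    by (simp add: prod_eq_iff stereographic_def)
qed

lemma continuous_on_inv_stereographic: "continuous_on S inv_stereographic"
proof -
  have "(norm v)\<^sup>2 + 1 \<noteq> 0" for v :: space3
    by (rule order.strict_implies_not_eq[symmetric], simp add: add_nonneg_pos)
  then show ?thesis
    unfolding inv_stereographic_def by (intro continuous_intros) auto
qed

lemma continuous_on_stereographic: "continuous_on (S3 - {north}) stereographic"
  unfolding stereographic_def
  by (intro continuous_intros) (use S3_north in auto)

text \<open>
  A vector field \<open>x \<mapsto> f x *\<^sub>R u\<close> of constant direction and bounded support that preserves the order
  along each line parallel to \<open>u\<close> generates an isotopy of space by straight-line motion.  It fixes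
  a neighbourhood of infinity and hence extends to the sphere.
\<close>

proposition push_isotopy:
  fixes f :: "space3 \<Rightarrow> real" and u :: space3
  assumes f: "continuous_on UNIV f"
    and mono: "\<And>x. strict_mono (\<lambda>s. s + f (x + s *\<^sub>R u))"
    and R: "\<And>x. norm x > R \<Longrightarrow> f x = 0"
  shows "ambient_isotopic S3 (inv_stereographic ` K)
           (inv_stereographic ` ((\<lambda>x. x + f x *\<^sub>R u) ` K))"
proof -
  define \<phi> where "\<phi> t x = x + (t * f x) *\<^sub>R u" for t x
  have \<phi>_cont: "continuous_on S (\<lambda>(t, x). \<phi> t x)" for S :: "(real \<times> space3) set"
    unfolding \<phi>_def case_prod_unfold
    by (intro continuous_intros continuous_on_compose2[OF f]) auto
  have strict: "strict_mono (\<lambda>s. s + t * f (x + s *\<^sub>R u))" if "t \<in> {0..1}" for t x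
  proof (rule strict_monoI)
    fix a b :: real assume ab: "a < b"
    have 1: "a + f (x + a *\<^sub>R u) < b + f (x + b *\<^sub>R u)"
      using mono[of x] ab by (simp add: strict_mono_def)
    show "a + t * f (x + a *\<^sub>R u) < b + t * f (x + b *\<^sub>R u)"
    proof (cases "t = 0")
      case False
      then have "t * (a + f (x + a *\<^sub>R u)) < t * (b + f (x + b *\<^sub>R u))"
        using 1 that by simp
      moreover have "(1 - t) * a \<le> (1 - t) * b"
        using ab that by (intro mult_left_mono) auto
      ultimately show ?thesis by (simp add: algebra_simps)
    qed (use ab in simp)
  qed
  have inj: "inj (\<phi> t)" if t: "t \<in> {0..1}" for t
  proof (rule injI)
    fix x y assume eq: "\<phi> t x = \<phi> t y"
    define s where "s = t * f x - t * f y"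
    have y: "y = x + s *\<^sub>R u"
      using eq by (simp add: \<phi>_def s_def algebra_simps)
    then have "0 + t * f (x + 0 *\<^sub>R u) = s + t * f (x + s *\<^sub>R u)"
      by (simp add: s_def)
    then have "s = 0"
      using strict_mono_eq[OF strict[OF t, of x], of 0 s] by simp
    then show "x = y" using y by simp
  qed
  have surj: "surj (\<phi> t)" if t: "t \<in> {0..1}" for t
  proof (cases "u = 0")
    case True
    then show ?thesis by (auto simp: \<phi>_def surj_def)
  next
    case False
    show ?thesis
      unfolding surj_def
    proof
      fix y :: space3
      \<comment> \<open>so far out on the line through y parallel to u that f vanishes there\<close>
      define S where "S = (norm y + \<bar>R\<bar> + 1) / norm u"
      have S: "S > 0" using False by (simp add: S_def add_nonneg_pos)
      have far: "f (y + s *\<^sub>R u) = 0" if "\<bar>s\<bar> = S" for s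
      proof (rule R)
        have "norm (s *\<^sub>R u) = norm y + \<bar>R\<bar> + 1"
          using that False by (simp add: S_def)
        then show "norm (y + s *\<^sub>R u) > R"
          using norm_triangle_ineq4[of "y + s *\<^sub>R u" y] by simp
      qed
      have "continuous_on {-S..S} (\<lambda>s. s + t * f (y + s *\<^sub>R u))"
        by (intro continuous_intros continuous_on_compose2[OF f]) auto
      then obtain s where "s + t * f (y + s *\<^sub>R u) = 0"
        using IVT'[of "\<lambda>s. s + t * f (y + s *\<^sub>R u)" "-S" 0 S] far[of S] far[of "-S"] S by auto
      then have "\<phi> t (y + s *\<^sub>R u) = y + 0 *\<^sub>R u"
        unfolding \<phi>_def by (metis add.assoc scaleR_add_left)
      then have "y = \<phi> t (y + s *\<^sub>R u)" by simp
      then show "\<exists>x. y = \<phi> t x" by blast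
    qed
  qed
  define H where "H t y = (if y = north then north else inv_stereographic (\<phi> t (stereographic y)))"
    for t y
  have H_inv: "H t (inv_stereographic v) = inv_stereographic (\<phi> t v)" for t v
    using snd_inv_stereographic_neq_1[of v] by (auto simp: H_def stereographic_inverse)
  \<comment> \<open>the height on the sphere above which all points lie outside the ball of radius R\<close>
  define c where "c = (R\<^sup>2 - 1) / (R\<^sup>2 + 1)"
  have R1: "R\<^sup>2 + 1 > 0" by (simp add: add_nonneg_pos)
  have c: "c < 1" using R1 by (simp add: c_def)
  have H_far: "H t y = y" if "y \<in> S3" "snd y > c" for t y
  proof (cases "y = north")
    case False
    then have s: "snd y < 1" using S3_snd_le_1[OF that(1)] S3_north[OF that(1)] by (cases "snd y = 1") auto
    have "(norm (stereographic y))\<^sup>2 > R\<^sup>2"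
      unfolding norm_stereographic[OF that(1) False] using s that(2) R1
      by (simp add: c_def field_simps)
    then have "norm (stereographic y) > R"
      by (rule power_less_imp_less_base) simp
    then show ?thesis
      using R inv_stereographic_inverse[OF that(1) False] False by (simp add: H_def \<phi>_def)
  qed (simp add: H_def)
  \<comment> \<open>H is the identity near the north pole and conjugate to the motion of space elsewhere\<close>
  have H_cont: "continuous_on ({0..1} \<times> S3) (\<lambda>(t, x). H t x)"
  proof -
    let ?D = "{0..1::real} \<times> S3"
    let ?U = "?D \<inter> {z. snd (snd z) > c}" and ?V = "?D - {z. snd z = north}"
    have "continuous_on ?U (\<lambda>z. snd z)" by (intro continuous_intros)
    then have 1: "continuous_on ?U (\<lambda>(t, x). H t x)"
      by (rule continuous_on_cong[THEN iffD1, rotated -1]) (auto simp: H_far)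
    have "continuous_on ?V (inv_stereographic \<circ> ((\<lambda>(t, x). \<phi> t x) \<circ> (\<lambda>z. (fst z, stereographic (snd z)))))"
      by (intro continuous_on_compose continuous_on_inv_stereographic \<phi>_cont continuous_intros
          continuous_on_compose2[OF continuous_on_stereographic]) auto
    then have 2: "continuous_on ?V (\<lambda>(t, x). H t x)"
      by (rule continuous_on_cong[THEN iffD1, rotated -1]) (auto simp: H_def)
    have oU: "openin (top_of_set ?D) ?U"
    proof -
      have "open {z :: real \<times> space4. snd (snd z) > c}"
        by (intro open_Collect_less continuous_intros)
      then show ?thesis by (rule openin_open_Int)
    qed
    have oV: "openin (top_of_set ?D) ?V"
    proof -
      have "closed {z :: real \<times> space4. snd z = north}"
        by (intro closed_Collect_eq continuous_intros)
      then have "openin (top_of_set ?D) (?D \<inter> - {z. snd z = north})"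
        by (intro openin_open_Int) auto
      then show ?thesis by (simp add: Diff_eq)
    qed
    have "?U \<union> ?V = ?D" using c by auto
    then show ?thesis
      using continuous_on_Un_local_open[of ?U ?V "\<lambda>(t, x). H t x"] oU oV 1 2 by simp
  qed
  have H_homeo: "\<exists>g. homeomorphism S3 S3 (H t) g" if t: "t \<in> {0..1}" for t
  proof (rule homeomorphism_compact)
    show "compact S3" by (simp add: S3_def)
    show "continuous_on S3 (H t)"
    proof -
      have "continuous_on S3 ((\<lambda>(t, x). H t x) \<circ> (\<lambda>x. (t, x)))"
        by (intro continuous_on_compose continuous_intros continuous_on_subset[OF H_cont])
          (use t in auto)
      then show ?thesis by (simp add: o_def)
    qed
    show "inj_on (H t) S3"
    proof (rule inj_onI)
      fix x y assume x: "x \<in> S3" and y: "y \<in> S3" and eq: "H t x = H t y"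
      show "x = y"
      proof (cases "x = north \<or> y = north")
        case True
        then show ?thesis
          using eq snd_inv_stereographic_neq_1 unfolding H_def by (metis snd_conv)
      next
        case False
        then have "\<phi> t (stereographic x) = \<phi> t (stereographic y)"
          using eq by (simp add: H_def) (metis stereographic_inverse)
        then show ?thesis
          using inj[OF t] inv_stereographic_inverse x y False by (metis injD)
      qed
    qed
    show "H t ` S3 = S3"
    proof
      show "H t ` S3 \<subseteq> S3"
      proof (rule image_subsetI)
        fix y assume "y \<in> S3"
        then show "H t y \<in> S3"
          using inv_stereographic_in_S3 by (cases "y = north") (simp_all add: H_def)
      qed
      show "S3 \<subseteq> H t ` S3"
      proof
        fix y assume y: "y \<in> S3"
        show "y \<in> H t ` S3"
        proof (cases "y = north")
          case True
          then have "y = H t y" by (simp add: H_def)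
          then show ?thesis using y by blast
        next
          case False
          obtain v where "stereographic y = \<phi> t v" using surj[OF t] by (metis surj_def)
          then have "y = H t (inv_stereographic v)"
            using inv_stereographic_inverse[OF y False] by (simp add: H_inv)
          then show ?thesis using inv_stereographic_in_S3 by blast
        qed
      qed
    qed
  qed
  show ?thesis
    unfolding ambient_isotopic_def
  proof (rule exI[of _ H], intro conjI ballI)
    show "H 0 x = x" if "x \<in> S3" for x
      using inv_stereographic_inverse[OF that] by (simp add: H_def \<phi>_def)
    show "H 1 ` inv_stereographic ` K = inv_stereographic ` (\<lambda>x. x + f x *\<^sub>R u) ` K"
      by (simp add: image_image H_inv) (simp add: \<phi>_def)
  qed (use H_cont H_homeo in auto)
qed

section \<open>Triangle moves\<close>

text \<open>
  Isotopy of subsets of space, always meant inside the sphere.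
\<close>

definition isotopic :: "space3 set \<Rightarrow> space3 set \<Rightarrow> bool" where
  "isotopic K L \<longleftrightarrow> ambient_isotopic S3 (inv_stereographic ` K) (inv_stereographic ` L)"

lemma isotopic_refl: "isotopic K K"
  by (simp add: isotopic_def ambient_isotopic_refl)

lemma isotopic_sym: "isotopic K L \<Longrightarrow> isotopic L K"
  unfolding isotopic_def
  by (rule ambient_isotopic_sym) (auto simp: inv_stereographic_in_S3)

lemma isotopic_trans [trans]: "isotopic K L \<Longrightarrow> isotopic L M \<Longrightarrow> isotopic K M"
  unfolding isotopic_def by (rule ambient_isotopic_trans)

text \<open>
  The triangle with base \<open>ab\<close> and apex \<open>c\<close>, given by the midpoint of the base,
  the vector \<open>d\<close> from the midpoint to \<open>b\<close> and the vector \<open>u\<close> from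
  it to \<open>c\<close>. The assumption is that the Gram determinant of \<open>d\<close> and
  \<open>u\<close> is positive, that is, that the triangle is not degenerate.

  The functions \<open>\<alpha>\<close> and \<open>\<beta>\<close> are the coordinates with respect to
  \<open>d\<close> and \<open>u\<close> of the orthogonal projection to the plane of the triangle, and
  \<open>\<gamma>\<close> is the distance from that plane. Only \<open>\<beta>\<close> changes along the
  direction \<open>u\<close>.
\<close>

locale triangle =
  fixes mid d u :: space3
  assumes gram_pos: "(d \<bullet> d) * (u \<bullet> u) - (d \<bullet> u)\<^sup>2 > 0"
begin

abbreviation "a \<equiv> mid - d"
abbreviation "b \<equiv> mid + d"
abbreviation "c \<equiv> mid + u"

definition gram where "gram = (d \<bullet> d) * (u \<bullet> u) - (d \<bullet> u)\<^sup>2"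
definition \<alpha> where "\<alpha> x = ((u \<bullet> u) * (x \<bullet> d) - (d \<bullet> u) * (x \<bullet> u)) / gram"
definition \<beta> where "\<beta> x = ((d \<bullet> d) * (x \<bullet> u) - (d \<bullet> u) * (x \<bullet> d)) / gram"
definition \<gamma> where "\<gamma> x = norm (x - \<alpha> x *\<^sub>R d - \<beta> x *\<^sub>R u)"

lemma gram_nonzero: "gram \<noteq> 0"
  using gram_pos by (simp add: gram_def)

lemma \<alpha>_linear: "\<alpha> (x + y) = \<alpha> x + \<alpha> y" "\<alpha> (k *\<^sub>R x) = k * \<alpha> x" "\<alpha> (x - y) = \<alpha> x - \<alpha> y" "\<alpha> 0 = 0" "\<alpha> (- x) = - \<alpha> x"
  using gram_nonzero by (simp_all add: \<alpha>_def inner_add_left inner_diff_left field_simps)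

lemma \<beta>_linear: "\<beta> (x + y) = \<beta> x + \<beta> y" "\<beta> (k *\<^sub>R x) = k * \<beta> x" "\<beta> (x - y) = \<beta> x - \<beta> y" "\<beta> 0 = 0" "\<beta> (- x) = - \<beta> x"
  using gram_nonzero by (simp_all add: \<beta>_def inner_add_left inner_diff_left field_simps)

lemma \<alpha>\<beta>_du: "\<alpha> d = 1" "\<alpha> u = 0" "\<beta> d = 0" "\<beta> u = 1"
  using gram_nonzero by (simp_all add: \<alpha>_def \<beta>_def) (simp_all add: gram_def inner_commute power2_eq_square algebra_simps)

lemma \<gamma>_homogeneous: "k \<ge> 0 \<Longrightarrow> \<gamma> (k *\<^sub>R x) = k * \<gamma> x"
proof -
  assume k: "k \<ge> 0"
  have "k *\<^sub>R x - \<alpha> (k *\<^sub>R x) *\<^sub>R d - \<beta> (k *\<^sub>R x) *\<^sub>R u = k *\<^sub>R (x - \<alpha> x *\<^sub>R d - \<beta> x *\<^sub>R u)"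
    by (simp add: \<alpha>_linear \<beta>_linear algebra_simps)
  then show ?thesis using k by (simp add: \<gamma>_def)
qed

lemma \<gamma>_invariant: "\<gamma> (x + s *\<^sub>R d) = \<gamma> x" "\<gamma> (x - s *\<^sub>R d) = \<gamma> x" "\<gamma> (x + s *\<^sub>R u) = \<gamma> x"
  by (simp_all add: \<gamma>_def \<alpha>_linear \<beta>_linear \<alpha>\<beta>_du algebra_simps)

lemma \<gamma>_nonneg: "\<gamma> x \<ge> 0"
  by (simp add: \<gamma>_def)

lemma continuous_coords: "continuous_on S \<alpha>" "continuous_on S \<beta>" "continuous_on S \<gamma>"
proof -
  show 1: "continuous_on S \<alpha>" "continuous_on S \<beta>"
    unfolding \<alpha>_def \<beta>_def using gram_nonzero by (auto intro!: continuous_intros)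
  show "continuous_on S \<gamma>"
    unfolding \<gamma>_def by (intro continuous_intros 1)
qed

text \<open>
  The triangle in coordinates centred at the midpoint of \<open>a\<close> and \<open>b\<close>: it is the part with
  \<open>\<gamma> = 0\<close> and \<open>0 \<le> \<beta> \<le> 1 - \<bar>\<alpha>\<bar>\<close>.
\<close>

lemma in_triangleI:
  assumes "\<gamma> (x - mid) = 0" and "0 \<le> \<beta> (x - mid)" and "\<bar>\<alpha> (x - mid)\<bar> + \<beta> (x - mid) \<le> 1"
  shows "x \<in> convex hull {a, b, c}"
proof -
  define s t where "s = \<alpha> (x - mid)" and "t = \<beta> (x - mid)"
  have x: "x = mid + s *\<^sub>R d + t *\<^sub>R u"
    using assms(1) by (simp add: \<gamma>_def s_def t_def algebra_simps)
  define A B where "A = (1 - s - t) / 2" and "B = (1 + s - t) / 2"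
  have AB: "A + B + t = 1" "B - A = s" by (simp_all add: A_def B_def field_simps)
  have "A *\<^sub>R a + B *\<^sub>R b + t *\<^sub>R c = (A + B + t) *\<^sub>R mid + (B - A) *\<^sub>R d + t *\<^sub>R u"
    by (simp add: algebra_simps)
  then have "x = A *\<^sub>R a + B *\<^sub>R b + t *\<^sub>R c" unfolding AB x by simp
  moreover have "0 \<le> A" "0 \<le> B" "0 \<le> t"
    using assms by (auto simp: s_def t_def A_def B_def)
  ultimately show ?thesis
    using AB(1) unfolding convex_hull_3 by blast
qed

text \<open>
  The gauge of a small neighbourhood of the triangle: its unit ball is a double pyramid with apices
  at \<open>a\<close> and \<open>b\<close>, of thickness \<open>\<epsilon>\<close> below the edge \<open>ab\<close> and to the sides, and reaching up to height
  \<open>1 + \<epsilon>\<close> above it.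
\<close>

definition gauge where
  "gauge \<epsilon> y = \<bar>\<alpha> y\<bar> + \<gamma> y / \<epsilon> + max (- \<beta> y / \<epsilon>) (\<beta> y / (1 + \<epsilon>))"

lemma gauge_antimono: "0 < \<epsilon> \<Longrightarrow> \<epsilon> \<le> \<delta> \<Longrightarrow> gauge \<delta> y \<le> gauge \<epsilon> y"
proof -
  assume e: "0 < \<epsilon>" "\<epsilon> \<le> \<delta>"
  have g: "\<gamma> y / \<delta> \<le> \<gamma> y / \<epsilon>"
    using e \<gamma>_nonneg[of y] by (simp add: frac_le)
  have "max (- \<beta> y / \<delta>) (\<beta> y / (1 + \<delta>)) \<le> max (- \<beta> y / \<epsilon>) (\<beta> y / (1 + \<epsilon>))"
  proof (cases "\<beta> y \<ge> 0")
    case True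
    have "\<beta> y / (1 + \<delta>) \<le> \<beta> y / (1 + \<epsilon>)" "- \<beta> y / \<delta> \<le> 0" "0 \<le> \<beta> y / (1 + \<epsilon>)"
      using True e by (auto intro!: frac_le divide_nonneg_nonneg divide_nonpos_nonneg)
    then show ?thesis by linarith
  next
    case False
    have "(- \<beta> y) / \<delta> \<le> (- \<beta> y) / \<epsilon>" "\<beta> y / (1 + \<delta>) \<le> 0" "0 \<le> (- \<beta> y) / \<epsilon>"
      using False e by (intro frac_le divide_nonneg_nonneg divide_nonpos_nonneg; simp)+
    then show ?thesis by linarith
  qed
  then show ?thesis using g unfolding gauge_def by linarith
qed

text \<open>
  The neighbourhoods shrink to the triangle as \<open>\<epsilon>\<close> tends to 0, so every point
  outside it is eventually left out.
\<close>

lemma gauge_outside: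
  assumes "x \<notin> convex hull {a, b, c}"
  shows "\<exists>\<epsilon>>0. gauge \<epsilon> (x - mid) > 1"
proof -
  define s t g where "s = \<alpha> (x - mid)" and "t = \<beta> (x - mid)" and "g = \<gamma> (x - mid)"
  have g: "g \<ge> 0" by (simp add: g_def \<gamma>_nonneg)
  have *: "gauge \<epsilon> (x - mid) = \<bar>s\<bar> + g / \<epsilon> + max (- t / \<epsilon>) (t / (1 + \<epsilon>))" for \<epsilon>
    by (simp add: gauge_def s_def t_def g_def)
  consider "g > 0" | "t < 0" | "t \<ge> 0" "\<bar>s\<bar> + t > 1"
    using in_triangleI[of x] assms g unfolding s_def t_def g_def by fastforce
  then show ?thesis
  proof cases
    case 1
    have "g / (g / 2) = 2" using 1 by simp
    moreover have "max (- t / (g / 2)) (t / (1 + g / 2)) \<ge> 0"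
      using 1 by (cases "t \<ge> 0") (auto simp: le_max_iff_disj divide_nonpos_nonneg)
    ultimately have "gauge (g / 2) (x - mid) > 1" unfolding * by linarith
    then show ?thesis using 1 by (intro exI[of _ "g / 2"]) simp
  next
    case 2
    have "- t / (- t / 2) = 2" using 2 by simp
    moreover have "g / (- t / 2) \<ge> 0" using 2 g by (intro divide_nonneg_nonneg) auto
    ultimately have "gauge (- t / 2) (x - mid) > 1" unfolding * by linarith
    then show ?thesis using 2 by (intro exI[of _ "- t / 2"]) simp
  next
    case 3
    show ?thesis
    proof (cases "\<bar>s\<bar> > 1")
      case True
      have "t / (1 + 1) \<ge> 0" "g / 1 \<ge> 0" using 3 g by auto
      then have "gauge 1 (x - mid) > 1" unfolding * using True by linarith
      then show ?thesis by (intro exI[of _ 1]) simp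
    next
      case False
      define e where "e = (\<bar>s\<bar> + t - 1) / 2"
      have e: "e > 0" using 3 by (simp add: e_def)
      have "(1 - \<bar>s\<bar>) * (1 + e) = 1 - \<bar>s\<bar> + (1 - \<bar>s\<bar>) * e" by (simp add: algebra_simps)
      also have "\<dots> \<le> 1 - \<bar>s\<bar> + 1 * e"
        using e by (intro add_left_mono mult_right_mono) auto
      also have "\<dots> < t" using 3 by (simp add: e_def field_simps)
      finally have "t / (1 + e) > 1 - \<bar>s\<bar>" using e by (simp add: field_simps)
      moreover have "g / e \<ge> 0" using g e by simp
      ultimately have "gauge e (x - mid) > 1" unfolding * by linarith
      then show ?thesis using e by blast
    qed
  qed
qed

lemma continuous_gauge: "\<epsilon> > 0 \<Longrightarrow> continuous_on S (\<lambda>x. gauge \<epsilon> (x - p))"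
  unfolding gauge_def
  by (intro continuous_intros continuous_on_compose2[OF continuous_coords(1)[of UNIV]]
      continuous_on_compose2[OF continuous_coords(2)[of UNIV]] continuous_on_compose2[OF continuous_coords(3)[of UNIV]]) auto

text \<open>
  Since the neighbourhoods are nested, compactness turns the bound for points into a uniform one.
\<close>

lemma gauge_compact:
  assumes "compact S" and "S \<inter> convex hull {a, b, c} = {}"
  shows "\<exists>\<epsilon>>0. \<forall>x\<in>S. gauge \<epsilon> (x - mid) \<ge> 1"
proof -
  define U where "U \<epsilon> = {x. gauge \<epsilon> (x - mid) > 1}" for \<epsilon>
  have op: "open (U \<epsilon>)" if "\<epsilon> \<in> {0<..}" for \<epsilon>
    unfolding U_def using that by (intro open_Collect_less continuous_gauge continuous_intros) auto
  have cov: "S \<subseteq> (\<Union>\<epsilon>\<in>{0<..}. U \<epsilon>)"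
    using gauge_outside assms(2) by (fastforce simp: U_def)
  obtain F where F: "F \<subseteq> {0<..}" "finite F" "S \<subseteq> (\<Union>\<epsilon>\<in>F. U \<epsilon>)"
    using compactE_image[OF assms(1) op cov] by metis
  define e where "e = Min (insert 1 F)"
  have e: "e > 0" using F(1,2) by (auto simp: e_def)
  have "gauge e (x - mid) \<ge> 1" if x: "x \<in> S" for x
  proof -
    obtain \<epsilon> where "\<epsilon> \<in> F" "x \<in> U \<epsilon>" using x F(3) by blast
    then have \<epsilon>: "\<epsilon> \<in> F" "gauge \<epsilon> (x - mid) > 1" by (simp_all add: U_def)
    then have "e \<le> \<epsilon>" using F(2) by (simp add: e_def)
    then show ?thesis using gauge_antimono[OF e, of \<epsilon> "x - mid"] \<epsilon>(2) by simp
  qed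
  then show ?thesis using e by blast
qed

text \<open>
  Near the vertices \<open>a\<close> and \<open>b\<close> smallness of \<open>\<epsilon>\<close> alone does not separate the neighbourhood from
  other pieces ending there; here straightness is needed: a segment starting at such a vertex
  either enters the triangle or leaves every thin enough neighbourhood at once.
\<close>

lemma gauge_vertex:
  assumes p: "p = mid - \<sigma> *\<^sub>R d" and \<sigma>: "\<sigma> = 1 \<or> \<sigma> = -1"
    and meet: "closed_segment p q \<inter> convex hull {a, b, c} \<subseteq> {a, b}"
  shows "\<exists>\<epsilon>>0. \<forall>x\<in>closed_segment p q. gauge \<epsilon> (x - mid) \<ge> 1"
proof -
  define w where "w = q - p"
  define A B G where "A = \<sigma> * \<alpha> w" and "B = \<beta> w" and "G = \<gamma> w"
  have G: "G \<ge> 0" by (simp add: G_def \<gamma>_nonneg)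
  have coords: "\<sigma> * \<alpha> (p + l *\<^sub>R w - mid) = - 1 + l * A" "\<beta> (p + l *\<^sub>R w - mid) = l * B"
    "\<gamma> (p + l *\<^sub>R w - mid) = l * G" if "l \<ge> 0" for l
  proof -
    have eq: "p + l *\<^sub>R w - mid = l *\<^sub>R w - \<sigma> *\<^sub>R d" by (simp add: p)
    show "\<sigma> * \<alpha> (p + l *\<^sub>R w - mid) = - 1 + l * A" "\<beta> (p + l *\<^sub>R w - mid) = l * B"
      unfolding eq using \<sigma> by (auto simp: \<alpha>_linear \<beta>_linear \<alpha>\<beta>_du A_def B_def)
    show "\<gamma> (p + l *\<^sub>R w - mid) = l * G"
      unfolding eq by (simp add: \<gamma>_invariant \<gamma>_homogeneous that G_def)
  qed
  have abs: "\<bar>\<alpha> y\<bar> = \<bar>\<sigma> * \<alpha> y\<bar>" for y using \<sigma> by auto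
  have seg: "closed_segment p q = {p + l *\<^sub>R w |l. 0 \<le> l \<and> l \<le> 1}"
    unfolding closed_segment_def w_def by (simp add: algebra_simps)
  show ?thesis
  proof (cases "w = 0 \<or> \<not> (G = 0 \<and> 0 \<le> B \<and> B \<le> A)")
    case False
    \<comment> \<open>a point of the segment so close to p that it still lies on the same half of the base as p\<close>
    define l where "l = 1 / (A + 1)"
    have l: "0 < l" "l \<le> 1" "l * A < 1"
      using False by (auto simp: l_def field_simps)
    moreover have "l * B \<le> l * A" using False l by (intro mult_left_mono) auto
    ultimately have l: "0 < l" "l \<le> 1" "l * A < 1" "l * B \<le> l * A" by auto
    define x where "x = p + l *\<^sub>R w"
    have "x \<in> convex hull {a, b, c}"
      by (rule in_triangleI) (use coords[of l] False l abs[of "x - mid"] in \<open>auto simp: x_def\<close>)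
    moreover have "x \<in> closed_segment p q" unfolding seg x_def using l by auto
    ultimately have x: "x \<in> {a, b}" using meet by blast
    moreover have "a = mid - \<sigma> *\<^sub>R d \<and> b = mid + \<sigma> *\<^sub>R d \<or> b = mid - \<sigma> *\<^sub>R d \<and> a = mid + \<sigma> *\<^sub>R d"
      using \<sigma> by auto
    moreover have "x \<noteq> p" using False l by (simp add: x_def)
    ultimately have "x = mid + \<sigma> *\<^sub>R d" using p by auto
    then have "\<sigma> * \<alpha> (x - mid) = 1" using \<sigma> by (auto simp: \<alpha>_linear \<alpha>\<beta>_du)
    then have False using coords(1)[of l] l by (simp add: x_def)
    then show ?thesis ..
  next
    case True
    have "\<exists>\<epsilon>>0. w = 0 \<or> G / \<epsilon> + max (- B / \<epsilon>) (B / (1 + \<epsilon>)) \<ge> A"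
    proof -
      consider "w = 0" | "G > 0" | "B < 0" | "B \<ge> 0" "B > A" using True G by linarith
      then show ?thesis
      proof cases
        case 2
        define e where "e = G / (\<bar>A\<bar> + 1)"
        have e: "e > 0" "G / e = \<bar>A\<bar> + 1" using 2 by (auto simp: e_def)
        have "max (- B / e) (B / (1 + e)) \<ge> 0"
          using e by (cases "B \<ge> 0") (auto simp: le_max_iff_disj divide_nonpos_nonneg)
        then have "G / e + max (- B / e) (B / (1 + e)) \<ge> A" using e by linarith
        then show ?thesis using e by blast
      next
        case 3
        define e where "e = - B / (\<bar>A\<bar> + 1)"
        have e: "e > 0" "- B / e = \<bar>A\<bar> + 1" using 3 by (auto simp: e_def field_simps)
        have "G / e \<ge> 0" using e G by simp
        then have "G / e + max (- B / e) (B / (1 + e)) \<ge> A" using e by linarith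
        then show ?thesis using e by blast
      next
        case 4
        define e where "e = (B - A) / (\<bar>A\<bar> + 1)"
        have e: "e > 0" using 4 by (auto simp: e_def)
        have "A * e \<le> B - A"
        proof -
          have "A * e \<le> (\<bar>A\<bar> + 1) * e" using e by (intro mult_right_mono) auto
          also have "\<dots> = B - A" by (simp add: e_def)
          finally show ?thesis .
        qed
        then have "B / (1 + e) \<ge> A" using e by (simp add: field_simps)
        moreover have "G / e \<ge> 0" using e G by simp
        ultimately have "G / e + max (- B / e) (B / (1 + e)) \<ge> A" by linarith
        then show ?thesis using e by blast
      qed (use zero_less_one in blast)
    qed
    then obtain \<epsilon> where \<epsilon>: "\<epsilon> > 0" "w = 0 \<or> G / \<epsilon> + max (- B / \<epsilon>) (B / (1 + \<epsilon>)) \<ge> A"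
      by blast
    have "gauge \<epsilon> (p + l *\<^sub>R w - mid) \<ge> 1" if l: "0 \<le> l" for l
    proof (cases "w = 0")
      case True
      then have "A = 0" "B = 0" "G = 0" by (auto simp: A_def B_def G_def \<alpha>_linear \<beta>_linear \<gamma>_def)
      then show ?thesis using coords[OF l] abs[of "p + l *\<^sub>R w - mid"] by (simp add: gauge_def)
    next
      case False
      have "gauge \<epsilon> (p + l *\<^sub>R w - mid) = \<bar>- 1 + l * A\<bar> + l * G / \<epsilon> + max (- (l * B) / \<epsilon>) (l * B / (1 + \<epsilon>))"
        unfolding gauge_def abs coords[OF l] ..
      also have "max (- (l * B) / \<epsilon>) (l * B / (1 + \<epsilon>)) = l * max (- B / \<epsilon>) (B / (1 + \<epsilon>))"
        using l by (simp add: max_mult_distrib_left)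
      also have "\<bar>- 1 + l * A\<bar> + l * G / \<epsilon> + l * max (- B / \<epsilon>) (B / (1 + \<epsilon>))
          = \<bar>- 1 + l * A\<bar> + l * (G / \<epsilon> + max (- B / \<epsilon>) (B / (1 + \<epsilon>)))"
        by (simp add: algebra_simps)
      also have "\<dots> \<ge> (1 - l * A) + l * A"
        by (intro add_mono mult_left_mono) (use \<epsilon>(2) False l in auto)
      finally show ?thesis by simp
    qed
    then show ?thesis using \<epsilon>(1) unfolding seg by blast
  qed
qed

lemma gauge_segment:
  assumes meet: "closed_segment p q \<inter> convex hull {a, b, c} \<subseteq> {a, b}"
  shows "\<exists>\<epsilon>>0. \<forall>x\<in>closed_segment p q. gauge \<epsilon> (x - mid) \<ge> 1"
proof (cases "\<exists>\<sigma>. (\<sigma> = 1 \<or> \<sigma> = -1) \<and> mid - \<sigma> *\<^sub>R d \<in> closed_segment p q")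
  case True
  then obtain \<sigma> v where \<sigma>: "\<sigma> = 1 \<or> \<sigma> = -1" "v = mid - \<sigma> *\<^sub>R d" "v \<in> closed_segment p q" by blast
  have sub: "closed_segment v p \<subseteq> closed_segment p q" "closed_segment v q \<subseteq> closed_segment p q"
    using \<sigma>(3) by (auto simp: subset_closed_segment)
  obtain e1 where e1: "e1 > 0" "\<forall>x\<in>closed_segment v p. gauge e1 (x - mid) \<ge> 1"
    using gauge_vertex[OF \<sigma>(2,1), of p] sub meet by blast
  obtain e2 where e2: "e2 > 0" "\<forall>x\<in>closed_segment v q. gauge e2 (x - mid) \<ge> 1"
    using gauge_vertex[OF \<sigma>(2,1), of q] sub meet by blast
  have "closed_segment p q = closed_segment v p \<union> closed_segment v q"
    using Un_closed_segment[OF \<sigma>(3)] by (simp add: closed_segment_commute)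
  moreover have "gauge (min e1 e2) (x - mid) \<ge> 1" if "x \<in> closed_segment v p \<union> closed_segment v q" for x
    using that e1 e2 gauge_antimono[of "min e1 e2" e1 "x - mid"] gauge_antimono[of "min e1 e2" e2 "x - mid"]
    by force
  ultimately show ?thesis using e1(1) e2(1) by (metis min_less_iff_conj)
next
  case False
  have "mid - 1 *\<^sub>R d = a" "mid - (-1) *\<^sub>R d = b" by simp_all
  then have "a \<notin> closed_segment p q" "b \<notin> closed_segment p q" using False by metis+
  then show ?thesis using meet by (intro gauge_compact) auto
qed

text \<open>
  The speed of the push. It is \<open>1 - \<bar>\<alpha>\<bar>\<close> on the base, which is what carries
  the base to the other two sides, and it decreases in the direction of \<open>u\<close> with slope at
  most \<open>1 / (1 + \<epsilon>)\<close>. As this is less than 1, points in front of the base are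
  compressed but never overtaken.
\<close>

definition tent where "tent \<epsilon> x = max 0 (1 - gauge \<epsilon> (x - mid))"

lemma norm_add4: "norm (p + q + r + s) \<le> norm p + norm q + norm r + norm s" for p :: space3
  by (intro norm_triangle_le add_right_mono norm_triangle_ineq)

lemma tent_isotopy:
  assumes \<epsilon>: "\<epsilon> > 0"
  shows "isotopic K ((\<lambda>x. x + tent \<epsilon> x *\<^sub>R u) ` K)"
  unfolding isotopic_def
proof (rule push_isotopy)
  show "continuous_on UNIV (tent \<epsilon>)"
    unfolding tent_def using \<epsilon> by (intro continuous_intros continuous_gauge) auto
  show "strict_mono (\<lambda>s. s + tent \<epsilon> (x + s *\<^sub>R u))" for x
  proof (rule strict_monoI)
    fix s t :: real assume st: "s < t"
    define y where "y = x - mid"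
    define g where "g r = max (- (\<beta> y + r) / \<epsilon>) ((\<beta> y + r) / (1 + \<epsilon>))" for r
    have gg: "gauge \<epsilon> (x + r *\<^sub>R u - mid) = \<bar>\<alpha> y\<bar> + \<gamma> y / \<epsilon> + g r" for r
    proof -
      have yr: "x + r *\<^sub>R u - mid = y + r *\<^sub>R u" by (simp add: y_def)
      show ?thesis
        unfolding yr by (simp add: gauge_def \<alpha>_linear \<beta>_linear \<alpha>\<beta>_du \<gamma>_invariant g_def)
    qed
    have "(\<beta> y + t) / (1 + \<epsilon>) = (\<beta> y + s) / (1 + \<epsilon>) + (t - s) / (1 + \<epsilon>)"
      by (simp add: add_divide_distrib diff_divide_distrib)
    moreover have "- (\<beta> y + t) / \<epsilon> \<le> - (\<beta> y + s) / \<epsilon>"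
      using st \<epsilon> by (intro divide_right_mono) auto
    moreover have "(t - s) / (1 + \<epsilon>) < t - s" "0 < (t - s) / (1 + \<epsilon>)"
      using st \<epsilon> by (auto simp: field_simps)
    ultimately have "g t < g s + (t - s)"
      unfolding g_def by linarith
    then show "s + tent \<epsilon> (x + s *\<^sub>R u) < t + tent \<epsilon> (x + t *\<^sub>R u)"
      unfolding tent_def gg using st by linarith
  qed
  show "tent \<epsilon> x = 0" if "norm x > norm mid + norm d + (1 + \<epsilon>) * norm u + \<epsilon>" for x
  proof (rule ccontr)
    assume "tent \<epsilon> x \<noteq> 0"
    define y where "y = x - mid"
    have 1: "\<bar>\<alpha> y\<bar> + \<gamma> y / \<epsilon> + max (- \<beta> y / \<epsilon>) (\<beta> y / (1 + \<epsilon>)) < 1"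
      using \<open>tent \<epsilon> x \<noteq> 0\<close> by (auto simp: tent_def gauge_def y_def max_def split: if_splits)
    have 2: "\<gamma> y / \<epsilon> \<ge> 0" using \<epsilon> \<gamma>_nonneg by simp
    have 3: "max (- \<beta> y / \<epsilon>) (\<beta> y / (1 + \<epsilon>)) \<ge> 0"
      using \<epsilon> by (cases "\<beta> y \<ge> 0") (auto simp: le_max_iff_disj divide_nonpos_nonneg)
    have 4: "\<bar>\<alpha> y\<bar> \<le> 1" "\<gamma> y / \<epsilon> \<le> 1" "- \<beta> y / \<epsilon> \<le> 1" "\<beta> y / (1 + \<epsilon>) \<le> 1"
      using 1 2 3 by linarith+
    then have 5: "\<gamma> y \<le> \<epsilon>" "\<bar>\<beta> y\<bar> \<le> 1 + \<epsilon>" using \<epsilon> by (auto simp: field_simps)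
    have "x = mid + \<alpha> y *\<^sub>R d + \<beta> y *\<^sub>R u + (y - \<alpha> y *\<^sub>R d - \<beta> y *\<^sub>R u)"
      by (simp add: y_def)
    then have "norm x \<le> norm mid + norm (\<alpha> y *\<^sub>R d) + norm (\<beta> y *\<^sub>R u) + \<gamma> y"
      unfolding \<gamma>_def by (metis norm_add4)
    also have "\<dots> \<le> norm mid + norm d + (1 + \<epsilon>) * norm u + \<epsilon>"
      using 4(1) 5 by (intro add_mono) (auto intro!: mult_right_mono mult_left_le_one_le)
    finally show False using that by simp
  qed
qed

lemma tent_image_edge:
  "(\<lambda>x. x + tent \<epsilon> x *\<^sub>R u) ` closed_segment a b = closed_segment a c \<union> closed_segment c b"
proof -
  have m: "mid \<in> closed_segment a b"
  proof -
    have "(1 / 2) *\<^sub>R v + (1 / 2) *\<^sub>R v = v" for v :: space3 by (simp flip: scaleR_add_left)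
    then have "mid = (1 - 1 / 2) *\<^sub>R a + (1 / 2) *\<^sub>R b" by (simp add: algebra_simps)
    then show ?thesis unfolding closed_segment_def by fastforce
  qed
  have half: "(\<lambda>x. x + tent \<epsilon> x *\<^sub>R u) ` closed_segment mid (mid + \<sigma> *\<^sub>R d)
      = closed_segment (mid + u) (mid + \<sigma> *\<^sub>R d)" if "\<sigma> = 1 \<or> \<sigma> = -1" for \<sigma>
  proof -
    have seg: "closed_segment mid (mid + \<sigma> *\<^sub>R d) = (\<lambda>l. mid + (l * \<sigma>) *\<^sub>R d) ` {0..1}"
      unfolding closed_segment_image_interval by (intro image_cong) (auto simp: algebra_simps)
    have seg': "closed_segment (mid + u) (mid + \<sigma> *\<^sub>R d) = (\<lambda>l. mid + (l * \<sigma>) *\<^sub>R d + (1 - l) *\<^sub>R u) ` {0..1}"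
      unfolding closed_segment_image_interval by (intro image_cong) (auto simp: algebra_simps)
    have "tent \<epsilon> (mid + (l * \<sigma>) *\<^sub>R d) = 1 - l" if "l \<in> {0..1}" for l
      using that \<open>\<sigma> = 1 \<or> \<sigma> = -1\<close>
      by (auto simp: tent_def gauge_def \<alpha>_linear \<beta>_linear \<alpha>\<beta>_du \<gamma>_def)
    then show ?thesis unfolding seg seg' image_image by (intro image_cong) auto
  qed
  have "closed_segment a b = closed_segment mid a \<union> closed_segment mid b"
    using Un_closed_segment[OF m] by (simp add: closed_segment_commute)
  then show ?thesis
    using half[of 1] half[of "-1"] by (simp add: image_Un closed_segment_commute Un_commute)
qed

end

text \<open>
  Links of diagrams are finite unions of segments; closedness alone would not keep other pieces away from
  the triangle near the ends of its base.
\<close>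

definition polygonal :: "space3 set \<Rightarrow> bool" where
  "polygonal K \<longleftrightarrow> (\<exists>S. finite S \<and> K = (\<Union>(p, q)\<in>S. closed_segment p q))"

lemma polygonal_segment [simp]: "polygonal (closed_segment p q)"
  unfolding polygonal_def by (intro exI[of _ "{(p, q)}"]) auto

lemma polygonal_empty [simp]: "polygonal {}"
  unfolding polygonal_def by (intro exI[of _ "{}"]) auto

lemma polygonal_point [simp]: "polygonal {p}"
  using polygonal_segment[of p p] by simp

lemma polygonal_Un [simp]: "polygonal K \<Longrightarrow> polygonal L \<Longrightarrow> polygonal (K \<union> L)"
  unfolding polygonal_def by (metis (no_types, lifting) UN_Un finite_UnI)

lemma polygonal_UN: "finite I \<Longrightarrow> (\<And>i. i \<in> I \<Longrightarrow> polygonal (f i)) \<Longrightarrow> polygonal (\<Union>i\<in>I. f i)"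
  by (induction I rule: finite_induct) auto

text \<open>
  The elementary move for polygonal links. The neighbourhood of the triangle is chosen thin enough to
  avoid the rest \<open>K\<close>; outside of it the push does not move anything.
\<close>

proposition triangle_move:
  assumes K: "polygonal K" and nc: "\<not> collinear {a, b, c}"
    and meet: "K \<inter> convex hull {a, b, c} \<subseteq> {a, b}"
  shows "isotopic (K \<union> closed_segment a b) (K \<union> closed_segment a c \<union> closed_segment c b)"
proof -
  define mid d u where "mid = (1 / 2) *\<^sub>R (a + b)" and "d = (1 / 2) *\<^sub>R (b - a)" and "u = c - mid"
  have abc: "a = mid - d" "b = mid + d" "c = mid + u"
    by (simp_all add: mid_def d_def u_def algebra_simps flip: scaleR_add_left)
  have "(d \<bullet> u)\<^sup>2 \<noteq> (d \<bullet> d) * (u \<bullet> u)"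
  proof
    assume "(d \<bullet> u)\<^sup>2 = (d \<bullet> d) * (u \<bullet> u)"
    then have "(\<bar>d \<bullet> u\<bar>)\<^sup>2 = (norm d * norm u)\<^sup>2"
      by (simp add: power_mult_distrib power2_norm_eq_inner)
    then have "\<bar>d \<bullet> u\<bar> = norm d * norm u"
      by (rule power2_eq_imp_eq) auto
    then have "collinear {0, d, u}"
      using norm_cauchy_schwarz_equal by blast
    then consider "d = 0" | k where "u = k *\<^sub>R d"
      unfolding collinear_lemma by (metis scaleR_zero_left)
    then have "collinear {a, b, c}"
    proof cases
      case 1
      then show ?thesis unfolding abc by simp
    next
      case 2
      then have "c = a + (1 + k) *\<^sub>R d" "b = a + 2 *\<^sub>R d" "a = a + 0 *\<^sub>R d"
        unfolding abc by (simp_all add: algebra_simps scaleR_2)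
      then show ?thesis
        unfolding collinear_alt by (intro exI[of _ a] exI[of _ d]) auto
    qed
    then show False using nc by simp
  qed
  then interpret triangle mid d u
    using Cauchy_Schwarz_ineq[of d u] by unfold_locales simp
  obtain S where S: "finite S" "K = (\<Union>(p, q)\<in>S. closed_segment p q)"
    using K by (auto simp: polygonal_def)
  have "\<exists>\<epsilon>>0. \<forall>x\<in>(\<Union>(p, q)\<in>S'. closed_segment p q). gauge \<epsilon> (x - mid) \<ge> 1" if "S' \<subseteq> S" for S'
    using finite_subset[OF that S(1)] that
  proof (induction S' rule: finite_induct)
    case (insert z S')
    obtain p q where z: "z = (p, q)" by (cases z)
    have "closed_segment p q \<inter> convex hull {a, b, c} \<subseteq> {a, b}"
      using meet S(2) insert.prems z unfolding abc by blast
    then obtain e1 where e1: "e1 > 0" "\<forall>x\<in>closed_segment p q. gauge e1 (x - mid) \<ge> 1"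
      using gauge_segment[folded abc] by blast
    obtain e2 where e2: "e2 > 0" "\<forall>x\<in>(\<Union>(p, q)\<in>S'. closed_segment p q). gauge e2 (x - mid) \<ge> 1"
      using insert by auto
    show ?case
    proof (intro exI[of _ "min e1 e2"] conjI ballI)
      fix x assume "x \<in> (\<Union>(p, q)\<in>insert z S'. closed_segment p q)"
      then have "gauge e1 (x - mid) \<ge> 1 \<or> gauge e2 (x - mid) \<ge> 1"
        using e1 e2 z by blast
      then show "gauge (min e1 e2) (x - mid) \<ge> 1"
        using e1 e2 gauge_antimono[of "min e1 e2" e1 "x - mid"] gauge_antimono[of "min e1 e2" e2 "x - mid"]
        by auto
    qed (use e1 e2 in auto)
  qed (auto intro: exI[of _ 1])
  from this[OF subset_refl] obtain \<epsilon> where \<epsilon>: "\<epsilon> > 0" "\<And>x. x \<in> K \<Longrightarrow> gauge \<epsilon> (x - mid) \<ge> 1"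
    unfolding S(2)[symmetric] by metis
  have "(\<lambda>x. x + tent \<epsilon> x *\<^sub>R u) ` K = (\<lambda>x. x) ` K"
    by (rule image_cong) (use \<epsilon>(2) in \<open>auto simp: tent_def\<close>)
  then show ?thesis
    using tent_isotopy[OF \<epsilon>(1), of "K \<union> closed_segment a b"]
    by (simp add: image_Un tent_image_edge[folded abc] Un_assoc)
qed

section \<open>Overpasses and underpasses of polygonal arcs\<close>

fun polyline :: "'a::real_vector list \<Rightarrow> 'a set" where
  "polyline [] = {}"
| "polyline [x] = {x}"
| "polyline (x # y # zs) = closed_segment x y \<union> polyline (y # zs)"

fun simple_polyline :: "'a::real_vector list \<Rightarrow> bool" where
  "simple_polyline (x # y # zs) \<longleftrightarrow>
     x \<noteq> y \<and> closed_segment x y \<inter> polyline (y # zs) \<subseteq> {y} \<and> simple_polyline (y # zs)"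
| "simple_polyline _ \<longleftrightarrow> True"

lemma set_subset_polyline: "set xs \<subseteq> polyline xs"
  by (induction xs rule: polyline.induct) auto

lemma polygonal_polyline [simp]: "polygonal (polyline xs)"
  by (induction xs rule: polyline.induct) auto

lemma linear_fst: "linear fst"
  by (rule linearI) auto

lemma fst_in_closed_segment: "z \<in> closed_segment x y \<Longrightarrow> fst z \<in> closed_segment (fst x) (fst y)"
  using closed_segment_linear_image[OF linear_fst] by blast

lemma fst_in_polyline: "z \<in> polyline xs \<Longrightarrow> fst z \<in> polyline (map fst xs)"
  by (induction xs rule: polyline.induct) (auto dest: fst_in_closed_segment)

text \<open>
  A polygon with a simple projection has a single point above the projection of its first vertex.
\<close>

lemma simple_polyline_over_hd:
  assumes "simple_polyline (map fst (y # zs))" and "z \<in> polyline (y # zs)" and "fst z = fst y"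
  shows "z = y"
  using assms
proof (cases zs)
  case (Cons y' zs')
  have ne: "fst y \<noteq> fst y'" and inter: "closed_segment (fst y) (fst y') \<inter> polyline (fst y' # map fst zs') \<subseteq> {fst y'}"
    using assms(1) Cons by auto
  have "z \<notin> polyline (y' # zs')"
    using inter ne assms(3) fst_in_polyline[of z "y' # zs'"] by auto
  then have "z \<in> closed_segment y y'"
    using assms(2) Cons by auto
  then obtain t where z: "z = (1 - t) *\<^sub>R y + t *\<^sub>R y'" by (auto simp: closed_segment_def)
  have "fst z = fst y + t *\<^sub>R (fst y' - fst y)" unfolding z by (simp add: algebra_simps)
  then have "t = 0" using ne assms(3) by simp
  then show ?thesis using z by simp
qed simp

lemma closed_segment_weightsE:
  assumes "z \<in> closed_segment x y"
  obtains t where "0 \<le> t" "t \<le> 1" "z = (1 - t) *\<^sub>R x + t *\<^sub>R y"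
  using assms by (auto simp: closed_segment_def)

lemma snd_closed_segment_bounds:
  assumes "z \<in> closed_segment x (y :: space3)"
  shows "min (snd x) (snd y) \<le> snd z" and "snd z \<le> max (snd x) (snd y)"
proof -
  obtain t where t: "0 \<le> t" "t \<le> 1" "z = (1 - t) *\<^sub>R x + t *\<^sub>R y"
    using assms by (rule closed_segment_weightsE)
  have "snd z \<in> closed_segment (snd x) (snd y)"
    using t by (auto simp: closed_segment_def)
  then show "min (snd x) (snd y) \<le> snd z" and "snd z \<le> max (snd x) (snd y)"
    by (auto simp: closed_segment_eq_real_ivl split: if_splits)
qed

lemma snd_polyline_less:
  "(\<And>x. x \<in> set xs \<Longrightarrow> snd x < (M :: real)) \<Longrightarrow> z \<in> polyline xs \<Longrightarrow> snd z < M" for z :: space3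
proof (induction xs rule: polyline.induct)
  case (3 x y zs)
  have "snd x < M" "snd y < M" "z \<in> polyline (y # zs) \<Longrightarrow> snd z < M"
    using "3.IH" "3.prems"(1) by (auto simp del: split_paired_All)
  moreover have "z \<in> closed_segment x y \<Longrightarrow> snd z \<le> max (snd x) (snd y)"
    by (rule snd_closed_segment_bounds)
  ultimately show ?case using "3.prems"(2) by fastforce
qed auto

lemma noncollinear_vertical:
  assumes "fst p = fst q" and "p \<noteq> q" and "fst r \<noteq> fst p"
  shows "\<not> collinear {p, q, r :: space3}"
proof
  assume "collinear {p, q, r}"
  then obtain w where w: "\<And>x y. x \<in> {p, q, r} \<Longrightarrow> y \<in> {p, q, r} \<Longrightarrow> \<exists>k. x - y = k *\<^sub>R w"
    unfolding collinear_def by blast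
  obtain k where k: "p - q = k *\<^sub>R w" using w[of p q] by auto
  obtain l where l: "r - p = l *\<^sub>R w" using w[of r p] by auto
  have "k *\<^sub>R fst w = 0" using arg_cong[OF k, of fst] assms(1) by simp
  moreover have "k \<noteq> 0" using k assms(2) by auto
  ultimately have "fst w = 0" by simp
  then have "fst r - fst p = 0" using arg_cong[OF l, of fst] by simp
  then show False using assms(3) by simp
qed

lemma noncollinear_horizontal:
  assumes "snd p = snd q" and "p \<noteq> q" and "snd r \<noteq> snd p"
  shows "\<not> collinear {p, q, r :: space3}"
proof
  assume "collinear {p, q, r}"
  then obtain w where w: "\<And>x y. x \<in> {p, q, r} \<Longrightarrow> y \<in> {p, q, r} \<Longrightarrow> \<exists>k. x - y = k *\<^sub>R w"
    unfolding collinear_def by blast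
  obtain k where k: "p - q = k *\<^sub>R w" using w[of p q] by auto
  obtain l where l: "r - p = l *\<^sub>R w" using w[of r p] by auto
  have "k * snd w = 0" using arg_cong[OF k, of snd] assms(1) by simp
  moreover have "k \<noteq> 0" using k assms(2) by auto
  ultimately have "snd w = 0" by simp
  then have "snd r - snd p = 0" using arg_cong[OF l, of snd] by simp
  then show False using assms(3) by simp
qed

text \<open>
  The vertical fence between the segment \<open>xy\<close> and its copy at height \<open>M\<close> is cut by a diagonal into
  two triangles; in both, \<open>t\<close> is the horizontal position.
\<close>

lemma lower_fence_triangle:
  assumes "z \<in> convex hull {(fst x, M), y, x :: space3}" and "snd x < M" and "snd y < M"
  obtains t where "0 \<le> t" "t \<le> 1" "fst z = (1 - t) *\<^sub>R fst x + t *\<^sub>R fst y"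
    "(1 - t) * snd x + t * snd y \<le> snd z" "t = 1 \<Longrightarrow> z = y" "t = 0 \<Longrightarrow> fst z = fst x"
    "snd z \<ge> M \<Longrightarrow> z = (fst x, M)"
proof -
  obtain l t m where lm: "0 \<le> l" "0 \<le> t" "0 \<le> m" "l + t + m = 1"
    "z = l *\<^sub>R (fst x, M) + t *\<^sub>R y + m *\<^sub>R x"
    using assms(1) unfolding convex_hull_3 by blast
  have m: "m = 1 - t - l" using lm(4) by simp
  have fz: "fst z = (1 - t) *\<^sub>R fst x + t *\<^sub>R fst y"
    unfolding lm(5) m by (simp add: algebra_simps)
  have sz: "snd z = l * M + t * snd y + m * snd x"
    unfolding lm(5) by simp
  have "l * snd x \<le> l * M" using lm(1) assms(2) by (intro mult_left_mono) auto
  then have low: "(1 - t) * snd x + t * snd y \<le> snd z"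
    unfolding sz m by (simp add: algebra_simps)
  have one: "z = y" if "t = 1"
  proof -
    have "l = 0" "m = 0" using that lm by auto
    then show ?thesis using that lm(5) by (simp flip: zero_prod_def)
  qed
  have top: "z = (fst x, M)" if "snd z \<ge> M"
  proof -
    have "M = l * M + t * M + m * M" using lm(4) by (metis distrib_right mult_1)
    then have "t * (M - snd y) + m * (M - snd x) \<le> 0"
      using that sz by (simp add: algebra_simps)
    moreover have "0 \<le> t * (M - snd y)" "0 \<le> m * (M - snd x)"
      using lm(2,3) assms(2,3) by auto
    ultimately have "t * (M - snd y) = 0" "m * (M - snd x) = 0" by linarith+
    then have "t = 0" "m = 0" using assms(2,3) by auto
    then show ?thesis using lm(4,5) by simp
  qed
  show ?thesis
    by (rule that[of t]) (use lm fz low one top in auto)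
qed

lemma upper_fence_triangle:
  assumes "z \<in> convex hull {(fst x, M), y, (fst y, M) :: space3}" and "snd x < M" and "snd y < M"
  obtains t where "0 \<le> t" "t \<le> 1" "fst z = (1 - t) *\<^sub>R fst x + t *\<^sub>R fst y"
    "(1 - t) * snd x + t * snd y \<le> snd z" "t = 0 \<Longrightarrow> z = (fst x, M)"
proof -
  obtain l t m where lm: "0 \<le> l" "0 \<le> t" "0 \<le> m" "l + t + m = 1"
    "z = l *\<^sub>R (fst x, M) + t *\<^sub>R y + m *\<^sub>R (fst y, M)"
    using assms(1) unfolding convex_hull_3 by blast
  have l: "l = 1 - (t + m)" using lm(4) by simp
  have fz: "fst z = (1 - (t + m)) *\<^sub>R fst x + (t + m) *\<^sub>R fst y"
    unfolding lm(5) l by (simp add: algebra_simps)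
  have sz: "snd z = l * M + t * snd y + m * M"
    unfolding lm(5) by simp
  have "l * snd x \<le> l * M" "m * snd y \<le> m * M" using lm assms(2,3) by (auto intro!: mult_left_mono)
  then have low: "(1 - (t + m)) * snd x + (t + m) * snd y \<le> snd z"
    unfolding sz l by (simp add: algebra_simps)
  have zero: "z = (fst x, M)" if "t + m = 0"
  proof -
    have "t = 0" "m = 0" using that lm by auto
    then show ?thesis using lm(4,5) by simp
  qed
  show ?thesis
    by (rule that[of "t + m"]) (use lm fz low zero in auto)
qed

text \<open>
  In a triangle with horizontal base at height \<open>M\<close> and apex at height \<open>M + 1\<close>, a
  point is found by first choosing a point \<open>y\<close> of the base and then going from it towards the
  apex.
\<close>

lemma cap_triangle:
  assumes "z \<in> convex hull {(v, M), (v', M), (c, M + 1) :: space3}"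
  obtains s y where "0 \<le> s" "s \<le> 1" "y \<in> closed_segment v v'" "snd z = M + s"
    "fst z = (1 - s) *\<^sub>R y + s *\<^sub>R c"
proof -
  obtain l t s where lm: "0 \<le> l" "0 \<le> t" "0 \<le> s" "l + t + s = 1"
    "z = l *\<^sub>R (v, M) + t *\<^sub>R (v', M) + s *\<^sub>R (c, M + 1)"
    using assms unfolding convex_hull_3 by blast
  have "snd z = (l + t + s) * M + s" unfolding lm(5) by (simp add: algebra_simps)
  then have sz: "snd z = M + s" using lm(4) by simp
  show ?thesis
  proof (cases "s = 1")
    case True
    then have "l = 0" "t = 0" using lm by auto
    then show ?thesis using that[of 1 v] lm(5) True sz by simp
  next
    case False
    define y where "y = (l / (1 - s)) *\<^sub>R v + (t / (1 - s)) *\<^sub>R v'"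
    have s: "s < 1" "l = 1 - s - t" using lm False by auto
    have l': "l / (1 - s) = 1 - t / (1 - s)" using s by (simp add: field_simps)
    have "0 \<le> t / (1 - s)" "t / (1 - s) \<le> 1" using s lm by (auto simp: field_simps)
    then have "y \<in> closed_segment v v'"
      unfolding y_def l' closed_segment_def by blast
    moreover have "fst z = (1 - s) *\<^sub>R y + s *\<^sub>R c"
      unfolding lm(5) y_def using s(1) by (simp add: scaleR_add_right)
    ultimately show ?thesis using that[of s y] lm s sz by auto
  qed
qed

text \<open>
  Canonical form of an overpass: from its initial point vertically up to height \<open>M\<close>, over an apex
  above everything else, and vertically down to its final point.
\<close>

definition arch :: "real \<Rightarrow> space3 \<Rightarrow> space3 \<Rightarrow> space3 set" where
  "arch M x y = closed_segment x (fst x, M) \<union> closed_segment (fst x, M) (0, M + 1) \<union>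
     closed_segment (0, M + 1) (fst y, M) \<union> closed_segment (fst y, M) y"

text \<open>
  One segment \<open>xy\<close> of the arc is absorbed by three triangle moves. The lower triangle of the
  fence above \<open>xy\<close> replaces the way down to \<open>x\<close> and on to \<open>y\<close> by
  the diagonal, the upper one replaces the diagonal by the way at height \<open>M\<close> and down to
  \<open>y\<close>, and the triangle with the apex cuts the remaining corner. All the rest lies beside
  these triangles or, like \<open>B\<close>, underneath.
\<close>

lemma raise_to_arch_step:
  assumes B: "polygonal B" "\<And>b. b \<in> B \<Longrightarrow> snd b < M" and x0: "snd x0 < M"
    and xs: "\<And>y. y \<in> set (x # xs) \<Longrightarrow> snd y < M"
    and simple: "simple_polyline (map fst (x # xs))"
    and v0: "fst x0 \<notin> polyline (map fst (x # xs))"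
    and above: "\<And>y b. y \<in> polyline (x # xs) \<Longrightarrow> b \<in> B \<Longrightarrow> fst b = fst y \<Longrightarrow>
                  snd b < snd y \<or> b = y \<and> y = last (x # xs)"
  shows "isotopic (B \<union> arch M x0 x \<union> polyline (x # xs)) (B \<union> arch M x0 (last (x # xs)))"
  using xs simple v0 above
proof (induction xs arbitrary: x)
  case Nil
  have "x \<in> arch M x0 x" by (auto simp: arch_def)
  then show ?case by (simp add: insert_absorb isotopic_refl)
next
  case (Cons y ys)
  define A where "A = polyline (y # ys)"
  let ?c = "(0, M + 1) :: space3" and ?w = "(fst x, M)" and ?w' = "(fst y, M)" and ?v = "(fst x0, M)"
  define P where "P = closed_segment x0 ?v"
  define Q where "Q = closed_segment ?v ?c"
  have ne: "fst x \<noteq> fst y" and inter: "closed_segment (fst x) (fst y) \<inter> polyline (map fst (y # ys)) \<subseteq> {fst y}"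
    and simple': "simple_polyline (map fst (y # ys))"
    using Cons.prems(2) by auto
  have xM: "snd x < M" and yM: "snd y < M" and AM: "\<And>z. z \<in> A \<Longrightarrow> snd z < M"
    using Cons.prems(1) snd_polyline_less[of "y # ys" M] by (auto simp: A_def)
  have v0: "fst x0 \<notin> closed_segment (fst x) (fst y)" "fst x0 \<notin> polyline (map fst (y # ys))"
    using Cons.prems(3) by auto
  have P: "fst z = fst x0" "snd z \<le> M" if "z \<in> P" for z
    using fst_in_closed_segment[of z x0 ?v] snd_closed_segment_bounds[of z x0 ?v] that x0
    by (auto simp: P_def)
  have Q: "snd z \<ge> M \<and> (snd z = M \<longrightarrow> z = (v, M))" if "z \<in> closed_segment (v, M) ?c" for z v
    using that by (auto simp: closed_segment_def algebra_simps)
  have toward_end: "z = y" if "z \<in> A" "fst z \<in> closed_segment (fst x) (fst y)" for z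
  proof -
    have "fst z = fst y" using inter fst_in_polyline[of z "y # ys"] that unfolding A_def by auto
    then show ?thesis using simple_polyline_over_hd[OF simple'] that(1) unfolding A_def by blast
  qed
  have fence_B: "z = y" if "z \<in> B" "0 \<le> t" "t \<le> 1" "fst z = (1 - t) *\<^sub>R fst x + t *\<^sub>R fst y"
    "(1 - t) * snd x + t * snd y \<le> snd z" for z t
  proof -
    define s where "s = (1 - t) *\<^sub>R x + t *\<^sub>R y"
    have s: "s \<in> closed_segment x y" using that by (auto simp: s_def closed_segment_def)
    have "fst z = fst s" "snd s \<le> snd z" using that by (auto simp: s_def)
    then have "z = s" "s = last (y # ys)"
      using Cons.prems(4)[of s z] s that(1) by auto
    then show ?thesis
      using toward_end[of z] last_in_set[of "y # ys"] set_subset_polyline[of "y # ys"]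
        fst_in_closed_segment[OF s] unfolding A_def by auto
  qed
  have in_seg: "fst z \<in> closed_segment (fst x) (fst y)"
    if "0 \<le> t" "t \<le> 1" "fst z = (1 - t) *\<^sub>R fst x + t *\<^sub>R fst y" for z :: space3 and t
    using that by (auto simp: closed_segment_def)
  define K where "K = B \<union> P \<union> Q \<union> closed_segment ?w ?c \<union> A"
  have polyK: "polygonal K" using B by (simp add: K_def P_def Q_def A_def)
  have 1: "isotopic (K \<union> closed_segment ?w y) (K \<union> closed_segment ?w x \<union> closed_segment x y)"
  proof (rule triangle_move[OF polyK])
    have "?w \<noteq> x" using xM by (metis order.irrefl snd_conv)
    then show "\<not> collinear {?w, y, x}"
      using noncollinear_vertical[of ?w x y] ne by (simp add: insert_commute)
    show "K \<inter> convex hull {?w, y, x} \<subseteq> {?w, y}"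
    proof
      fix z assume z: "z \<in> K \<inter> convex hull {?w, y, x}"
      then obtain t where t: "0 \<le> t" "t \<le> 1" "fst z = (1 - t) *\<^sub>R fst x + t *\<^sub>R fst y"
        "(1 - t) * snd x + t * snd y \<le> snd z" "snd z \<ge> M \<Longrightarrow> z = ?w"
        using lower_fence_triangle[of z x M y] xM yM by blast
      from z consider "z \<in> B" | "z \<in> P" | "z \<in> Q" | "z \<in> closed_segment ?w ?c" | "z \<in> A"
        by (auto simp: K_def)
      then show "z \<in> {?w, y}"
        using fence_B[OF _ t(1-4)] P v0(1) in_seg[OF t(1-3)] Q[of z "fst x0"] Q[of z "fst x"]
          toward_end[of z] t(5) unfolding Q_def by cases auto
    qed
  qed
  have 2: "isotopic (K \<union> closed_segment ?w y) (K \<union> closed_segment ?w ?w' \<union> closed_segment ?w' y)"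
  proof (rule triangle_move[OF polyK])
    have "?w' \<noteq> y" using yM by (metis order.irrefl snd_conv)
    then show "\<not> collinear {?w, y, ?w'}"
      using noncollinear_vertical[of ?w' y ?w] ne by (simp add: insert_commute)
    show "K \<inter> convex hull {?w, y, ?w'} \<subseteq> {?w, y}"
    proof
      fix z assume z: "z \<in> K \<inter> convex hull {?w, y, ?w'}"
      then obtain t where t: "0 \<le> t" "t \<le> 1" "fst z = (1 - t) *\<^sub>R fst x + t *\<^sub>R fst y"
        "(1 - t) * snd x + t * snd y \<le> snd z"
        using upper_fence_triangle[of z x M y] xM yM by blast
      have "convex hull {?w, y, ?w'} \<subseteq> {z. snd z \<le> M}"
      proof (rule hull_minimal)
        show "convex {z :: space3. snd z \<le> M}"
          using convex_halfspace_le[of "(0, 1) :: space3" M] by (simp add: inner_prod_def)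
      qed (use yM in auto)
      then have zM: "snd z \<le> M" using z by blast
      have zQ: "z \<notin> Q"
      proof
        assume "z \<in> Q"
        then have "z = (fst x0, M)" using Q[of z "fst x0"] zM unfolding Q_def by auto
        then have "fst z = fst x0" by simp
        then show False using v0(1) in_seg[OF t(1-3)] by simp
      qed
      from z consider "z \<in> B" | "z \<in> P" | "z \<in> Q" | "z \<in> closed_segment ?w ?c" | "z \<in> A"
        by (auto simp: K_def)
      then show "z \<in> {?w, y}"
        using fence_B[OF _ t(1-4)] P v0(1) in_seg[OF t(1-3)] Q[of z "fst x"]
          toward_end[of z] zM zQ by cases auto
    qed
  qed
  define L where "L = B \<union> P \<union> Q \<union> closed_segment ?w' y \<union> A"
  have 3: "isotopic (L \<union> closed_segment ?c ?w') (L \<union> closed_segment ?c ?w \<union> closed_segment ?w ?w')"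
  proof (rule triangle_move)
    show "polygonal L" using B by (simp add: L_def P_def Q_def A_def)
    show "\<not> collinear {?c, ?w', ?w}"
      using noncollinear_horizontal[of ?w ?w' ?c] ne by (auto simp: insert_commute)
    show "L \<inter> convex hull {?c, ?w', ?w} \<subseteq> {?c, ?w'}"
    proof
      fix z assume z: "z \<in> L \<inter> convex hull {?c, ?w', ?w}"
      then have "z \<in> convex hull {?w, ?w', ?c}" by (simp add: insert_commute)
      then obtain s v where s: "0 \<le> s" "s \<le> 1" "v \<in> closed_segment (fst x) (fst y)" "snd z = M + s"
        "fst z = (1 - s) *\<^sub>R v + s *\<^sub>R 0"
        by (rule cap_triangle)
      from z consider "z \<in> B" | "z \<in> P" | "z \<in> Q" | "z \<in> closed_segment ?w' y" | "z \<in> A"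
        by (auto simp: L_def)
      then show "z \<in> {?c, ?w'}"
      proof cases
        case 1
        then show ?thesis using B(2)[of z] s by simp
      next
        case 2
        then have "s = 0" using P(2)[of z] s by simp
        then show ?thesis using P(1)[OF 2] s v0(1) by auto
      next
        case 3
        then obtain r where r: "0 \<le> r" "r \<le> 1" "z = (1 - r) *\<^sub>R ?v + r *\<^sub>R ?c"
          unfolding Q_def by (rule closed_segment_weightsE)
        then have "r = s" using s(4) by (simp add: algebra_simps)
        then have "(1 - s) *\<^sub>R fst x0 = (1 - s) *\<^sub>R v" using r(3) s(5) by simp
        then have "s = 1" using v0(1) s(3) by auto
        then show ?thesis using r(3) \<open>r = s\<close> by simp
      next
        case 4
        then obtain r where r: "0 \<le> r" "r \<le> 1" "z = (1 - r) *\<^sub>R ?w' + r *\<^sub>R y"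
          by (rule closed_segment_weightsE)
        have "r * (snd y - M) = s" using r(3) s(4) by (simp add: algebra_simps)
        moreover have "r * (snd y - M) \<le> 0" using r(1) yM by (simp add: mult_nonneg_nonpos)
        ultimately have "r * (snd y - M) = 0" using s(1) by simp
        then have "r = 0" using yM by simp
        then show ?thesis using r(3) by simp
      next
        case 5
        then show ?thesis using AM[of z] s by simp
      qed
    qed
  qed
  have "B \<union> arch M x0 x \<union> polyline (x # y # ys) = K \<union> closed_segment ?w x \<union> closed_segment x y"
    unfolding arch_def K_def P_def Q_def A_def by (auto simp: closed_segment_commute)
  also have "isotopic \<dots> (K \<union> closed_segment ?w ?w' \<union> closed_segment ?w' y)"
    using isotopic_trans[OF isotopic_sym[OF 1] 2] .
  also have "K \<union> closed_segment ?w ?w' \<union> closed_segment ?w' y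
      = L \<union> closed_segment ?c ?w \<union> closed_segment ?w ?w'"
    unfolding K_def L_def by (auto simp: closed_segment_commute)
  also have "isotopic \<dots> (L \<union> closed_segment ?c ?w')"
    by (rule isotopic_sym[OF 3])
  also have "L \<union> closed_segment ?c ?w' = B \<union> arch M x0 y \<union> polyline (y # ys)"
    unfolding arch_def L_def P_def Q_def A_def by (auto simp: closed_segment_commute)
  also have "isotopic \<dots> (B \<union> arch M x0 (last (y # ys)))"
  proof (rule Cons.IH)
    show "snd z < M" if "z \<in> set (y # ys)" for z using that Cons.prems(1) by auto
    show "snd b < snd z \<or> b = z \<and> z = last (y # ys)"
      if "z \<in> polyline (y # ys)" "b \<in> B" "fst b = fst z" for z b
      using that Cons.prems(4)[of z b] by auto
  qed (use simple' v0 in auto)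
  finally show ?case by simp
qed

text \<open>
  The projection of the arc is simple, and wherever the arc and \<open>B\<close> have the same projection
  the arc is higher, apart from its two ends, where it may be attached to \<open>B\<close>.
\<close>

definition passes_over :: "space3 list \<Rightarrow> space3 set \<Rightarrow> bool" where
  "passes_over xs B \<longleftrightarrow> length xs \<ge> 2 \<and> simple_polyline (map fst xs) \<and>
     (\<forall>y\<in>polyline xs. \<forall>b\<in>B. fst b = fst y \<longrightarrow>
        snd b < snd y \<or> b = y \<and> (y = hd xs \<or> y = last xs))"

text \<open>
  The first segment is treated separately, since the initial point has to stay attached to
  \<open>B\<close>: the post is erected above it, and only then the connection is raised.
\<close>

lemma raise_to_arch:
  assumes B: "polygonal B" "\<And>b. b \<in> B \<Longrightarrow> snd b < M"
    and xs: "\<And>y. y \<in> set xs \<Longrightarrow> snd y < M" and over: "passes_over xs B"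
  shows "isotopic (B \<union> polyline xs) (B \<union> arch M (hd xs) (last xs))"
proof -
  obtain x y ys where xs_eq: "xs = x # y # ys"
    using over by (auto simp: passes_over_def numeral_2_eq_2 Suc_le_length_iff)
  define A where "A = polyline (y # ys)"
  let ?c = "(0, M + 1) :: space3" and ?w = "(fst x, M)" and ?w' = "(fst y, M)"
  have simple: "simple_polyline (map fst (x # y # ys))"
    and above: "\<And>z b. z \<in> polyline (x # y # ys) \<Longrightarrow> b \<in> B \<Longrightarrow> fst b = fst z \<Longrightarrow>
                  snd b < snd z \<or> b = z \<and> (z = x \<or> z = last (y # ys))"
    using over by (auto simp: passes_over_def xs_eq)
  have ne: "fst x \<noteq> fst y" and inter: "closed_segment (fst x) (fst y) \<inter> polyline (map fst (y # ys)) \<subseteq> {fst y}"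
    and simple': "simple_polyline (map fst (y # ys))"
    using simple by auto
  have v0: "fst x \<notin> polyline (map fst (y # ys))" using inter ne by auto
  have xM: "snd x < M" and yM: "snd y < M" and AM: "\<And>z. z \<in> A \<Longrightarrow> snd z < M"
    using xs snd_polyline_less[of "y # ys" M] by (auto simp: A_def xs_eq)
  have toward_end: "z = y" if "z \<in> A" "fst z \<in> closed_segment (fst x) (fst y)" for z
  proof -
    have "fst z = fst y" using inter fst_in_polyline[of z "y # ys"] that unfolding A_def by auto
    then show ?thesis using simple_polyline_over_hd[OF simple'] that(1) unfolding A_def by blast
  qed
  have fence_B: "z = y \<or> z = x \<and> t = 0" if "z \<in> B" "0 \<le> t" "t \<le> 1" "fst z = (1 - t) *\<^sub>R fst x + t *\<^sub>R fst y"
    "(1 - t) * snd x + t * snd y \<le> snd z" for z t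
  proof -
    define s where "s = (1 - t) *\<^sub>R x + t *\<^sub>R y"
    have s: "s \<in> closed_segment x y" using that by (auto simp: s_def closed_segment_def)
    have "fst z = fst s" "snd s \<le> snd z" using that by (auto simp: s_def)
    then have "z = s" "s = x \<or> s = last (y # ys)"
      using above[of s z] s that(1) by auto
    moreover have "t = 0" if "s = x"
    proof -
      have "t *\<^sub>R (fst y - fst x) = 0" using arg_cong[OF that, of fst] by (simp add: s_def algebra_simps)
      then show ?thesis using ne by simp
    qed
    ultimately show ?thesis
      using toward_end[of z] last_in_set[of "y # ys"] set_subset_polyline[of "y # ys"]
        fst_in_closed_segment[OF s] unfolding A_def by auto
  qed
  have in_seg: "fst z \<in> closed_segment (fst x) (fst y)"
    if "0 \<le> t" "t \<le> 1" "fst z = (1 - t) *\<^sub>R fst x + t *\<^sub>R fst y" for z :: space3 and t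
    using that by (auto simp: closed_segment_def)
  have 1: "isotopic (B \<union> A \<union> closed_segment x y) (B \<union> A \<union> closed_segment x ?w \<union> closed_segment ?w y)"
  proof (rule triangle_move)
    show "polygonal (B \<union> A)" using B by (simp add: A_def)
    have "?w \<noteq> x" using xM by (metis order.irrefl snd_conv)
    then show "\<not> collinear {x, y, ?w}"
      using noncollinear_vertical[of ?w x y] ne by (simp add: insert_commute)
    show "(B \<union> A) \<inter> convex hull {x, y, ?w} \<subseteq> {x, y}"
    proof
      fix z assume z: "z \<in> (B \<union> A) \<inter> convex hull {x, y, ?w}"
      then have "z \<in> convex hull {?w, y, x}" by (simp add: insert_commute)
      then obtain t where t: "0 \<le> t" "t \<le> 1" "fst z = (1 - t) *\<^sub>R fst x + t *\<^sub>R fst y"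
        "(1 - t) * snd x + t * snd y \<le> snd z"
        using lower_fence_triangle[of z x M y] xM yM by blast
      then show "z \<in> {x, y}"
        using z fence_B[OF _ t] toward_end[of z] in_seg[OF t(1-3)] by auto
    qed
  qed
  define K where "K = B \<union> A \<union> closed_segment x ?w"
  have 2: "isotopic (K \<union> closed_segment ?w y) (K \<union> closed_segment ?w ?w' \<union> closed_segment ?w' y)"
  proof (rule triangle_move)
    show "polygonal K" using B by (simp add: A_def K_def)
    have "?w' \<noteq> y" using yM by (metis order.irrefl snd_conv)
    then show "\<not> collinear {?w, y, ?w'}"
      using noncollinear_vertical[of ?w' y ?w] ne by (simp add: insert_commute)
    show "K \<inter> convex hull {?w, y, ?w'} \<subseteq> {?w, y}"
    proof
      fix z assume z: "z \<in> K \<inter> convex hull {?w, y, ?w'}"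
      then obtain t where t: "0 \<le> t" "t \<le> 1" "fst z = (1 - t) *\<^sub>R fst x + t *\<^sub>R fst y"
        "(1 - t) * snd x + t * snd y \<le> snd z" "t = 0 \<Longrightarrow> z = ?w"
        using upper_fence_triangle[of z x M y] xM yM by blast
      have "z = ?w" if "z \<in> closed_segment x ?w"
      proof (rule t(5))
        have "fst z = fst x" using fst_in_closed_segment[OF that] by simp
        then have "t *\<^sub>R (fst y - fst x) = 0" using t(3) by (simp add: algebra_simps)
        then show "t = 0" using ne by simp
      qed
      then show "z \<in> {?w, y}"
        using z fence_B[OF _ t(1-4)] toward_end[of z] in_seg[OF t(1-3)] t(5) unfolding K_def by auto
    qed
  qed
  define L where "L = B \<union> A \<union> closed_segment x ?w \<union> closed_segment ?w' y"
  have 3: "isotopic (L \<union> closed_segment ?w ?w') (L \<union> closed_segment ?w ?c \<union> closed_segment ?c ?w')"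
  proof (rule triangle_move)
    show "polygonal L" using B by (simp add: A_def L_def)
    show "\<not> collinear {?w, ?w', ?c}"
      using noncollinear_horizontal[of ?w ?w' ?c] ne by auto
    show "L \<inter> convex hull {?w, ?w', ?c} \<subseteq> {?w, ?w'}"
    proof
      fix z assume z: "z \<in> L \<inter> convex hull {?w, ?w', ?c}"
      then have "z \<in> convex hull {?w, ?w', ?c}" by simp
      then obtain s where s: "0 \<le> s" "snd z = M + s" by (rule cap_triangle)
      have post: "z = (fst p, M)" if p: "z \<in> closed_segment (fst p, M) p" "snd p < M" for p :: space3
      proof -
        obtain r where r: "0 \<le> r" "r \<le> 1" "z = (1 - r) *\<^sub>R (fst p, M) + r *\<^sub>R p"
          using p(1) by (rule closed_segment_weightsE)
        have "r * (snd p - M) = s" using r(3) s by (simp add: algebra_simps)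
        moreover have "r * (snd p - M) \<le> 0" using r(1) p(2) by (simp add: mult_nonneg_nonpos)
        ultimately have "r * (snd p - M) = 0" using s(1) by simp
        then have "r = 0" using p(2) by simp
        then show ?thesis using r(3) by simp
      qed
      have "z \<notin> B" "z \<notin> A" using B(2)[of z] AM[of z] s by auto
      then show "z \<in> {?w, ?w'}"
        using z post[OF _ xM] post[OF _ yM] unfolding L_def by (auto simp: closed_segment_commute)
    qed
  qed
  have "B \<union> polyline xs = B \<union> A \<union> closed_segment x y"
    unfolding A_def xs_eq by auto
  also have "isotopic \<dots> (K \<union> closed_segment ?w y)" using 1 by (simp add: K_def)
  also have "isotopic \<dots> (L \<union> closed_segment ?w ?w')"
    using 2 by (simp add: K_def L_def Un_ac)
  also have "isotopic \<dots> (L \<union> closed_segment ?w ?c \<union> closed_segment ?c ?w')" by (rule 3)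
  also have "\<dots> = B \<union> arch M x y \<union> polyline (y # ys)"
    unfolding arch_def L_def A_def by auto
  also have "isotopic \<dots> (B \<union> arch M x (last (y # ys)))"
  proof (rule raise_to_arch_step[OF B xM _ simple' v0])
    show "snd z < M" if "z \<in> set (y # ys)" for z using that xs xs_eq by auto
    show "snd b < snd z \<or> b = z \<and> z = last (y # ys)"
      if "z \<in> polyline (y # ys)" "b \<in> B" "fst b = fst z" for z b
      using that above[of z b] v0 fst_in_polyline[of z "y # ys"] by auto
  qed
  finally show ?thesis by (simp add: xs_eq)
qed

lemma bounded_polygonal:
  assumes "polygonal K"
  obtains M where "\<And>x. x \<in> K \<Longrightarrow> snd x < M"
proof -
  obtain S where "finite S" "K = (\<Union>(p, q)\<in>S. closed_segment p q)"
    using assms by (auto simp: polygonal_def)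
  then have "bounded K" by (auto intro!: bounded_UN simp: bounded_closed_segment)
  then obtain b where b: "\<And>x. x \<in> K \<Longrightarrow> norm x \<le> b" by (auto simp: bounded_iff)
  have "snd x < b + 1" if "x \<in> K" for x
    using b[OF that] norm_snd_le[of "snd x" "fst x"] by simp
  then show ?thesis using that by blast
qed

text \<open>
  Both arcs can be raised to the same arch, as this depends on nothing but the ends of the arc.
\<close>

proposition overpass_isotopic:
  assumes "polygonal B" and "passes_over xs B" and "passes_over ys B"
    and "hd xs = hd ys" and "last xs = last ys"
  shows "isotopic (B \<union> polyline xs) (B \<union> polyline ys)"
proof -
  obtain M where "\<And>x. x \<in> B \<union> polyline xs \<union> polyline ys \<Longrightarrow> snd x < M"
    using bounded_polygonal[of "B \<union> polyline xs \<union> polyline ys"] assms(1) by auto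
  then have M: "\<And>x. x \<in> B \<Longrightarrow> snd x < M" "\<And>x. x \<in> set xs \<Longrightarrow> snd x < M" "\<And>x. x \<in> set ys \<Longrightarrow> snd x < M"
    using set_subset_polyline[of xs] set_subset_polyline[of ys] by blast+
  have "isotopic (B \<union> polyline xs) (B \<union> arch M (hd xs) (last xs))"
    "isotopic (B \<union> polyline ys) (B \<union> arch M (hd xs) (last xs))"
    using raise_to_arch[OF assms(1) M(1,2) assms(2)] raise_to_arch[OF assms(1) M(1,3) assms(3)]
      assms(4,5) by simp_all
  then show ?thesis by (metis isotopic_sym isotopic_trans)
qed

definition mirror :: "space3 \<Rightarrow> space3" where
  "mirror x = (fst x, - snd x)"

lemma isotopic_mirror:
  assumes "isotopic K L"
  shows "isotopic (mirror ` K) (mirror ` L)"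
proof -
  define \<mu> :: "space4 \<Rightarrow> space4" where "\<mu> y = (mirror (fst y), snd y)" for y
  have norm_mirror: "norm (mirror x) = norm x" for x
    by (simp add: mirror_def norm_prod_def)
  have mirror_scaleR: "mirror (k *\<^sub>R x) = k *\<^sub>R mirror x" for k x
    by (simp add: mirror_def)
  have comm: "inv_stereographic (mirror x) = \<mu> (inv_stereographic x)" for x
    by (simp add: inv_stereographic_def \<mu>_def norm_mirror mirror_scaleR)
  have "\<mu> ` S3 \<subseteq> S3"
    by (auto simp: S3_def \<mu>_def norm_Pair norm_mirror)
  moreover have "\<mu> (\<mu> y) = y" for y by (simp add: \<mu>_def mirror_def)
  moreover have "continuous_on S3 \<mu>"
    unfolding \<mu>_def mirror_def by (intro continuous_intros)
  ultimately have "homeomorphism S3 S3 \<mu> \<mu>"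
    by (intro homeomorphismI) auto
  then have "ambient_isotopic S3 (\<mu> ` inv_stereographic ` K) (\<mu> ` inv_stereographic ` L)"
    by (intro ambient_isotopic_image) (use assms inv_stereographic_in_S3 in \<open>auto simp: isotopic_def\<close>)
  then show ?thesis by (simp add: isotopic_def image_image comm)
qed

section \<open>Rerouting a strand of a diagram\<close>

text \<open>
  An edge drawn in space as in the link of a diagram, with the height scaled by a weight: 1 for an over
  edge, 0 for a flat one, and \<open>-1\<close> for an over edge seen from below.
\<close>

definition lifted :: "(plane set \<Rightarrow> real) \<Rightarrow> plane set \<Rightarrow> space3 set" where
  "lifted s e = (\<lambda>v. (v, s e * infdist v e)) ` (convex hull e)"

fun path_edges :: "plane list \<Rightarrow> plane set set" where
  "path_edges (v # w # vs) = insert {v, w} (path_edges (w # vs))"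
| "path_edges _ = {}"

text \<open>
  The polygon above a plane path. A midpoint is inserted into every edge because the lifted edges are
  tents (\<open>lifted_pair\<close>).
\<close>

fun roof :: "(plane set \<Rightarrow> real) \<Rightarrow> plane list \<Rightarrow> space3 list" where
  "roof s (v # w # vs) =
     (v, 0) # (midpoint v w, s {v, w} * (dist v w / 2)) # roof s (w # vs)"
| "roof s [v] = [(v, 0)]"
| "roof s [] = []"

lemma infdist_pair: "infdist v {a, b} = min (dist v a) (dist v b)"
  using infdist_Un_min[of "{b}" "{a}" v] by (simp add: min.commute)

lemma lifted_pair:
  "lifted s {a, b} = closed_segment (a, 0) (midpoint a b, s {a, b} * (dist a b / 2)) \<union>
     closed_segment (midpoint a b, s {a, b} * (dist a b / 2)) (b, 0)"
proof -
  have half: "(\<lambda>v. (v, r * min (dist v a) (dist v b))) ` closed_segment a (midpoint a b)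
      = closed_segment (a, 0) (midpoint a b, r * (dist a b / 2))" for a b :: plane and r
  proof -
    have "(\<lambda>v. (v, r * min (dist v a) (dist v b))) ` (\<lambda>u. (1 - u) *\<^sub>R a + u *\<^sub>R midpoint a b) ` {0..1}
        = (\<lambda>u. (1 - u) *\<^sub>R (a, 0) + u *\<^sub>R (midpoint a b, r * (dist a b / 2))) ` {0..1}"
      unfolding image_image
    proof (rule image_cong)
      fix u :: real assume u: "u \<in> {0..1}"
      define v where "v = (1 - u) *\<^sub>R a + u *\<^sub>R midpoint a b"
      have "v - a = (u / 2) *\<^sub>R (b - a)" "b - v = (1 - u / 2) *\<^sub>R (b - a)"
        by (simp_all add: v_def midpoint_def algebra_simps flip: scaleR_2)
      then have "dist v a = u / 2 * dist a b" "dist v b = (1 - u / 2) * dist a b"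
        using u by (simp_all add: dist_norm norm_minus_commute[of v b] norm_minus_commute[of a b])
      moreover have "u / 2 * dist a b \<le> (1 - u / 2) * dist a b"
        using u by (intro mult_right_mono) auto
      ultimately show "(v, r * min (dist v a) (dist v b)) =
          (1 - u) *\<^sub>R (a, 0) + u *\<^sub>R (midpoint a b, r * (dist a b / 2))"
        by (simp add: min_def v_def)
    qed simp
    then show ?thesis by (simp add: closed_segment_image_interval)
  qed
  have "convex hull {a, b} = closed_segment a (midpoint a b) \<union> closed_segment b (midpoint b a)"
    using Un_closed_segment[of "midpoint a b" a b]
    by (simp add: segment_convex_hull[symmetric] closed_segment_commute midpoint_sym)
  moreover have "(\<lambda>v. (v, s {a, b} * min (dist v a) (dist v b))) ` closed_segment b (midpoint b a)
      = closed_segment (b, 0) (midpoint a b, s {a, b} * (dist a b / 2))"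
    using half[of "s {a, b}" b a] by (simp add: min.commute dist_commute midpoint_sym)
  ultimately show ?thesis
    using half[of "s {a, b}" a b]
    by (simp add: lifted_def infdist_pair image_Un closed_segment_commute)
qed

lemma polygonal_lifted: "card e = 2 \<Longrightarrow> polygonal (lifted s e)"
  by (auto simp: card_2_iff lifted_pair)

lemma roof_hd: "vs \<noteq> [] \<Longrightarrow> hd (roof s vs) = (hd vs, 0)"
  by (cases "(s, vs)" rule: roof.cases) auto

lemma roof_nonempty [simp]: "roof s vs = [] \<longleftrightarrow> vs = []"
  by (cases "(s, vs)" rule: roof.cases) auto

lemma roof_last: "vs \<noteq> [] \<Longrightarrow> last (roof s vs) = (last vs, 0)"
  by (induction s vs rule: roof.induct) auto

lemma polyline_Cons: "xs \<noteq> [] \<Longrightarrow> polyline (x # xs) = closed_segment x (hd xs) \<union> polyline xs"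
  by (cases xs) auto

lemma simple_polyline_Cons:
  "xs \<noteq> [] \<Longrightarrow> simple_polyline (x # xs) \<longleftrightarrow>
     x \<noteq> hd xs \<and> closed_segment x (hd xs) \<inter> polyline xs \<subseteq> {hd xs} \<and> simple_polyline xs"
  by (cases xs) auto

lemma polyline_roof:
  "vs \<noteq> [] \<Longrightarrow> polyline (roof s vs) = insert (hd vs, 0) (\<Union>e\<in>path_edges vs. lifted s e)"
proof (induction s vs rule: roof.induct)
  case (1 s v w vs)
  have "(w, 0) \<in> lifted s {v, w}" "(v, 0) \<in> lifted s {v, w}" by (auto simp: lifted_pair)
  then show ?case
    using 1 by (auto simp: polyline_Cons roof_hd lifted_pair)
qed auto

lemma polyline_map_fst_roof:
  "vs \<noteq> [] \<Longrightarrow> polyline (map fst (roof s vs)) = insert (hd vs) (\<Union>e\<in>path_edges vs. convex hull e)"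
proof (induction s vs rule: roof.induct)
  case (1 s v w vs)
  have *: "convex hull {v, w} = closed_segment v (midpoint v w) \<union> closed_segment (midpoint v w) w"
    using Un_closed_segment[of "midpoint v w" v w] by (simp add: segment_convex_hull[symmetric])
  have "hd (map fst (roof s (w # vs))) = w" by (simp add: hd_map roof_hd)
  then show ?case
    using 1 by (auto simp: polyline_Cons roof_hd *)
qed auto

lemma path_edges_subset: "e \<in> path_edges vs \<Longrightarrow> e \<subseteq> set vs"
  by (induction vs rule: path_edges.induct) auto

lemma path_edge_pair: "e \<in> path_edges vs \<Longrightarrow> \<exists>a b. e = {a, b}"
  by (induction vs rule: path_edges.induct) auto

lemma simple_roof:
  assumes "distinct vs"
    and "\<And>e f. e \<in> path_edges vs \<Longrightarrow> f \<in> path_edges vs \<Longrightarrow> e \<noteq> f \<Longrightarrow> convex hull e \<inter> convex hull f \<subseteq> e \<inter> f"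
  shows "simple_polyline (map fst (roof s vs))"
  using assms
proof (induction s vs rule: roof.induct)
  case (1 s v w vs)
  let ?m = "midpoint v w" and ?R = "map fst (roof s (w # vs))"
  have vw: "v \<noteq> w" using 1 by auto
  have hd: "hd ?R = w" by (simp add: hd_map roof_hd)
  have seg: "closed_segment v w = closed_segment v ?m \<union> closed_segment ?m w"
    using Un_closed_segment[of ?m v w] by simp
  have far: "closed_segment v w \<inter> polyline ?R \<subseteq> {w}"
  proof
    fix z assume z: "z \<in> closed_segment v w \<inter> polyline ?R"
    show "z \<in> {w}"
    proof (cases "z = w")
      case False
      then obtain e where e: "e \<in> path_edges (w # vs)" "z \<in> convex hull e"
        using z by (auto simp: polyline_map_fst_roof)
      have "v \<notin> e" using path_edges_subset[OF e(1)] "1.prems"(1) by auto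
      then have "convex hull {v, w} \<inter> convex hull e \<subseteq> {v, w} \<inter> e"
        using "1.prems"(2)[of "{v, w}" e] e(1) by auto
      then show ?thesis using z e(2) \<open>v \<notin> e\<close> by (auto simp: segment_convex_hull)
    qed simp
  qed
  have w: "w \<notin> closed_segment v ?m"
  proof
    assume "w \<in> closed_segment v ?m"
    then have "dist v w \<le> dist v ?m"
      using dist_in_closed_segment[of w v ?m] by (simp add: dist_commute)
    then show False using vw by (simp add: dist_midpoint)
  qed
  have halves: "closed_segment v ?m \<inter> closed_segment ?m w = {?m}"
    using Int_closed_segment[of ?m v w] by auto
  have mid: "?m \<noteq> v" "?m \<noteq> w" using vw by auto
  have simple: "simple_polyline ?R"
    using "1.IH" "1.prems" by auto
  have ne: "?R \<noteq> []" by simp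
  have far': "closed_segment ?m w \<inter> polyline ?R \<subseteq> {w}" using far seg by auto
  have near: "closed_segment v ?m \<inter> polyline (?m # ?R) \<subseteq> {?m}"
  proof
    fix z assume z: "z \<in> closed_segment v ?m \<inter> polyline (?m # ?R)"
    then have "z \<in> closed_segment v w" unfolding seg by simp
    then have "z \<notin> polyline ?R" using far w z by auto
    then show "z \<in> {?m}" using z halves unfolding polyline_Cons[OF ne] hd by auto
  qed
  have "simple_polyline (?m # ?R)"
    unfolding simple_polyline_Cons[OF ne] hd using mid(2) far' simple by simp
  then show ?case
    using mid(1)[symmetric] near simple_polyline.simps(1)[of v ?m "?R"]
    by (simp add: simple_polyline_Cons)
qed auto

lemma set_path_interior:
  assumes "v \<in> set vs"
  shows "v = hd vs \<or> v = last vs \<or> v \<in> set (butlast (tl vs))"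
proof (cases "tl vs = []")
  case True
  then show ?thesis using assms by (cases vs) auto
next
  case False
  have "set (tl vs) = insert (last (tl vs)) (set (butlast (tl vs)))"
    using append_butlast_last_id[OF False] by (metis list.simps(15) rotate1.simps(2) set_rotate1)
  moreover have "set vs = insert (hd vs) (set (tl vs))" "last (tl vs) = last vs"
    using False assms by (cases vs; simp)+
  ultimately show ?thesis using assms by auto
qed

text \<open>
  The weights \<open>s\<close> select the strand that runs on top: at a crossing with the rest \<open>E\<close> of the curve
  every edge of an overpass is the higher one.
\<close>

definition overpass :: "(plane set \<Rightarrow> real) \<Rightarrow> plane set set \<Rightarrow> plane list \<Rightarrow> bool" where
  "overpass s E vs \<longleftrightarrow> distinct vs \<and> length vs \<ge> 2 \<and>
     (\<forall>e\<in>path_edges vs. \<forall>f\<in>path_edges vs. e \<noteq> f \<longrightarrow> convex hull e \<inter> convex hull f \<subseteq> e \<inter> f) \<and>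
     set (butlast (tl vs)) \<inter> \<Union>E = {} \<and>
     (\<forall>e\<in>path_edges vs. \<forall>f\<in>E. convex hull e \<inter> convex hull f \<subseteq> e \<inter> f \<or>
        crosses e f \<and> s f \<le> 0 \<and> 0 \<le> s e \<and> s f < s e)"

lemma infdist_vertex: "v \<in> e \<Longrightarrow> infdist v e = 0"
  using infdist_zero by blast

lemma infdist_pos:
  assumes "finite e" and "e \<noteq> {}" and "v \<notin> e"
  shows "infdist v e > 0"
  using assms infdist_pos_not_in_closed[of e v] finite_imp_closed by blast

lemma polyline_roof_lifted:
  assumes "length vs \<ge> 2"
  shows "polyline (roof s vs) = (\<Union>e\<in>path_edges vs. lifted s e)" and "vs \<noteq> []"
proof -
  obtain a b cs where vs_eq: "vs = a # b # cs"
    using assms by (auto simp: numeral_2_eq_2 Suc_le_length_iff)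
  show "vs \<noteq> []" by (simp add: vs_eq)
  have "(hd vs, 0) \<in> lifted s {a, b}" "{a, b} \<in> path_edges vs"
    by (simp_all add: vs_eq lifted_pair)
  then show "polyline (roof s vs) = (\<Union>e\<in>path_edges vs. lifted s e)"
    unfolding polyline_roof[OF \<open>vs \<noteq> []\<close>] by blast
qed

text \<open>
  Over a common vertex both heights are 0; over a crossing the distances to the end points are positive,
  so the weights decide.
\<close>

lemma overpass_passes_over:
  assumes over: "overpass s E vs" and E: "\<And>e. e \<in> E \<Longrightarrow> card e = 2"
  shows "passes_over (roof s vs) (\<Union>e\<in>E. lifted s e)"
  unfolding passes_over_def
proof (intro conjI ballI impI)
  have vs: "distinct vs" "length vs \<ge> 2" using over by (auto simp: overpass_def)
  then obtain a b cs where vs_eq: "vs = a # b # cs"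
    by (auto simp: numeral_2_eq_2 Suc_le_length_iff)
  show "length (roof s vs) \<ge> 2" by (simp add: vs_eq Suc_le_eq)
  show "simple_polyline (map fst (roof s vs))"
    using over by (intro simple_roof) (auto simp: overpass_def)
  fix y b' assume y: "y \<in> polyline (roof s vs)" and b': "b' \<in> (\<Union>e\<in>E. lifted s e)" and eq: "fst b' = fst y"
  obtain e where e: "e \<in> path_edges vs" "y \<in> lifted s e"
    using y polyline_roof_lifted[OF vs(2)] by blast
  obtain f where f: "f \<in> E" "b' \<in> lifted s f" using b' by blast
  define v where "v = fst y"
  have yv: "y = (v, s e * infdist v e)" "v \<in> convex hull e"
    and bv: "b' = (v, s f * infdist v f)" "v \<in> convex hull f"
    using e(2) f(2) eq by (auto simp: lifted_def v_def)
  obtain p q where pq: "e = {p, q}" using e(1) path_edge_pair by blast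
  consider "convex hull e \<inter> convex hull f \<subseteq> e \<inter> f"
    | "crosses e f" "s f \<le> 0" "0 \<le> s e" "s f < s e"
    using over e(1) f(1) unfolding overpass_def by blast
  then show "snd b' < snd y \<or> b' = y \<and> (y = hd (roof s vs) \<or> y = last (roof s vs))"
  proof cases
    case 1
    then have v: "v \<in> e" "v \<in> f" using yv(2) bv(2) by auto
    have "v \<in> set vs" using path_edges_subset[OF e(1)] v by auto
    moreover have "v \<notin> set (butlast (tl vs))"
      using over v f(1) by (auto simp: overpass_def)
    ultimately have "v = hd vs \<or> v = last vs" using set_path_interior[of v vs] by blast
    then show ?thesis
      using yv(1) bv(1) v by (auto simp: infdist_vertex roof_hd roof_last vs_eq)
  next
    case 2
    then obtain c where "convex hull e \<inter> convex hull f = {c}" "c \<notin> e" "c \<notin> f"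
      unfolding crosses_def by blast
    moreover from this have "v = c" using yv(2) bv(2) by blast
    ultimately have v: "v \<notin> e" "v \<notin> f" by auto
    have "finite f" "f \<noteq> {}" using E[OF f(1)] by (auto simp: card_2_iff)
    then have "infdist v e > 0" "infdist v f > 0"
      using v pq by (auto intro: infdist_pos)
    then have "s f * infdist v f \<le> 0" "0 \<le> s e * infdist v e"
      "s f * infdist v f < 0 \<or> 0 < s e * infdist v e"
      using 2 by (auto simp: mult_nonpos_nonneg mult_less_0_iff zero_less_mult_iff)
    then show ?thesis by (auto simp: yv(1) bv(1))
  qed
qed

lemma overpass_isotopic_lifted:
  assumes "finite E" and "\<And>e. e \<in> E \<Longrightarrow> card e = 2"
    and "overpass s E vs" and "overpass s' E vs'" and "hd vs = hd vs'" and "last vs = last vs'"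
    and "\<And>e. e \<in> E \<Longrightarrow> s e = s' e"
  shows "isotopic ((\<Union>e\<in>E. lifted s e) \<union> (\<Union>e\<in>path_edges vs. lifted s e))
                  ((\<Union>e\<in>E. lifted s' e) \<union> (\<Union>e\<in>path_edges vs'. lifted s' e))"
proof -
  have poly: "polyline (roof s vs) = (\<Union>e\<in>path_edges vs. lifted s e)" "vs \<noteq> []"
    if "overpass s E vs" for s vs
    using that polyline_roof_lifted by (auto simp: overpass_def)
  have B: "(\<Union>e\<in>E. lifted s e) = (\<Union>e\<in>E. lifted s' e)"
    using assms(7) by (simp add: lifted_def)
  have "isotopic ((\<Union>e\<in>E. lifted s e) \<union> polyline (roof s vs)) ((\<Union>e\<in>E. lifted s e) \<union> polyline (roof s' vs'))"
  proof (rule overpass_isotopic)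
    show "polygonal (\<Union>e\<in>E. lifted s e)"
      using assms(1,2) by (intro polygonal_UN polygonal_lifted) auto
    show "passes_over (roof s vs) (\<Union>e\<in>E. lifted s e)"
      by (rule overpass_passes_over) (use assms in auto)
    show "passes_over (roof s' vs') (\<Union>e\<in>E. lifted s e)"
      unfolding B by (rule overpass_passes_over) (use assms in auto)
    show "hd (roof s vs) = hd (roof s' vs')" "last (roof s vs) = last (roof s' vs')"
      using poly(2) assms(3-6) by (auto simp: roof_hd roof_last)
  qed
  then show ?thesis using poly(1) assms(3,4) B by simp
qed

lemma lifted_uminus: "lifted (\<lambda>e. - s e) e = mirror ` lifted s e"
  by (simp add: lifted_def mirror_def image_image)

text \<open>Turning space upside down makes an underpass an overpass.\<close>

lemma underpass_isotopic_lifted: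
  assumes "finite E" and "\<And>e. e \<in> E \<Longrightarrow> card e = 2"
    and "overpass (\<lambda>e. - s e) E vs" and "overpass (\<lambda>e. - s' e) E vs'"
    and "hd vs = hd vs'" and "last vs = last vs'" and "\<And>e. e \<in> E \<Longrightarrow> s e = s' e"
  shows "isotopic ((\<Union>e\<in>E. lifted s e) \<union> (\<Union>e\<in>path_edges vs. lifted s e))
                  ((\<Union>e\<in>E. lifted s' e) \<union> (\<Union>e\<in>path_edges vs'. lifted s' e))"
proof -
  have "mirror ` mirror ` K = K" for K
    by (simp add: image_image mirror_def)
  then show ?thesis
    using isotopic_mirror[OF overpass_isotopic_lifted[OF assms(1,2) assms(3,4,5,6)]] assms(7)
    by (simp add: lifted_uminus image_Un image_UN)
qed

text \<open>
  How edges without crossings are lifted does not matter: each of them is an overpass in its own right,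
  whatever its height, and can be exchanged for itself at another height.
\<close>

lemma isotopic_change_heights:
  assumes E: "finite E" "\<And>e. e \<in> E \<Longrightarrow> card e = 2"
    and pairs: "\<And>e f. e \<in> E \<Longrightarrow> f \<in> E \<Longrightarrow> e \<noteq> f \<Longrightarrow> convex hull e \<inter> convex hull f \<subseteq> e \<inter> f \<or> crosses e f"
    and eq: "\<And>e f. e \<in> E \<Longrightarrow> f \<in> E \<Longrightarrow> crosses e f \<Longrightarrow> s e = s' e"
  shows "isotopic (\<Union>e\<in>E. lifted s e) (\<Union>e\<in>E. lifted s' e)"
proof -
  have "isotopic (\<Union>e\<in>E. lifted s e) (\<Union>e\<in>E. lifted (\<lambda>e. if e \<in> F then s' e else s e) e)"
    if "F \<subseteq> E" for F
    using finite_subset[OF that E(1)] that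
  proof (induction F rule: finite_induct)
    case empty
    then show ?case by (simp add: isotopic_refl)
  next
    case (insert e F)
    let ?s = "\<lambda>f. if f \<in> F then s' f else s f" and ?s' = "\<lambda>f. if f \<in> insert e F then s' f else s f"
    have eE: "e \<in> E" using insert.prems by auto
    have step: "isotopic (\<Union>f\<in>E. lifted ?s f) (\<Union>f\<in>E. lifted ?s' f)"
    proof (cases "s e = s' e")
      case True
      then have "?s = ?s'" by auto
      then show ?thesis by (metis isotopic_refl)
    next
      case False
      obtain a b where ab: "e = {a, b}" "a \<noteq> b" using E(2)[OF eE] by (auto simp: card_2_iff)
      have over: "overpass r (E - {e}) [a, b]" for r
        using ab pairs[OF eE] eq[OF eE] False unfolding overpass_def by auto
      have "isotopic ((\<Union>f\<in>E - {e}. lifted ?s f) \<union> (\<Union>f\<in>path_edges [a, b]. lifted ?s f))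
          ((\<Union>f\<in>E - {e}. lifted ?s' f) \<union> (\<Union>f\<in>path_edges [a, b]. lifted ?s' f))"
        by (rule overpass_isotopic_lifted[OF _ _ over over]) (use E in auto)
      moreover have "E - {e} \<union> path_edges [a, b] = E" using ab eE by auto
      ultimately show ?thesis by (metis UN_Un)
    qed
    then show ?case using insert isotopic_trans[OF _ step] by simp
  qed
  from this[OF subset_refl] show ?thesis by (simp add: lifted_def)
qed

definition raised :: "diagram \<Rightarrow> plane set \<Rightarrow> real" where
  "raised D e = (if e \<in> over D then 1 else 0)"

lemma link_of_lifted: "link_of D = inv_stereographic ` (\<Union>e\<in>edges D. lifted (raised D) e)"
proof -
  have "lifted (raised D) e = (\<lambda>v. (v, height D e v)) ` (convex hull e)" for e
    by (auto simp: lifted_def raised_def height_def)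
  then show ?thesis by (simp add: link_of_def)
qed

lemma interior_degree:
  assumes "distinct vs" and "v \<in> set (butlast (tl vs))"
  obtains e f where "e \<in> path_edges vs" "f \<in> path_edges vs" "e \<noteq> f" "v \<in> e" "v \<in> f"
  using assms
proof (induction vs arbitrary: thesis rule: path_edges.induct)
  case (1 u w vs)
  show ?case
  proof (cases "v = w")
    case True
    then obtain x xs where "vs = x # xs" using "1.prems"(3) by (cases vs) auto
    then show ?thesis using "1.prems"(1)[of "{u, w}" "{w, x}"] "1.prems"(2) True by (auto simp: doubleton_eq_iff)
  next
    case False
    then have "v \<in> set (butlast (tl (w # vs)))" using "1.prems"(3) by (auto split: if_splits)
    then show ?thesis using "1.IH" "1.prems" by (metis distinct.simps(2) insertCI path_edges.simps(1))
  qed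
qed auto

lemma link_diagram_degree:
  assumes "link_diagram D" and "v \<in> e" and "e \<in> edges D"
  shows "card {e \<in> edges D. v \<in> e} = 2"
  using assms(1) UnionI[OF assms(3,2)] unfolding link_diagram_def by (elim conjE) (erule bspec)

text \<open>
  Two link diagrams that differ only by a strand that is over everywhere, or under everywhere, represent
  the same link. The truth value \<open>u\<close> tells which of the two it is.
\<close>

theorem reroute_isotopic:
  assumes D: "link_diagram D" and D': "link_diagram D'"
    and vs: "distinct vs" "length vs \<ge> 2" "path_edges vs \<subseteq> edges D"
    and vs': "distinct vs'" "length vs' \<ge> 2" "path_edges vs' \<subseteq> edges D'"
    and ends: "hd vs = hd vs'" "last vs = last vs'"
    and rest: "edges D - path_edges vs = E" "edges D' - path_edges vs' = E"
    and strand: "\<And>e f. e \<in> path_edges vs \<Longrightarrow> f \<in> edges D \<Longrightarrow> crosses e f \<Longrightarrow> e \<in> over D \<longleftrightarrow> u"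
    and strand': "\<And>e f. e \<in> path_edges vs' \<Longrightarrow> f \<in> edges D' \<Longrightarrow> crosses e f \<Longrightarrow> e \<in> over D' \<longleftrightarrow> u"
    and same: "\<And>e f. e \<in> E \<Longrightarrow> f \<in> E \<Longrightarrow> crosses e f \<Longrightarrow> e \<in> over D \<longleftrightarrow> e \<in> over D'"
  shows "ambient_isotopic S3 (link_of D) (link_of D')"
proof -
  define U where "U = over D \<union> over D'"
  define T where "T D e = (if e \<in> E then if e \<in> U then 1 else 0 else raised D e)" for D e
  have edges: "edges D = E \<union> path_edges vs" "edges D' = E \<union> path_edges vs'"
    using rest vs(3) vs'(3) by auto
  have sym: "crosses e f \<longleftrightarrow> crosses f e" for e f
    by (auto simp: crosses_def Int_commute)
  have card2: "card e = 2" if "link_diagram D" "e \<in> edges D" for D e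
    using that by (auto simp: link_diagram_def)
  have fin: "finite (edges D)" if "link_diagram D" for D
    using that by (auto simp: link_diagram_def)
  have pairs: "convex hull e \<inter> convex hull f \<subseteq> e \<inter> f \<or> crosses e f"
    if "link_diagram D" "e \<in> edges D" "f \<in> edges D" "e \<noteq> f" for D e f
    using that unfolding link_diagram_def by (metis order_refl)
  have alt: "e \<in> over D \<longleftrightarrow> f \<notin> over D"
    if "link_diagram D" "e \<in> edges D" "f \<in> edges D" "crosses e f" for D e f
    using that unfolding link_diagram_def by blast
  have unique: "f = g" if "link_diagram D" "e \<in> edges D" "f \<in> edges D" "g \<in> edges D" "crosses e f" "crosses e g" for D e f g
    using that unfolding link_diagram_def by blast
  have over_crossing: "\<exists>f\<in>edges D. crosses e f" if "link_diagram D" "e \<in> over D" for D e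
    using that unfolding link_diagram_def crossing_edge_def by blast
  \<comment> \<open>the sign that turns the strand into an overpass\<close>
  define \<sigma> :: real where "\<sigma> = (if u then 1 else - 1)"
  text \<open>
    The strand and the rest of the curve keep their heights at all their crossings; elsewhere the
    two diagrams may disagree about what is raised, and \<open>T\<close> raises what is raised in either of them.
  \<close>
  have main: "isotopic (\<Union>e\<in>edges D. lifted (raised D) e) ((\<Union>e\<in>E. lifted (T D) e) \<union> (\<Union>e\<in>path_edges vs. lifted (T D) e))
      \<and> overpass (\<lambda>e. \<sigma> * T D e) E vs"
    if L: "link_diagram D" "link_diagram D'" and vs: "distinct vs" "length vs \<ge> 2"
      and edges: "edges D = E \<union> path_edges vs" "E \<inter> path_edges vs = {}" "edges D' = E \<union> path_edges vs'"
      and strand: "\<And>e f. e \<in> path_edges vs \<Longrightarrow> f \<in> edges D \<Longrightarrow> crosses e f \<Longrightarrow> e \<in> over D \<longleftrightarrow> u"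
      and strand': "\<And>e f. e \<in> path_edges vs' \<Longrightarrow> f \<in> edges D' \<Longrightarrow> crosses e f \<Longrightarrow> e \<in> over D' \<longleftrightarrow> u"
      and same: "\<And>e f. e \<in> E \<Longrightarrow> f \<in> E \<Longrightarrow> crosses e f \<Longrightarrow> e \<in> over D \<longleftrightarrow> e \<in> over D'"
      and U: "U = over D \<union> over D'"
    for D D' vs vs'
  proof
    have T: "T D e = (if e \<in> E then if e \<in> over D \<or> e \<in> over D' then 1 else 0 else raised D e)" for e
      by (auto simp: T_def U)
    have agree: "raised D e = T D e" if e: "e \<in> edges D" "f \<in> edges D" "crosses e f" for e f
    proof (cases "e \<in> E")
      case True
      show ?thesis
      proof (cases "f \<in> E")
        case True
        then show ?thesis using same[of e f] e \<open>e \<in> E\<close> by (auto simp: T raised_def)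
      next
        case False
        then have f: "f \<in> path_edges vs" using e edges by auto
        then have eu: "e \<in> over D \<longleftrightarrow> \<not> u"
          using strand[OF f e(1)] alt[OF L(1) e] sym e(3) by blast
        have "e \<in> over D' \<longrightarrow> \<not> u"
        proof
          assume "e \<in> over D'"
          then obtain g where g: "g \<in> edges D'" "crosses e g" using over_crossing[OF L(2)] by blast
          have "g \<in> path_edges vs'"
            using g unique[OF L(1) e(1,2) _ e(3) g(2)] edges f by blast
          then show "\<not> u"
            using strand'[of g e] alt[OF L(2) _ g(1,2)] \<open>e \<in> over D'\<close> edges \<open>e \<in> E\<close> sym g(2) by blast
        qed
        then show ?thesis using eu True by (auto simp: T raised_def)
      qed
    next
      case False
      then show ?thesis by (simp add: T)
    qed
    have "isotopic (\<Union>e\<in>edges D. lifted (raised D) e) (\<Union>e\<in>edges D. lifted (T D) e)"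
      by (rule isotopic_change_heights) (use fin card2 pairs agree L(1) in auto)
    then show "isotopic (\<Union>e\<in>edges D. lifted (raised D) e)
        ((\<Union>e\<in>E. lifted (T D) e) \<union> (\<Union>e\<in>path_edges vs. lifted (T D) e))"
      by (simp add: edges(1) UN_Un)
    show "overpass (\<lambda>e. \<sigma> * T D e) E vs"
      unfolding overpass_def
    proof (intro conjI ballI impI)
      fix e f assume e: "e \<in> path_edges vs" and f: "f \<in> path_edges vs" and "e \<noteq> f"
      have "\<not> crosses e f"
        using strand[OF e, of f] strand[OF f, of e] alt[OF L(1), of e f] e f edges sym by blast
      then show "convex hull e \<inter> convex hull f \<subseteq> e \<inter> f"
        using pairs[OF L(1), of e f] e f edges \<open>e \<noteq> f\<close> by blast
    next
      show "set (butlast (tl vs)) \<inter> \<Union>E = {}"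
      proof (rule ccontr)
        assume "set (butlast (tl vs)) \<inter> \<Union>E \<noteq> {}"
        then obtain v g where v: "v \<in> set (butlast (tl vs))" "v \<in> g" "g \<in> E" by blast
        obtain e f where ef: "e \<in> path_edges vs" "f \<in> path_edges vs" "e \<noteq> f" "v \<in> e" "v \<in> f"
          using interior_degree[OF vs(1) v(1)] by blast
        have "{e, f, g} \<subseteq> {e \<in> edges D. v \<in> e}" using ef v edges by auto
        moreover have "card {e \<in> edges D. v \<in> e} = 2"
          using link_diagram_degree[OF L(1) v(2)] v(3) edges by blast
        moreover have "e \<noteq> g" "f \<noteq> g" using ef v edges by auto
        then have "card {e, f, g} = 3" using ef(3) by simp
        ultimately show False
          using card_mono[of "{e \<in> edges D. v \<in> e}" "{e, f, g}"] fin[OF L(1)] by simp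
      qed
    next
      fix e f assume e: "e \<in> path_edges vs" and f: "f \<in> E"
      have "e \<noteq> f" using e f edges(2) by auto
      then consider "convex hull e \<inter> convex hull f \<subseteq> e \<inter> f" | "crosses e f"
        using pairs[OF L(1), of e f] e f edges by blast
      then show "convex hull e \<inter> convex hull f \<subseteq> e \<inter> f \<or>
          crosses e f \<and> \<sigma> * T D f \<le> 0 \<and> 0 \<le> \<sigma> * T D e \<and> \<sigma> * T D f < \<sigma> * T D e"
      proof cases
        case 2
        have "e \<in> edges D" "f \<in> edges D" using e f edges by auto
        then have "T D e = (if u then 1 else 0)" "T D f = (if u then 0 else 1)"
          using agree[of e f] agree[of f e] strand[OF e, of f] alt[OF L(1), of e f] 2 sym
          by (auto simp: raised_def)
        then show ?thesis using 2 by (simp add: \<sigma>_def)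
      qed blast
    qed (use vs in auto)
  qed
  have 1: "isotopic (\<Union>e\<in>edges D. lifted (raised D) e) ((\<Union>e\<in>E. lifted (T D) e) \<union> (\<Union>e\<in>path_edges vs. lifted (T D) e))
      \<and> overpass (\<lambda>e. \<sigma> * T D e) E vs"
  proof (rule main[OF D D' vs(1,2) edges(1) _ edges(2)])
    show "E \<inter> path_edges vs = {}" using rest(1) by auto
  qed (use strand strand' same U_def in blast)+
  have 2: "isotopic (\<Union>e\<in>edges D'. lifted (raised D') e) ((\<Union>e\<in>E. lifted (T D') e) \<union> (\<Union>e\<in>path_edges vs'. lifted (T D') e))
      \<and> overpass (\<lambda>e. \<sigma> * T D' e) E vs'"
  proof (rule main[OF D' D vs'(1,2) edges(2) _ edges(1)])
    show "E \<inter> path_edges vs' = {}" using rest(2) by auto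
  qed (use strand strand' same U_def in blast)+
  have finE: "finite E" "\<And>e. e \<in> E \<Longrightarrow> card e = 2" using fin[OF D] card2[OF D] edges by auto
  have "isotopic ((\<Union>e\<in>E. lifted (T D) e) \<union> (\<Union>e\<in>path_edges vs. lifted (T D) e))
      ((\<Union>e\<in>E. lifted (T D') e) \<union> (\<Union>e\<in>path_edges vs'. lifted (T D') e))"
  proof (cases u)
    case True
    then show ?thesis
      using overpass_isotopic_lifted[OF finE, of "T D" vs "T D'" vs'] 1 2 ends
      by (simp add: \<sigma>_def) (simp add: T_def)
  next
    case False
    then show ?thesis
      using underpass_isotopic_lifted[OF finE, of "T D" vs "T D'" vs'] 1 2 ends
      by (simp add: \<sigma>_def) (simp add: T_def)
  qed
  then have "isotopic (\<Union>e\<in>edges D. lifted (raised D) e) (\<Union>e\<in>edges D'. lifted (raised D') e)"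
    using isotopic_trans[OF isotopic_trans[OF 1[THEN conjunct1]] isotopic_sym[OF 2[THEN conjunct1]]] by blast
  then show ?thesis by (simp add: isotopic_def link_of_lifted)
qed

section \<open>Plane curves with crossing data\<close>

definition matching :: "('a \<times> 'a) set \<Rightarrow> bool" where
  "matching C \<longleftrightarrow> (\<forall>(e, f)\<in>C. \<forall>(e', f')\<in>C. {e, f} \<inter> {e', f'} \<noteq> {} \<longrightarrow> e = e' \<and> f = f')"

lemma matching_eq:
  assumes "matching C" and "(e, f) \<in> C" and "(e', f') \<in> C" and "{e, f} \<inter> {e', f'} \<noteq> {}"
  shows "e = e' \<and> f = f'"
proof -
  have "\<forall>(a, b)\<in>C. {e, f} \<inter> {a, b} \<noteq> {} \<longrightarrow> e = a \<and> f = b"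
    using bspec[OF assms(1)[unfolded matching_def] assms(2)] by (simp only: split_conv)
  from bspec[OF this assms(3)] show ?thesis using assms(4) by (simp only: split_conv not_False_eq_True simp_thms)
qed

lemma matchingI:
  assumes "\<And>e f e' f'. (e, f) \<in> C \<Longrightarrow> (e', f') \<in> C \<Longrightarrow> {e, f} \<inter> {e', f'} \<noteq> {} \<Longrightarrow> e = e' \<and> f = f'"
  shows "matching C"
  unfolding matching_def
proof clarify
  fix e f e' f' assume *: "(e, f) \<in> C" "(e', f') \<in> C" "{e, f} \<inter> {e', f'} \<noteq> {}"
  show "e = e' \<and> f = f'" by (rule assms[OF *])
qed

lemma matching_subset:
  assumes "matching C" and "D \<subseteq> C"
  shows "matching D"
proof (rule matchingI)
  fix e f e' f' assume *: "(e, f) \<in> D" "(e', f') \<in> D" "{e, f} \<inter> {e', f'} \<noteq> {}"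
  show "e = e' \<and> f = f'"
    using matching_eq[OF assms(1) subsetD[OF assms(2) *(1)] subsetD[OF assms(2) *(2)] *(3)] .
qed

lemma matching_Un:
  assumes "matching C" and "matching D"
    and apart: "\<And>e f e' f'. (e, f) \<in> C \<Longrightarrow> (e', f') \<in> D \<Longrightarrow> {e, f} \<inter> {e', f'} = {}"
  shows "matching (C \<union> D)"
proof (rule matchingI)
  fix e f e' f' assume *: "(e, f) \<in> C \<union> D" "(e', f') \<in> C \<union> D" "{e, f} \<inter> {e', f'} \<noteq> {}"
  consider "(e, f) \<in> C" "(e', f') \<in> C" | "(e, f) \<in> D" "(e', f') \<in> D"
    | "(e, f) \<in> C" "(e', f') \<in> D" | "(e, f) \<in> D" "(e', f') \<in> C"
    using *(1,2) by (elim UnE)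
  then show "e = e' \<and> f = f'"
  proof cases
    case 1 then show ?thesis by (rule matching_eq[OF assms(1) _ _ *(3)])
  next
    case 2 then show ?thesis by (rule matching_eq[OF assms(2) _ _ *(3)])
  next
    case 3 then show ?thesis using apart[OF 3] *(3) by simp
  next
    case 4 then show ?thesis using apart[OF 4(2,1)] *(3) by (simp add: Int_commute)
  qed
qed

lemma matching_singleton: "matching {(e, f)}"
  by (rule matchingI) auto

text \<open>
  The plane curve of a link diagram together with its crossings, recorded as pairs consisting of the over
  and the under edge. This form is easier to modify than a diagram: the pairs replace both the search for
  crossing edges and the set of over edges.
\<close>

definition plane_curve :: "plane set set \<Rightarrow> (plane set \<times> plane set) set \<Rightarrow> bool" where
  "plane_curve E C \<longleftrightarrow>
     finite E \<and> (\<forall>e\<in>E. card e = 2) \<and> (\<forall>v\<in>\<Union>E. card {e \<in> E. v \<in> e} = 2) \<and>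
     C \<subseteq> E \<times> E \<and> matching C \<and> (\<forall>(e, f)\<in>C. crosses e f) \<and>
     (\<forall>e\<in>E. \<forall>f\<in>E. e \<noteq> f \<and> (e, f) \<notin> C \<and> (f, e) \<notin> C \<longrightarrow> convex hull e \<inter> convex hull f \<subseteq> e \<inter> f)"

lemma plane_curveI:
  assumes "finite E" and "\<And>e. e \<in> E \<Longrightarrow> card e = 2" and "\<And>v. v \<in> \<Union>E \<Longrightarrow> card {e \<in> E. v \<in> e} = 2"
    and "C \<subseteq> E \<times> E" and "matching C" and "\<And>e f. (e, f) \<in> C \<Longrightarrow> crosses e f"
    and "\<And>e f. e \<in> E \<Longrightarrow> f \<in> E \<Longrightarrow> e \<noteq> f \<Longrightarrow> (e, f) \<notin> C \<Longrightarrow> (f, e) \<notin> C \<Longrightarrow>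
           convex hull e \<inter> convex hull f \<subseteq> e \<inter> f"
  shows "plane_curve E C"
  using assms unfolding plane_curve_def by (intro conjI ballI) auto

lemma plane_curveD:
  assumes "plane_curve E C"
  shows "finite E" and "\<And>e. e \<in> E \<Longrightarrow> card e = 2" and "\<And>v. v \<in> \<Union>E \<Longrightarrow> card {e \<in> E. v \<in> e} = 2"
    and "C \<subseteq> E \<times> E" and "matching C" and "\<And>e f. (e, f) \<in> C \<Longrightarrow> crosses e f"
    and "\<And>e f. e \<in> E \<Longrightarrow> f \<in> E \<Longrightarrow> e \<noteq> f \<Longrightarrow> (e, f) \<notin> C \<Longrightarrow> (f, e) \<notin> C \<Longrightarrow>
           convex hull e \<inter> convex hull f \<subseteq> e \<inter> f"
proof -
  note * = assms[unfolded plane_curve_def]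
  show "finite E" using * by (elim conjE)
  show "C \<subseteq> E \<times> E" using * by (elim conjE)
  show "matching C" using * by (elim conjE)
  show "card e = 2" if "e \<in> E" for e using * that by (elim conjE) (erule bspec)
  show "card {e \<in> E. v \<in> e} = 2" if "v \<in> \<Union>E" for v using * that by (elim conjE) (erule bspec)
  show "crosses e f" if "(e, f) \<in> C" for e f
    using * that by (elim conjE) (drule (1) bspec, simp)
  show "convex hull e \<inter> convex hull f \<subseteq> e \<inter> f"
    if "e \<in> E" "f \<in> E" "e \<noteq> f" "(e, f) \<notin> C" "(f, e) \<notin> C" for e f
  proof -
    have "\<forall>e\<in>E. \<forall>f\<in>E. e \<noteq> f \<and> (e, f) \<notin> C \<and> (f, e) \<notin> C \<longrightarrow> convex hull e \<inter> convex hull f \<subseteq> e \<inter> f"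
      using * by (elim conjE)
    from bspec[OF bspec[OF this that(1)] that(2)] show ?thesis using that(3-5) by simp
  qed
qed

definition diagram_of :: "plane set set \<Rightarrow> (plane set \<times> plane set) set \<Rightarrow> diagram" where
  "diagram_of E C = \<lparr>edges = E, over = fst ` C\<rparr>"

lemma diagram_of_simps [simp]: "edges (diagram_of E C) = E" "over (diagram_of E C) = fst ` C"
  by (simp_all add: diagram_of_def)

lemma crosses_sym: "crosses e f \<longleftrightarrow> crosses f e"
  by (auto simp: crosses_def Int_commute)

lemma not_crosses: "convex hull e \<inter> convex hull f \<subseteq> e \<inter> f \<Longrightarrow> \<not> crosses e f"
  by (auto simp: crosses_def)

lemma matchingD:
  assumes "matching C" and "(e, f) \<in> C"
  shows "(e, g) \<in> C \<Longrightarrow> g = f" and "(g, f) \<in> C \<Longrightarrow> g = e"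
    and "(f, g) \<in> C \<Longrightarrow> e = f" and "(g, e) \<in> C \<Longrightarrow> e = f"
  using matching_eq[OF assms, of e g] matching_eq[OF assms, of g f]
    matching_eq[OF assms, of f g] matching_eq[OF assms, of g e] by (simp_all only:) blast+

lemma plane_curve_crosses:
  assumes "plane_curve E C" and "e \<in> E" and "f \<in> E"
  shows "crosses e f \<longleftrightarrow> (e, f) \<in> C \<or> (f, e) \<in> C"
proof
  assume "crosses e f"
  then have "e \<noteq> f" "\<not> convex hull e \<inter> convex hull f \<subseteq> e \<inter> f"
    using not_crosses by (auto simp: crosses_def)
  then show "(e, f) \<in> C \<or> (f, e) \<in> C"
    using plane_curveD(7)[OF assms] by blast
next
  assume "(e, f) \<in> C \<or> (f, e) \<in> C"
  then show "crosses e f"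
    using plane_curveD(6)[OF assms(1)] crosses_sym by blast
qed

lemma plane_curve_irrefl: "plane_curve E C \<Longrightarrow> (e, e) \<notin> C"
  using plane_curveD(6)[of E C e e] by (auto simp: crosses_def)

lemma plane_curve_over:
  assumes "plane_curve E C" and "(e, f) \<in> C"
  shows "e \<in> fst ` C" and "f \<notin> fst ` C"
proof -
  show "e \<in> fst ` C" using assms(2) by force
  show "f \<notin> fst ` C"
  proof
    assume "f \<in> fst ` C"
    then obtain g where "(f, g) \<in> C" by auto
    then have "e = f"
      using assms(2) matchingD(3)[OF plane_curveD(5)[OF assms(1)]] by blast
    then show False using plane_curve_irrefl assms by blast
  qed
qed

lemma plane_curve_link_diagram:
  assumes "plane_curve E C"
  shows "link_diagram (diagram_of E C)"
  unfolding link_diagram_def diagram_of_simps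
proof (intro conjI ballI impI)
  note C = plane_curveD(4,5)[OF assms]
  show "convex hull e \<inter> convex hull f = e \<inter> f \<or> crosses e f" if "e \<in> E" "f \<in> E" "e \<noteq> f" for e f
  proof (cases "(e, f) \<in> C \<or> (f, e) \<in> C")
    case True
    then show ?thesis using plane_curve_crosses[OF assms that(1,2)] by simp
  next
    case False
    then have "convex hull e \<inter> convex hull f \<subseteq> e \<inter> f"
      using plane_curveD(7)[OF assms that] by blast
    then show ?thesis using hull_subset[of e convex] hull_subset[of f convex] by blast
  qed
  show "f = g" if "e \<in> E" "f \<in> E" "g \<in> E" "crosses e f \<and> crosses e g" for e f g
  proof -
    have "(e, f) \<in> C \<or> (f, e) \<in> C" "(e, g) \<in> C \<or> (g, e) \<in> C"
      using that plane_curve_crosses[OF assms] by auto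
    then show ?thesis
      using matchingD[OF C(2)] plane_curve_irrefl[OF assms] by metis
  qed
  show "crossing_edge (diagram_of E C) e" if e: "e \<in> fst ` C" for e
  proof -
    obtain f where f: "(e, f) \<in> C" using e by auto
    then have "e \<in> E" "f \<in> E" using C by auto
    then show ?thesis
      using f plane_curve_crosses[OF assms] unfolding crossing_edge_def by auto
  qed
  show "e \<in> fst ` C \<longleftrightarrow> f \<notin> fst ` C" if "e \<in> E" "f \<in> E" "crosses e f" for e f
    using that plane_curve_crosses[OF assms that(1,2)] plane_curve_over[OF assms] by blast
qed (use plane_curveD(1-3)[OF assms] in auto)

text \<open>
  Changing a crossing is swapping the components of its pair.
\<close>

lemma plane_curve_flip:
  assumes "plane_curve E C" and "(e, f) \<in> C"
  shows "plane_curve E (insert (f, e) (C - {(e, f)}))"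
    and "change_crossing (diagram_of E C) e f = diagram_of E (insert (f, e) (C - {(e, f)}))"
proof -
  let ?C = "insert (f, e) (C - {(e, f)})"
  note m = plane_curveD(5)[OF assms(1)]
  have "matching ?C"
    unfolding matching_def
  proof clarify
    fix a b a' b' assume *: "(a, b) \<in> ?C" "(a', b') \<in> ?C" "{a, b} \<inter> {a', b'} \<noteq> {}"
    have helper: "g = e \<and> k = f" if "(g, k) \<in> C" "{g, k} \<inter> {e, f} \<noteq> {}" for g k
      using matching_eq[OF m that(1) assms(2) that(2)] .
    consider "(a, b) = (f, e)" "(a', b') = (f, e)" | "(a, b) = (f, e)" "(a', b') \<in> C - {(e, f)}"
      | "(a', b') = (f, e)" "(a, b) \<in> C - {(e, f)}" | "(a, b) \<in> C" "(a', b') \<in> C"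
      using *(1,2) by blast
    then show "a = a' \<and> b = b'"
    proof cases
      case 2
      then show ?thesis using helper[of a' b'] *(3) by auto
    next
      case 3
      then show ?thesis using helper[of a b] *(3) by auto
    next
      case 4
      then show ?thesis using matching_eq[OF m _ _ *(3)] by blast
    qed simp
  qed
  moreover have "crosses f e"
    using plane_curveD(6)[OF assms] crosses_sym by blast
  moreover have "(e, f) \<in> E \<times> E" using plane_curveD(4)[OF assms(1)] assms(2) by blast
  ultimately have *: "matching ?C" "crosses f e" "(e, f) \<in> E \<times> E" by blast+
  show "plane_curve E ?C"
  proof (rule plane_curveI)
    show "convex hull a \<inter> convex hull b \<subseteq> a \<inter> b"
      if "a \<in> E" "b \<in> E" "a \<noteq> b" "(a, b) \<notin> ?C" "(b, a) \<notin> ?C" for a b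
      using that by (intro plane_curveD(7)[OF assms(1)]) auto
    show "crosses a b" if "(a, b) \<in> ?C" for a b
      using that plane_curveD(6)[OF assms(1)] *(2) by auto
    show "?C \<subseteq> E \<times> E" using plane_curveD(4)[OF assms(1)] *(3) by auto
  qed (use plane_curveD(1-3)[OF assms(1)] *(1) in auto)
  have over: "e \<in> fst ` C" "f \<notin> fst ` C" using plane_curve_over[OF assms] .
  have "fst ` (C - {(e, f)}) = fst ` C - {e}"
  proof (rule set_eqI)
    fix a
    have "(a, b) \<in> C - {(e, f)} \<longleftrightarrow> (a, b) \<in> C \<and> a \<noteq> e" for b
      using matchingD(1)[OF m assms(2), of b] assms(2) by auto
    then show "a \<in> fst ` (C - {(e, f)}) \<longleftrightarrow> a \<in> fst ` C - {e}" by (simp add: image_iff Bex_def)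
  qed
  moreover have "fst ` C - {e, f} \<union> ({e, f} - fst ` C) = insert f (fst ` C - {e})"
    using over by auto
  ultimately show "change_crossing (diagram_of E C) e f = diagram_of E ?C"
    by (simp add: change_crossing_def diagram_of_def)
qed

lemma finite_path_edges: "finite (path_edges vs)"
  by (induction vs rule: path_edges.induct) auto

lemma card_path_edge: "distinct vs \<Longrightarrow> e \<in> path_edges vs \<Longrightarrow> card e = 2"
proof (induction vs rule: path_edges.induct)
  case (1 v w vs)
  then have "v \<noteq> w" "distinct (w # vs)" by auto
  then show ?case using 1 by (cases "e = {v, w}") simp_all
qed auto

lemma path_degree:
  assumes "distinct vs" and "length vs \<ge> 2"
  shows "card {e \<in> path_edges vs. v \<in> e} =
    (if v \<notin> set vs then 0 else if v = hd vs \<or> v = last vs then 1 else 2)"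
  using assms
proof (induction vs rule: path_edges.induct)
  case (1 u w vs)
  have new: "{u, w} \<notin> path_edges (w # vs)"
    using path_edges_subset[of "{u, w}" "w # vs"] "1.prems" by auto
  have split: "{e \<in> path_edges (u # w # vs). v \<in> e} =
      (if v \<in> {u, w} then insert {u, w} {e \<in> path_edges (w # vs). v \<in> e} else {e \<in> path_edges (w # vs). v \<in> e})"
    by auto
  show ?case
  proof (cases "vs = []")
    case True
    then show ?thesis unfolding split by auto
  next
    case False
    then have IH: "card {e \<in> path_edges (w # vs). v \<in> e} =
        (if v \<notin> set (w # vs) then 0 else if v = w \<or> v = last vs then 1 else 2)"
      using 1 by (auto simp: Suc_le_eq)
    have "last vs \<in> set vs" using False by simp
    moreover have "{e \<in> path_edges (w # vs). u \<in> e} = {}"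
      using path_edges_subset[of _ "w # vs"] "1.prems"(1) by auto
    ultimately show ?thesis
      unfolding split using IH new "1.prems"(1) False
      by (auto simp: card_insert_if finite_path_edges)
  qed
qed auto

text \<open>
  Replacing a path in the curve by another path with the same ends.  Degrees are preserved because a path has
  degree 1 at its ends and degree 2 at its other vertices: the interior vertices of the old path lose both of
  their edges, and those of the new path are new to the curve.
\<close>

lemma plane_curve_reroute:
  assumes curve: "plane_curve E C"
    and vs: "distinct vs" "length vs \<ge> 2" "path_edges vs \<subseteq> E"
    and vs': "distinct vs'" "length vs' \<ge> 2"
    and ends: "hd vs = hd vs'" "last vs = last vs'"
    and E\<^sub>0: "E\<^sub>0 = E - path_edges vs" and C\<^sub>0: "C\<^sub>0 = C \<inter> E\<^sub>0 \<times> E\<^sub>0"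
    and interior: "set (butlast (tl vs')) \<inter> \<Union>E\<^sub>0 = {}"
    and self: "\<And>e f. e \<in> path_edges vs' \<Longrightarrow> f \<in> path_edges vs' \<Longrightarrow> e \<noteq> f \<Longrightarrow>
                convex hull e \<inter> convex hull f \<subseteq> e \<inter> f"
    and apart: "\<And>e f. e \<in> path_edges vs' \<Longrightarrow> f \<in> E\<^sub>0 \<Longrightarrow> (e, f) \<notin> N \<Longrightarrow> (f, e) \<notin> N \<Longrightarrow>
                convex hull e \<inter> convex hull f \<subseteq> e \<inter> f"
    and N: "\<And>e f. (e, f) \<in> N \<Longrightarrow> e \<in> E\<^sub>0 \<union> path_edges vs' \<and> f \<in> E\<^sub>0 \<union> path_edges vs' \<and> crosses e f"
    and match: "matching (C\<^sub>0 \<union> N)"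
  shows "plane_curve (E\<^sub>0 \<union> path_edges vs') (C\<^sub>0 \<union> N) \<and> E\<^sub>0 \<inter> path_edges vs' = {}"
proof -
  note fin = plane_curveD(1)[OF curve] and card2 = plane_curveD(2)[OF curve]
    and deg = plane_curveD(3)[OF curve]
  have disj: "E\<^sub>0 \<inter> path_edges vs' = {}"
  proof (rule ccontr)
    assume "E\<^sub>0 \<inter> path_edges vs' \<noteq> {}"
    then obtain e where e: "e \<in> E\<^sub>0" "e \<in> path_edges vs'" by blast
    have "(e, e) \<notin> N" using N[of e e] by (auto simp: crosses_def)
    then have "convex hull e \<subseteq> e" using apart[OF e(2,1)] by auto
    moreover obtain a b where "e = {a, b}" "a \<noteq> b"
      using card2[of e] e(1) E\<^sub>0 by (auto simp: card_2_iff)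
    moreover have "midpoint a b \<in> convex hull {a, b}" by (simp add: segment_convex_hull[symmetric])
    ultimately have "midpoint a b \<in> {a, b}" by blast
    then show False using \<open>a \<noteq> b\<close> by simp
  qed
  have deg': "card {e \<in> E\<^sub>0 \<union> path_edges vs'. v \<in> e} = 2" if v: "v \<in> \<Union>(E\<^sub>0 \<union> path_edges vs')" for v
  proof -
    let ?d = "card {e \<in> E. v \<in> e}" and ?r = "card {e \<in> E\<^sub>0. v \<in> e}"
    have fin0: "finite E\<^sub>0" using fin E\<^sub>0 by simp
    have "{e \<in> E\<^sub>0 \<union> path_edges vs'. v \<in> e} = {e \<in> E\<^sub>0. v \<in> e} \<union> {e \<in> path_edges vs'. v \<in> e}" by auto
    then have 1: "card {e \<in> E\<^sub>0 \<union> path_edges vs'. v \<in> e} = ?r + card {e \<in> path_edges vs'. v \<in> e}"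
      using disj fin0 finite_path_edges[of vs'] by (simp add: card_Un_disjoint disjoint_iff)
    have "{e \<in> E. v \<in> e} = {e \<in> E\<^sub>0. v \<in> e} \<union> {e \<in> path_edges vs. v \<in> e}" using vs(3) E\<^sub>0 by auto
    moreover have "{e \<in> E\<^sub>0. v \<in> e} \<inter> {e \<in> path_edges vs. v \<in> e} = {}" using E\<^sub>0 by auto
    ultimately have 2: "?d = ?r + card {e \<in> path_edges vs. v \<in> e}"
      using fin0 finite_path_edges[of vs]
        card_Un_disjoint[of "{e \<in> E\<^sub>0. v \<in> e}" "{e \<in> path_edges vs. v \<in> e}"] by simp
    have hdlast: "hd vs \<in> set vs" "last vs \<in> set vs" "hd vs' \<in> set vs'" "last vs' \<in> set vs'"
      using vs(2) vs'(2) by (cases vs; cases vs'; simp)+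
    have no0: "?r = 0" if "v \<notin> \<Union>E\<^sub>0"
    proof -
      have "{e \<in> E\<^sub>0. v \<in> e} = {}" using that by blast
      then show ?thesis by (simp only: card.empty)
    qed
    have d2: "?d = 2" if "v \<in> \<Union>E" using deg that by blast
    have dpath: "v \<in> \<Union>(path_edges vs) \<longleftrightarrow> v \<in> set vs"
    proof -
      have "v \<in> \<Union>(path_edges vs) \<longleftrightarrow> card {e \<in> path_edges vs. v \<in> e} \<noteq> 0"
        using finite_path_edges[of vs] by auto
      then show ?thesis using path_degree[OF vs(1,2), of v] by auto
    qed
    show ?thesis
    proof (cases "v \<in> set vs'")
      case False
      then have "card {e \<in> path_edges vs'. v \<in> e} = 0"
        using path_degree[OF vs', of v] by simp
      moreover from this have v0: "v \<in> \<Union>E\<^sub>0" using v finite_path_edges[of vs'] by auto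
      moreover have "v \<notin> set vs"
      proof
        assume "v \<in> set vs"
        moreover have "v \<noteq> hd vs" "v \<noteq> last vs" using False ends hdlast by auto
        ultimately have "card {e \<in> path_edges vs. v \<in> e} = 2" using path_degree[OF vs(1,2)] by auto
        then have "?r = 0" using 2 d2 v0 E\<^sub>0 by auto
        then show False using v0 fin0 by auto
      qed
      ultimately show ?thesis
        using 1 2 d2 path_degree[OF vs(1,2), of v] E\<^sub>0 by auto
    next
      case True
      show ?thesis
      proof (cases "v = hd vs' \<or> v = last vs'")
        case True
        then have v: "v \<in> set vs" "v = hd vs \<or> v = last vs" using ends hdlast by auto
        then have "v \<in> \<Union>E" using dpath vs(3) by blast
        moreover have "card {e \<in> path_edges vs. v \<in> e} = 1" "card {e \<in> path_edges vs'. v \<in> e} = 1"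
          using path_degree[OF vs(1,2), of v] path_degree[OF vs', of v] v True \<open>v \<in> set vs'\<close> by auto
        ultimately show ?thesis using 1 2 d2 by simp
      next
        case False
        then have "v \<in> set (butlast (tl vs'))" using True set_path_interior[of v vs'] by blast
        then have "v \<notin> \<Union>E\<^sub>0" using interior by blast
        then have "?r = 0" by (rule no0)
        then show ?thesis using 1 path_degree[OF vs', of v] True False by simp
      qed
    qed
  qed
  have "plane_curve (E\<^sub>0 \<union> path_edges vs') (C\<^sub>0 \<union> N)"
  proof (rule plane_curveI)
    show "finite (E\<^sub>0 \<union> path_edges vs')" using fin E\<^sub>0 finite_path_edges by simp
    show "card e = 2" if "e \<in> E\<^sub>0 \<union> path_edges vs'" for e
      using that card2 E\<^sub>0 card_path_edge[OF vs'(1)] by auto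
    show "C\<^sub>0 \<union> N \<subseteq> (E\<^sub>0 \<union> path_edges vs') \<times> (E\<^sub>0 \<union> path_edges vs')" using N C\<^sub>0 by auto
    show "crosses e f" if "(e, f) \<in> C\<^sub>0 \<union> N" for e f
      using that N C\<^sub>0 plane_curveD(6)[OF curve] by blast
    show "convex hull e \<inter> convex hull f \<subseteq> e \<inter> f"
      if e: "e \<in> E\<^sub>0 \<union> path_edges vs'" and f: "f \<in> E\<^sub>0 \<union> path_edges vs'"
        and ne: "e \<noteq> f" "(e, f) \<notin> C\<^sub>0 \<union> N" "(f, e) \<notin> C\<^sub>0 \<union> N" for e f
    proof -
      show "convex hull e \<inter> convex hull f \<subseteq> e \<inter> f"
      proof (cases "e \<in> E\<^sub>0")
        case True
        show ?thesis
        proof (cases "f \<in> E\<^sub>0")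
          case f0: True
          then have "(e, f) \<notin> C" "(f, e) \<notin> C" using ne True C\<^sub>0 by auto
          then show ?thesis using plane_curveD(7)[OF curve, of e f] True f0 ne(1) E\<^sub>0 by blast
        next
          case False
          then show ?thesis using apart[of f e] f ne True by blast
        qed
      next
        case False
        then have "e \<in> path_edges vs'" using e by blast
        then show ?thesis using apart[of e f] self[of e f] f ne by blast
      qed
    qed
  qed (use match deg' in auto)
  then show ?thesis using disj ..
qed

text \<open>
  The strand is an overpass if \<open>u\<close> is true and an underpass otherwise: its edges never occur
  as the under, respectively the over, edge of a crossing.
\<close>

lemma ambient_isotopic_reroute:
  assumes curve: "plane_curve E C" and curve': "plane_curve (E\<^sub>0 \<union> path_edges vs') (C\<^sub>0 \<union> N)"
    and vs: "distinct vs" "length vs \<ge> 2" "path_edges vs \<subseteq> E"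
    and vs': "distinct vs'" "length vs' \<ge> 2" "E\<^sub>0 \<inter> path_edges vs' = {}"
    and ends: "hd vs = hd vs'" "last vs = last vs'"
    and E\<^sub>0: "E\<^sub>0 = E - path_edges vs" and C\<^sub>0: "C\<^sub>0 = C \<inter> E\<^sub>0 \<times> E\<^sub>0"
    and strand: "\<And>e f. (e, f) \<in> C \<Longrightarrow> (if u then f else e) \<notin> path_edges vs"
    and strand': "\<And>e f. (e, f) \<in> N \<Longrightarrow> (if u then f else e) \<notin> path_edges vs'"
    and N: "\<And>e f. (e, f) \<in> N \<Longrightarrow> e \<in> path_edges vs' \<or> f \<in> path_edges vs'"
  shows "ambient_isotopic S3 (link_of (diagram_of E C))
           (link_of (diagram_of (E\<^sub>0 \<union> path_edges vs') (C\<^sub>0 \<union> N)))"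
proof (rule reroute_isotopic[OF plane_curve_link_diagram[OF curve] plane_curve_link_diagram[OF curve']])
  show "e \<in> over (diagram_of E C) \<longleftrightarrow> u" if "e \<in> path_edges vs" "f \<in> edges (diagram_of E C)" "crosses e f" for e f
  proof -
    have "(e, f) \<in> C \<or> (f, e) \<in> C"
      using that plane_curve_crosses[OF curve, of e f] vs(3) by auto
    then show ?thesis
      using that(1) strand[of e f] strand[of f e] plane_curve_over[OF curve] unfolding diagram_of_simps
      by metis
  qed
  show "e \<in> over (diagram_of (E\<^sub>0 \<union> path_edges vs') (C\<^sub>0 \<union> N)) \<longleftrightarrow> u"
    if "e \<in> path_edges vs'" "f \<in> edges (diagram_of (E\<^sub>0 \<union> path_edges vs') (C\<^sub>0 \<union> N))" "crosses e f" for e f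
  proof -
    have "(e, f) \<in> C\<^sub>0 \<union> N \<or> (f, e) \<in> C\<^sub>0 \<union> N"
      using that plane_curve_crosses[OF curve', of e f] by auto
    moreover have "e \<notin> E\<^sub>0" using that(1) vs'(3) by blast
    ultimately have "(e, f) \<in> N \<or> (f, e) \<in> N" using C\<^sub>0 by blast
    then show ?thesis
      using that(1) strand'[of e f] strand'[of f e] plane_curve_over[OF curve'] unfolding diagram_of_simps
      by (metis UnI2)
  qed
  show "e \<in> over (diagram_of E C) \<longleftrightarrow> e \<in> over (diagram_of (E\<^sub>0 \<union> path_edges vs') (C\<^sub>0 \<union> N))"
    if "e \<in> E\<^sub>0" "f \<in> E\<^sub>0" "crosses e f" for e f
  proof -
    have "(e, f) \<in> C \<or> (f, e) \<in> C"
      using that plane_curve_crosses[OF curve, of e f] E\<^sub>0 by auto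
    then have "(e, f) \<in> C \<and> (e, f) \<in> C\<^sub>0 \<union> N \<or> (f, e) \<in> C \<and> (f, e) \<in> C\<^sub>0 \<union> N"
      using that C\<^sub>0 by blast
    then show ?thesis
      using plane_curve_over[OF curve] plane_curve_over[OF curve'] unfolding diagram_of_simps by metis
  qed
qed (use vs vs' ends E\<^sub>0 in auto)

text \<open>
  In an alternating diagram every arc between consecutive crossings can be directed from the crossing
  where it is over to the one where it is under.  Conversely such directions certify alternation: the
  flow leaves every over edge at both ends and enters every under edge at both ends.  They are encoded
  by the edge \<open>\<tau> v\<close> through which the flow arrives at the vertex \<open>v\<close>.

  There are as many vertices as edges, and as many over as under edges; so counting the ends at which
  the flow leaves an edge shows that it arrives at every vertex.
\<close>

lemma flow_covers:
  assumes curve: "plane_curve E C"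
    and crossing: "\<And>e f v. (e, f) \<in> C \<Longrightarrow> (v \<in> e \<longrightarrow> \<tau> v = e) \<and> (v \<in> f \<longrightarrow> \<tau> v \<noteq> f)"
    and arc: "\<And>e. e \<in> E \<Longrightarrow> e \<notin> fst ` C \<union> snd ` C \<Longrightarrow> \<exists>a b. e = {a, b} \<and> \<tau> a = e \<and> \<tau> b \<noteq> e"
    and v: "v \<in> \<Union>E"
  shows "\<tau> v \<in> E \<and> v \<in> \<tau> v"
proof -
  note fin = plane_curveD(1)[OF curve] and card2 = plane_curveD(2)[OF curve]
    and deg = plane_curveD(3)[OF curve] and CE = plane_curveD(4)[OF curve]
    and match = plane_curveD(5)[OF curve]
  define out where "out e = {v \<in> e. \<tau> v = e}" for e
  have fine: "finite e" if "e \<in> E" for e using card2[OF that] card.infinite by force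
  have finV: "finite (\<Union>E)" using fin fine by blast
  have finC: "finite C" using finite_subset[OF CE] fin by simp
  have "inj_on fst C"
  proof (rule inj_onI)
    fix x y assume *: "x \<in> C" "y \<in> C" "fst x = fst y"
    obtain a b c d where xy: "x = (a, b)" "y = (c, d)" by (cases x, cases y)
    show "x = y"
      using matchingD(1)[OF match, of a b d] * xy by simp
  qed
  moreover have "inj_on snd C"
  proof (rule inj_onI)
    fix x y assume *: "x \<in> C" "y \<in> C" "snd x = snd y"
    obtain a b c d where xy: "x = (a, b)" "y = (c, d)" by (cases x, cases y)
    show "x = y"
      using matchingD(2)[OF match, of a b c] * xy by simp
  qed
  ultimately have cardC: "card (fst ` C) = card (snd ` C)"
    by (simp add: card_image)
  have sub: "fst ` C \<subseteq> E" "snd ` C \<subseteq> E" using CE by auto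
  have card_out: "int (card (out e)) = 1 + of_bool (e \<in> fst ` C) - of_bool (e \<in> snd ` C)" if e: "e \<in> E" for e
  proof -
    consider f where "(e, f) \<in> C" | f where "(f, e) \<in> C" | "e \<notin> fst ` C \<union> snd ` C" by fastforce
    then show ?thesis
    proof cases
      case 1
      then have "e \<in> fst ` C" by (rule plane_curve_over[OF curve])
      moreover have "e \<notin> snd ` C"
      proof
        assume "e \<in> snd ` C"
        then obtain g where "(g, e) \<in> C" by auto
        then have "e \<notin> fst ` C" by (rule plane_curve_over[OF curve])
        then show False using \<open>e \<in> fst ` C\<close> by blast
      qed
      moreover have "out e = e" using crossing[OF 1] by (auto simp: out_def)
      ultimately show ?thesis using card2[OF e] by simp
    next
      case 2
      then have "e \<notin> fst ` C" by (rule plane_curve_over[OF curve])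
      moreover have "e \<in> snd ` C" using image_eqI[OF _ 2, of e snd] by simp
      moreover have "out e = {}" using crossing[OF 2] by (auto simp: out_def)
      ultimately show ?thesis by simp
    next
      case 3
      then obtain a b where ab: "e = {a, b}" "\<tau> a = e" "\<tau> b \<noteq> e" using arc[OF e] by blast
      then have "out e = {a}" unfolding out_def by blast
      then show ?thesis using 3 by simp
    qed
  qed
  have "int (\<Sum>e\<in>E. card (out e)) = (\<Sum>e\<in>E. 1 + of_bool (e \<in> fst ` C) - of_bool (e \<in> snd ` C))"
    by (simp add: card_out)
  also have "\<dots> = int (card E) + (\<Sum>e\<in>E. of_bool (e \<in> fst ` C)) - (\<Sum>e\<in>E. of_bool (e \<in> snd ` C))"
    by (simp add: sum.distrib sum_subtractf)
  also have "(\<Sum>e\<in>E. of_bool (e \<in> fst ` C)) = int (card (fst ` C))"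
    using sub(1) fin by (simp add: sum_of_bool_eq Int_absorb1)
  also have "(\<Sum>e\<in>E. of_bool (e \<in> snd ` C)) = int (card (snd ` C))"
    using sub(2) fin by (simp add: sum_of_bool_eq Int_absorb1)
  finally have "int (\<Sum>e\<in>E. card (out e)) = int (card E)" using cardC by simp
  then have total: "(\<Sum>e\<in>E. card (out e)) = card E" by (simp only: of_nat_eq_iff)
  have "(\<Sum>e\<in>E. card {v \<in> \<Union>E. v \<in> e}) = (\<Sum>v\<in>\<Union>E. 2)"
    by (rule sum_multicount_gen) (use fin finV deg in auto)
  moreover have "{v \<in> \<Union>E. v \<in> e} = e" if "e \<in> E" for e using that by blast
  ultimately have "card (\<Union>E) = card E" using card2 by simp
  moreover have "card (\<Union>e\<in>E. out e) = (\<Sum>e\<in>E. card (out e))"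
    by (rule card_UN_disjoint) (use fin fine in \<open>auto simp: out_def\<close>)
  ultimately have "(\<Union>e\<in>E. out e) = \<Union>E"
    using total finV by (intro card_subset_eq) (auto simp: out_def)
  then obtain e where "e \<in> E" "v \<in> out e" using v by blast
  then show ?thesis by (auto simp: out_def)
qed

text \<open>
  Following the curve from a crossing to the next one, the flow can be tracked from edge to edge, because
  at every vertex it passes from one of the two edges to the other.
\<close>

lemma alternating_if_flow:
  assumes curve: "plane_curve E C"
    and crossing: "\<And>e f v. (e, f) \<in> C \<Longrightarrow> (v \<in> e \<longrightarrow> \<tau> v = e) \<and> (v \<in> f \<longrightarrow> \<tau> v \<noteq> f)"
    and arc: "\<And>e. e \<in> E \<Longrightarrow> e \<notin> fst ` C \<union> snd ` C \<Longrightarrow> \<exists>a b. e = {a, b} \<and> \<tau> a = e \<and> \<tau> b \<noteq> e"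
  shows "alternating_diagram (diagram_of E C)"
proof -
  note fin = plane_curveD(1)[OF curve] and card2 = plane_curveD(2)[OF curve]
    and deg = plane_curveD(3)[OF curve]
  have \<tau>: "\<tau> v \<in> E \<and> v \<in> \<tau> v" if "e \<in> E" "v \<in> e" for e v
    by (rule flow_covers[OF curve crossing arc]) (use that in auto)
  have three: False if "v \<in> e" "v \<in> f" "v \<in> g" "e \<in> E" "f \<in> E" "g \<in> E" "e \<noteq> f" "f \<noteq> g" "e \<noteq> g" for v e f g
  proof -
    have "card {e, f, g} \<le> card {e \<in> E. v \<in> e}"
      using that fin by (intro card_mono) auto
    then show False using deg[of v] that by auto
  qed
  have one: "\<tau> v = e \<longleftrightarrow> \<tau> v \<noteq> f" if "v \<in> e" "v \<in> f" "e \<in> E" "f \<in> E" "e \<noteq> f" for v e f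
    using three[of v e f "\<tau> v"] \<tau>[OF that(3,1)] that by metis
  have ce: "crossing_edge (diagram_of E C) e \<longleftrightarrow> e \<in> fst ` C \<union> snd ` C" if eE: "e \<in> E" for e
  proof
    assume "crossing_edge (diagram_of E C) e"
    then show "e \<in> fst ` C \<union> snd ` C"
      using plane_curve_crosses[OF curve eE] by (force simp: crossing_edge_def)
  next
    assume "e \<in> fst ` C \<union> snd ` C"
    then obtain f where f: "(e, f) \<in> C \<or> (f, e) \<in> C" by fastforce
    then have "f \<in> E" using plane_curveD(4)[OF curve] by auto
    then show "crossing_edge (diagram_of E C) e"
      using f plane_curve_crosses[OF curve eE] eE by (auto simp: crossing_edge_def)
  qed
  have state: "\<tau> v = e \<longleftrightarrow> e \<in> fst ` C" if e: "e \<in> fst ` C \<union> snd ` C" and v: "v \<in> e" for e v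
  proof -
    obtain f where "(e, f) \<in> C \<or> (f, e) \<in> C" using e by fastforce
    then show ?thesis
      using crossing[of e f v] crossing[of f e v] plane_curve_over[OF curve] v by metis
  qed
  text \<open>Along an arc the flow keeps its direction.\<close>
  have flow: "last es \<in> fst ` C \<longleftrightarrow> \<tau> v \<noteq> e"
    if "es \<noteq> []" "set (e # es) \<subseteq> E" "distinct (e # es)" "successively (\<lambda>e f. e \<inter> f \<noteq> {}) (e # es)"
      "v \<in> e" "v \<in> hd es" "last es \<in> fst ` C \<union> snd ` C"
      "\<forall>f\<in>set (butlast es). f \<notin> fst ` C \<union> snd ` C" for e v es
    using that
  proof (induction es arbitrary: e v)
    case (Cons f fs)
    have ef: "e \<in> E" "f \<in> E" "e \<noteq> f" using Cons.prems by auto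
    have dir: "\<tau> v = e \<longleftrightarrow> \<tau> v \<noteq> f" using one[of v e f] ef Cons.prems by auto
    show ?case
    proof (cases "fs = []")
      case True
      then have "f \<in> fst ` C \<union> snd ` C" using Cons.prems by auto
      then have "\<tau> v = f \<longleftrightarrow> f \<in> fst ` C" using state[of f v] Cons.prems by auto
      then show ?thesis using True dir by auto
    next
      case False
      obtain g gs where g: "fs = g # gs" using False by (cases fs) auto
      then obtain w where w: "w \<in> f" "w \<in> g" using Cons.prems by auto
      have "f \<notin> fst ` C \<union> snd ` C" using Cons.prems g by auto
      then obtain a b where ab: "f = {a, b}" "\<tau> a = f" "\<tau> b \<noteq> f" using arc[OF ef(2)] by blast
      have "v \<noteq> w"
      proof
        assume "v = w"
        then show False using three[of v e f g] Cons.prems w g by auto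
      qed
      then have "\<tau> v = f \<longleftrightarrow> \<tau> w \<noteq> f" using ab w(1) Cons.prems(6) by auto
      moreover have "last fs \<in> fst ` C \<longleftrightarrow> \<tau> w \<noteq> f"
        by (rule Cons.IH) (use Cons.prems w g in auto)
      ultimately show ?thesis using dir False by auto
    qed
  qed simp
  show ?thesis
    unfolding alternating_diagram_def
  proof (intro allI impI, elim conjE)
    fix es
    assume es: "set es \<subseteq> edges (diagram_of E C)" "distinct es" "2 \<le> length es"
      "successively (\<lambda>e f. e \<inter> f \<noteq> {}) es" "crossing_edge (diagram_of E C) (hd es)"
      "crossing_edge (diagram_of E C) (last es)"
      "\<forall>e\<in>set (butlast (tl es)). \<not> crossing_edge (diagram_of E C) e"
    then obtain e f fs where es_eq: "es = e # f # fs"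
      by (auto simp: numeral_2_eq_2 Suc_le_length_iff)
    then obtain v where v: "v \<in> e" "v \<in> f" using es(4) by auto
    have ces: "x \<in> set es \<Longrightarrow> crossing_edge (diagram_of E C) x \<longleftrightarrow> x \<in> fst ` C \<union> snd ` C" for x
      using ce es(1) by auto
    have "last (f # fs) \<in> fst ` C \<longleftrightarrow> \<tau> v \<noteq> e"
    proof (rule flow)
      show "last (f # fs) \<in> fst ` C \<union> snd ` C"
        using es(6) ces[OF last_in_set[of es]] es_eq by simp
      show "\<forall>x\<in>set (butlast (f # fs)). x \<notin> fst ` C \<union> snd ` C"
      proof
        fix x assume x: "x \<in> set (butlast (f # fs))"
        then have "x \<in> set es" using in_set_butlastD[OF x] es_eq by auto
        then show "x \<notin> fst ` C \<union> snd ` C" using es(7) x ces[of x] es_eq by auto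
      qed
    qed (use es es_eq v in auto)
    moreover have "e \<in> fst ` C \<longleftrightarrow> \<tau> v = e"
      using state[of e v] es(5) ces[of e] v es_eq by auto
    ultimately show "hd es \<in> over (diagram_of E C) \<longleftrightarrow> last es \<notin> over (diagram_of E C)"
      by (simp add: es_eq)
  qed
qed

section \<open>The standard pretzel diagram\<close>

definition pretzel_crossings :: "int list \<Rightarrow> (plane set \<times> plane set) set" where
  "pretzel_crossings ps = (\<Union>i<length ps. \<Union>k<nat \<bar>ps ! i\<bar>.
     {if ps ! i > 0 then (rising i k, falling i k) else (falling i k, rising i k)})"

lemma pretzel_diagram_eq: "pretzel_diagram ps = diagram_of (edges (pretzel_diagram ps)) (pretzel_crossings ps)"
proof -
  have "fst ` pretzel_crossings ps =
      (\<Union>i<length ps. \<Union>k<nat \<bar>ps ! i\<bar>. {if ps ! i > 0 then rising i k else falling i k})"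
    unfolding pretzel_crossings_def image_UN by (intro SUP_cong) auto
  then show ?thesis by (simp add: pretzel_diagram_def diagram_of_def)
qed

lemma in_segment_iff:
  "(X, Y) \<in> convex hull {(x1, y1), (x2, y2 :: real)} \<longleftrightarrow>
     (\<exists>t. 0 \<le> t \<and> t \<le> 1 \<and> X = x1 + t * (x2 - x1 :: real) \<and> Y = y1 + t * (y2 - y1))"
  by (auto simp: segment_convex_hull[symmetric] closed_segment_def algebra_simps)

lemma in_horizontal: "x1 \<le> x2 \<Longrightarrow> (X, Y) \<in> convex hull {(x1, y), (x2, y :: real)} \<longleftrightarrow> Y = y \<and> x1 \<le> X \<and> X \<le> (x2 :: real)"
proof -
  assume "x1 \<le> x2"
  then have "X \<in> closed_segment x1 x2 \<longleftrightarrow> x1 \<le> X \<and> X \<le> x2" by (simp add: closed_segment_eq_real_ivl)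
  then show ?thesis unfolding in_segment_iff by (auto simp: closed_segment_def algebra_simps)
qed

lemma in_vertical: "y1 \<le> y2 \<Longrightarrow> (X, Y) \<in> convex hull {(x, y1), (x :: real, y2 :: real)} \<longleftrightarrow> X = x \<and> y1 \<le> Y \<and> Y \<le> y2"
proof -
  assume "y1 \<le> y2"
  then have "Y \<in> closed_segment y1 y2 \<longleftrightarrow> y1 \<le> Y \<and> Y \<le> y2" by (simp add: closed_segment_eq_real_ivl)
  then show ?thesis unfolding in_segment_iff by (auto simp: closed_segment_def algebra_simps)
qed

lemma in_rising: "(X, Y) \<in> convex hull (rising i k) \<longleftrightarrow> 2 * real i \<le> X \<and> X \<le> 2 * real i + 1 \<and> Y = X - 2 * real i + real k"
  unfolding rising_def in_segment_iff
  by (auto intro!: exI[of _ "X - 2 * real i"])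

lemma in_falling: "(X, Y) \<in> convex hull (falling i k) \<longleftrightarrow> 2 * real i \<le> X \<and> X \<le> 2 * real i + 1 \<and> Y = 2 * real i + 1 - X + real k"
  unfolding falling_def in_segment_iff
  by (auto intro!: exI[of _ "2 * real i + 1 - X"])

lemma crosses_rising_falling: "crosses (rising i k) (falling i k)"
proof -
  have "convex hull (rising i k) \<inter> convex hull (falling i k) = {(2 * real i + 1 / 2, real k + 1 / 2)}"
    by (auto simp: in_rising in_falling)
  then show ?thesis
    unfolding crosses_def by (auto simp: rising_def falling_def doubleton_eq_iff)
qed

text \<open>
  Linear arithmetic over the reals does not know that distinct column numbers differ by at least 1.
\<close>

lemma real_nat_cases:
  obtains "i = j" | "real i + 1 \<le> real j" | "real j + 1 \<le> real i"
  by (cases i j rule: linorder_cases) auto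

lemma rising_eq_iff [simp]: "rising i k = rising j l \<longleftrightarrow> i = j \<and> k = l"
  and falling_eq_iff [simp]: "falling i k = falling j l \<longleftrightarrow> i = j \<and> k = l"
  and rising_neq_falling [simp]: "rising i k \<noteq> falling j l"
  and falling_neq_rising [simp]: "falling i k \<noteq> rising j l"
proof -
  have *: "2 * real i \<noteq> 2 * real j + 1" "2 * real j + 1 \<noteq> 2 * real i" for i j
    by (rule real_nat_cases[of i j]; simp)+
  show "rising i k = rising j l \<longleftrightarrow> i = j \<and> k = l" "falling i k = falling j l \<longleftrightarrow> i = j \<and> k = l"
    using *[of i j] *[of j i] by (auto simp: rising_def falling_def doubleton_eq_iff)
  show "rising i k \<noteq> falling j l" "falling i k \<noteq> rising j l"
    using *[of i j] *[of j i] by (auto simp: rising_def falling_def doubleton_eq_iff)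
qed

locale pretzel =
  fixes ps :: "int list"
  assumes nonempty: "ps \<noteq> []"
begin

definition n where "n = length ps"
definition twists where "twists i = nat \<bar>ps ! i\<bar>"
definition h where "h = box_height ps"
definition m where "m = 2 * real n - 1"
definition E where "E = edges (pretzel_diagram ps)"

lemma n_pos: "n \<ge> 1"
  using nonempty by (simp add: n_def Suc_le_eq)

lemma twists_less: "i < n \<Longrightarrow> real (twists i) + 1 \<le> h"
proof -
  assume "i < n"
  then have "\<bar>ps ! i\<bar> \<le> (\<Sum>i<length ps. \<bar>ps ! i\<bar>)"
    by (intro member_le_sum) (auto simp: n_def)
  then have "real_of_int \<bar>ps ! i\<bar> \<le> real_of_int (\<Sum>i<length ps. \<bar>ps ! i\<bar>)"
    by (simp only: of_int_le_iff)
  then show ?thesis unfolding h_def box_height_def by (simp add: twists_def)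
qed

lemma h_ge_1: "h \<ge> 1"
  using twists_less[of 0] n_pos by simp

inductive strand :: "nat \<Rightarrow> nat \<Rightarrow> plane set \<Rightarrow> bool" where
  "i < n \<Longrightarrow> k < twists i \<Longrightarrow> strand i k (rising i k)"
| "i < n \<Longrightarrow> k < twists i \<Longrightarrow> strand i k (falling i k)"

lemma edge_cases:
  assumes "e \<in> E"
  obtains (strand) i k where "strand i k e"
  | (vertical) i x where "i < n" "x = 2 * real i \<or> x = 2 * real i + 1" "e = {(x, real (twists i)), (x, h)}"
  | (join) i y where "Suc i < n" "y = 0 \<or> y = h" "e = {(2 * real i + 1, y), (2 * real i + 2, y)}"
  | (post) x y where "x = 0 \<or> x = m" "y = -1 \<or> y = h" "e = {(x, y), (x, y + 1)}"
  | (bar) y where "y = -1 \<or> y = h + 1" "e = {(0, y), (m, y)}"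
proof -
  have abs: "\<bar>real_of_int (ps ! i)\<bar> = real (twists i)" for i by (simp add: twists_def)
  from assms consider "e \<in> twist_edges ps" | "e \<in> vertical_edges ps" | "e \<in> joining_edges ps" | "e \<in> outer_edges ps"
    by (auto simp: E_def pretzel_diagram_def)
  then show ?thesis
  proof cases
    case 1
    then obtain i k where "strand i k e"
      unfolding twist_edges_def n_def[symmetric] twists_def[symmetric] by (auto intro: strand.intros)
    then show ?thesis by (rule that(1))
  next
    case 2
    then show ?thesis
      using that(2) unfolding vertical_edges_def abs by (auto simp: n_def h_def)
  next
    case 3
    then obtain i y where "i < n - 1" "y \<in> {0, h}" "e = {(2 * real i + 1, y), (2 * real i + 2, y)}"
      unfolding joining_edges_def n_def h_def by blast
    then show ?thesis using that(3)[of i y] by auto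
  next
    case 4
    then have "e \<in> {{(0, h), (0, h + 1)}, {(0, h + 1), (m, h + 1)}, {(m, h + 1), (m, h)},
          {(0, 0), (0, - 1)}, {(0, - 1), (m, - 1)}, {(m, - 1), (m, 0)}}"
      unfolding outer_edges_def Let_def m_def n_def h_def .
    then consider "e = {(0, h), (0, h + 1)}" | "e = {(0, h + 1), (m, h + 1)}" | "e = {(m, h + 1), (m, h)}"
      | "e = {(0, 0), (0, - 1)}" | "e = {(0, - 1), (m, - 1)}" | "e = {(m, - 1), (m, 0)}"
      unfolding insert_iff empty_iff by argo
    then show ?thesis
    proof cases
      case 1 then show ?thesis using that(4)[of 0 h] by simp
    next
      case 2 then show ?thesis using that(5)[of "h + 1"] by simp
    next
      case 3 then show ?thesis using that(4)[of m h] by (simp add: insert_commute)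
    next
      case 4 then show ?thesis using that(4)[of 0 "-1"] by (simp add: insert_commute)
    next
      case 5 then show ?thesis using that(5)[of "-1"] by simp
    next
      case 6 then show ?thesis using that(4)[of m "-1"] by simp
    qed
  qed
qed

lemma strand_edge: "strand i k e \<Longrightarrow> e \<in> E"
  unfolding E_def pretzel_diagram_def twist_edges_def n_def[symmetric] twists_def[symmetric]
  by (induction rule: strand.induct) auto

lemma vertical_edge: "i < n \<Longrightarrow> x = 2 * real i \<or> x = 2 * real i + 1 \<Longrightarrow> {(x, real (twists i)), (x, h)} \<in> E"
proof -
  assume *: "i < n" "x = 2 * real i \<or> x = 2 * real i + 1"
  have "real (twists i) = \<bar>real_of_int (ps ! i)\<bar>" by (simp add: twists_def)
  then show ?thesis
    using * unfolding E_def pretzel_diagram_def vertical_edges_def n_def h_def by auto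
qed

lemma join_edge: "Suc i < n \<Longrightarrow> y = 0 \<or> y = h \<Longrightarrow> {(2 * real i + 1, y), (2 * real i + 2, y)} \<in> E"
proof -
  assume "Suc i < n" "y = 0 \<or> y = h"
  then have "i \<in> {..<length ps - 1}" "y \<in> {0, box_height ps}" by (auto simp: n_def h_def)
  then have "{(2 * real i + 1, y), (2 * real i + 2, y)} \<in> joining_edges ps"
    unfolding joining_edges_def by blast
  then show ?thesis by (simp add: E_def pretzel_diagram_def)
qed

lemma outer_edge: "{{(0, h), (0, h + 1)}, {(0, h + 1), (m, h + 1)}, {(m, h), (m, h + 1)},
      {(0, - 1), (0, 0)}, {(0, - 1), (m, - 1)}, {(m, - 1), (m, 0)}} \<subseteq> E"
  unfolding E_def pretzel_diagram_def outer_edges_def Let_def n_def h_def m_def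
  by (auto simp: insert_commute)

text \<open>
  What the two directions of strands in a box have in common: position, and the fact that they reach the
  boundary of their square only in vertices.
\<close>

lemma in_strand:
  assumes "strand i k e" and "(X, Y) \<in> convex hull e"
  shows "2 * real i \<le> X" "X \<le> 2 * real i + 1" "real k \<le> Y" "Y \<le> real k + 1"
    "X = 2 * real i \<or> X = 2 * real i + 1 \<or> Y = real k \<or> Y = real k + 1 \<longrightarrow> (X, Y) \<in> e"
    "i < n" "real k + 1 \<le> real (twists i)"
proof -
  have range: "i < n" "k < twists i" using assms(1) by (auto elim: strand.cases)
  then show "i < n" "real k + 1 \<le> real (twists i)" by simp_all
  have *: "2 * real i \<le> X \<and> X \<le> 2 * real i + 1 \<and>
      (Y = X - 2 * real i + real k \<and> e = rising i k \<or> Y = 2 * real i + 1 - X + real k \<and> e = falling i k)"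
    using assms(1)
  proof cases
    case 1
    then show ?thesis using assms(2) in_rising by simp
  next
    case 2
    then show ?thesis using assms(2) in_falling by simp
  qed
  then show "2 * real i \<le> X" "X \<le> 2 * real i + 1" "real k \<le> Y" "Y \<le> real k + 1"
    by auto
  show "X = 2 * real i \<or> X = 2 * real i + 1 \<or> Y = real k \<or> Y = real k + 1 \<longrightarrow> (X, Y) \<in> e"
    using * by (auto simp: rising_def falling_def)
qed

lemma m_bound: "i < n \<Longrightarrow> 2 * real i + 1 \<le> m"
  by (simp add: m_def)

text \<open>
  Two strands in the same box meet in a common vertex unless they form a half twist; all other edges stay
  outside the open box.
\<close>

lemma strand_apart:
  assumes e: "strand i k e" and f: "f \<in> E" and ne: "e \<noteq> f"
    and not: "\<not> (e = rising i k \<and> f = falling i k)" "\<not> (e = falling i k \<and> f = rising i k)"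
    and p: "(X, Y) \<in> convex hull e" "(X, Y) \<in> convex hull f"
  shows "(X, Y) \<in> e \<and> (X, Y) \<in> f"
proof -
  note * = in_strand[OF e p(1)]
  have kh: "real k + 2 \<le> h" using *(7) twists_less[OF *(6)] by simp
  show ?thesis
    using f
  proof (cases rule: edge_cases)
    case (strand j l)
    note ** = in_strand[OF strand p(2)]
    show ?thesis
    proof (rule real_nat_cases[of i j])
      assume ij: "i = j"
      show ?thesis
      proof (rule real_nat_cases[of k l])
        assume "k = l"
        then have False using e strand ij ne not by (auto elim!: strand.cases)
        then show ?thesis ..
      qed (use * ** ij in linarith)+
    qed (use * ** in linarith)+
  next
    case (vertical j x)
    then have **: "X = x" "real (twists j) \<le> Y" "Y \<le> h" using p(2) twists_less[of j] by (auto simp: in_vertical)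
    show ?thesis
    proof (rule real_nat_cases[of i j])
      assume ij: "i = j"
      then have "Y = real (twists j)" using *(4) *(7)[unfolded ij] ** by linarith
      then show ?thesis using ** * vertical ij by auto
    qed (use * ** vertical in linarith)+
  next
    case (join j y)
    then have **: "Y = y" "2 * real j + 1 \<le> X" "X \<le> 2 * real j + 2" using p(2) by (auto simp: in_horizontal)
    have "X = 2 * real j + 1 \<and> X = 2 * real i + 1 \<or> X = 2 * real j + 2 \<and> X = 2 * real i"
    proof (rule real_nat_cases[of i j])
      assume "real j + 1 \<le> real i"
      then have "X = 2 * real j + 2 \<and> X = 2 * real i" using * ** by linarith
      then show ?thesis ..
    next
      assume "i = j"
      then have "X = 2 * real j + 1 \<and> X = 2 * real i + 1" using * ** by auto
      then show ?thesis ..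
    qed (use * ** in linarith)
    then have "(X, Y) \<in> e" "(X, Y) \<in> f" using *(5) ** join by auto
    then show ?thesis ..
  next
    case (post x y)
    then have **: "X = x" "y \<le> Y" "Y \<le> y + 1" using p(2) by (auto simp: in_vertical)
    have "Y = real k \<and> Y = y + 1"
      using * ** kh post by auto
    then show ?thesis using ** * post by auto
  next
    case (bar y)
    have "Y = y" using p(2) n_pos bar by (simp add: in_horizontal m_def)
    then show ?thesis using * kh bar by auto
  qed
qed

lemma frame_apart:
  assumes e: "e \<in> E" "\<And>i k. \<not> strand i k e" and f: "f \<in> E" "\<And>i k. \<not> strand i k f" and ne: "e \<noteq> f"
    and p: "(X, Y) \<in> convex hull e" "(X, Y) \<in> convex hull f"
  shows "(X, Y) \<in> e \<and> (X, Y) \<in> f"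
proof -
  have m: "m \<ge> 1" using n_pos by (simp add: m_def)
  have vertical_eq: "i = j" if "x = 2 * real i \<or> x = 2 * real i + 1" "x = 2 * real j \<or> x = 2 * real j + 1" for x i j
    using that by (rule_tac real_nat_cases[of i j]) auto
  have join_vertical: "(X, Y) \<in> e \<and> (X, Y) \<in> f"
    if "Suc i < n" "y = 0 \<or> y = h" "e = {(2 * real i + 1, y), (2 * real i + 2, y)}"
      "j < n" "x = 2 * real j \<or> x = 2 * real j + 1" "f = {(x, real (twists j)), (x, h)}"
      "(X, Y) \<in> convex hull e" "(X, Y) \<in> convex hull f" for i y j x e f
  proof -
    have **: "Y = y" "2 * real i + 1 \<le> X" "X \<le> 2 * real i + 2" "X = x" "real (twists j) \<le> Y" "Y \<le> h"
      using that twists_less[of j] by (auto simp: in_vertical in_horizontal)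
    have "x \<le> 2 * real i + 1 \<or> x \<ge> 2 * real i + 2"
    proof (rule real_nat_cases[of i j])
      assume "real i + 1 \<le> real j"
      then have "x \<ge> 2 * real i + 2" using that(5) by linarith
      then show ?thesis ..
    next
      assume "real j + 1 \<le> real i"
      then have "x \<le> 2 * real i + 1" using that(5) by linarith
      then show ?thesis ..
    next
      assume "i = j"
      then have "x \<le> 2 * real i + 1" using that(5) by auto
      then show ?thesis ..
    qed
    then have "X = 2 * real i + 1 \<or> X = 2 * real i + 2" using ** by auto
    moreover have "Y = real (twists j) \<or> Y = h" using ** that(2) by auto
    ultimately show ?thesis using ** that by auto
  qed
  have post_vertical: "(X, Y) \<in> e \<and> (X, Y) \<in> f"
    if "y = -1 \<or> y = h" "e = {(x', y), (x', y + 1)}"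
      "j < n" "f = {(x, real (twists j)), (x, h)}"
      "(X, Y) \<in> convex hull e" "(X, Y) \<in> convex hull f" for y x' j x e f
  proof -
    have "X = x'" "y \<le> Y" "Y \<le> y + 1" "X = x" "real (twists j) \<le> Y" "Y \<le> h"
      using that twists_less[of j] by (auto simp: in_vertical)
    moreover from this have "(Y = y \<or> Y = y + 1) \<and> (Y = real (twists j) \<or> Y = h)" using that(1) by auto
    ultimately show ?thesis using that by auto
  qed
  have bar_low: False
    if "y = -1 \<or> y = h + 1" "e = {(0, y), (m, y)}" "(X, Y) \<in> convex hull e" "0 \<le> Y" "Y \<le> h" for y e
    using that m by (auto simp: in_horizontal)
  have post_join: "(X, Y) \<in> e \<and> (X, Y) \<in> f"
    if "x = 0 \<or> x = m" "y = -1 \<or> y = h" "e = {(x, y), (x, y + 1)}"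
      "Suc i < n" "y' = 0 \<or> y' = h" "f = {(2 * real i + 1, y'), (2 * real i + 2, y')}"
      "(X, Y) \<in> convex hull e" "(X, Y) \<in> convex hull f" for x y i y' e f
  proof -
    have "X = x" "2 * real i + 1 \<le> X" "X \<le> 2 * real i + 2" using that by (auto simp: in_vertical in_horizontal)
    moreover have "2 * real i + 3 \<le> m" using m_bound[OF that(4)] by simp
    ultimately show ?thesis using that(1) by auto
  qed
  have post_bar: "(X, Y) \<in> e \<and> (X, Y) \<in> f"
    if "x = 0 \<or> x = m" "y = -1 \<or> y = h" "e = {(x, y), (x, y + 1)}"
      "y' = -1 \<or> y' = h + 1" "f = {(0, y'), (m, y')}"
      "(X, Y) \<in> convex hull e" "(X, Y) \<in> convex hull f" for x y y' e f
  proof -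
    have "X = x" "y \<le> Y" "Y \<le> y + 1" "Y = y'" using that m by (auto simp: in_vertical in_horizontal)
    moreover from this have "Y = y \<or> Y = y + 1" using that h_ge_1 by auto
    ultimately show ?thesis using that by auto
  qed
  have low: "0 \<le> Y \<and> Y \<le> h"
    if "i < n" "e = {(x, real (twists i)), (x, h)}" "(X, Y) \<in> convex hull e" for i x e
    using that twists_less[of i] by (auto simp: in_vertical)
  have low': "0 \<le> Y \<and> Y \<le> h"
    if "y = 0 \<or> y = h" "e = {(2 * real i + 1, y), (2 * real i + 2, y)}" "(X, Y) \<in> convex hull e" for i y e
    using that h_ge_1 by (auto simp: in_horizontal)
  show ?thesis
    using e(1)
  proof (cases rule: edge_cases)
    case (strand i k)
    then show ?thesis using e(2) by blast
  next
    case e: (vertical i x)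
    show ?thesis
      using f(1)
    proof (cases rule: edge_cases)
      case (strand i k)
      then show ?thesis using f(2) by blast
    next
      case (vertical j x')
      then have "x = x'" using p e twists_less[of i] twists_less[of j] by (auto simp: in_vertical)
      then have "i = j" using vertical_eq e vertical by blast
      then show ?thesis using e vertical \<open>x = x'\<close> ne by auto
    next
      case (join j y)
      then show ?thesis using join_vertical e p by blast
    next
      case (post x' y)
      then show ?thesis using post_vertical e p by blast
    next
      case (bar y)
      then show ?thesis using bar_low low[OF e(1) e(3) p(1)] p by blast
    qed
  next
    case e: (join i y)
    show ?thesis
      using f(1)
    proof (cases rule: edge_cases)
      case (strand i k)
      then show ?thesis using f(2) by blast
    next
      case (vertical j x')
      then show ?thesis using join_vertical e p by blast
    next
      case (join j y')
      then have "Y = y" "Y = y'" "2 * real i + 1 \<le> X" "X \<le> 2 * real i + 2" "2 * real j + 1 \<le> X" "X \<le> 2 * real j + 2"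
        using p e by (auto simp: in_horizontal)
      then have "i = j" by (rule_tac real_nat_cases[of i j]) linarith+
      then show ?thesis using e join \<open>Y = y\<close> \<open>Y = y'\<close> ne by auto
    next
      case (post x' y')
      then show ?thesis using post_join[of x' y' f i y e] e p by blast
    next
      case (bar y')
      then show ?thesis using bar_low low'[OF e(2,3) p(1)] p by blast
    qed
  next
    case e: (post x y)
    show ?thesis
      using f(1)
    proof (cases rule: edge_cases)
      case (strand i k)
      then show ?thesis using f(2) by blast
    next
      case (vertical j x')
      then show ?thesis using post_vertical e p by blast
    next
      case (join j y')
      then show ?thesis using post_join[of x y e j y' f] e p by blast
    next
      case (post x' y')
      then have "x = x'" "y \<le> Y" "Y \<le> y + 1" "y' \<le> Y" "Y \<le> y' + 1" using p e by (auto simp: in_vertical)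
      then have "y = y'" using e post h_ge_1 by auto
      then show ?thesis using e post ne \<open>x = x'\<close> by auto
    next
      case (bar y')
      then show ?thesis using post_bar e p by blast
    qed
  next
    case e: (bar y)
    show ?thesis
      using f(1)
    proof (cases rule: edge_cases)
      case (strand i k)
      then show ?thesis using f(2) by blast
    next
      case (vertical j x')
      then show ?thesis using bar_low low[OF vertical(1,3) p(2)] p e by blast
    next
      case (join j y')
      then show ?thesis using bar_low low'[OF join(2,3) p(2)] p e by blast
    next
      case (post x' y')
      then show ?thesis using post_bar e p by blast
    next
      case (bar y')
      then have "y = y'" using e p m by (auto simp: in_horizontal)
      then show ?thesis using e bar ne by auto
    qed
  qed
qed

lemma edges_apart:
  assumes "e \<in> E" and "f \<in> E" and "e \<noteq> f" and "(e, f) \<notin> pretzel_crossings ps" and "(f, e) \<notin> pretzel_crossings ps"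
  shows "convex hull e \<inter> convex hull f \<subseteq> e \<inter> f"
proof
  fix p assume p: "p \<in> convex hull e \<inter> convex hull f"
  obtain X Y where XY: "p = (X, Y)" by (cases p)
  have not: "\<not> (e = rising i k \<and> f = falling i k)" "\<not> (e = falling i k \<and> f = rising i k)"
    if "i < n" "k < twists i" for i k
    using that assms(4,5) by (force simp: pretzel_crossings_def n_def twists_def split: if_splits)+
  consider i k where "strand i k e" | i k where "strand i k f" | "\<And>i k. \<not> strand i k e" "\<And>i k. \<not> strand i k f"
    by blast
  then have "(X, Y) \<in> e \<and> (X, Y) \<in> f"
  proof cases
    case (1 i k)
    then have "i < n" "k < twists i" by (auto elim: strand.cases)
    then show ?thesis using strand_apart[OF 1 assms(2,3)] not p XY by blast
  next
    case (2 i k)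
    then have "i < n" "k < twists i" by (auto elim: strand.cases)
    then show ?thesis using strand_apart[OF 2 assms(1) assms(3)[symmetric]] not p XY by blast
  next
    case 3
    then show ?thesis using frame_apart[OF assms(1) _ assms(2) _ assms(3)] p XY by blast
  qed
  then show "p \<in> e \<inter> f" using XY by simp
qed

lemma even_odd [simp]:
  "2 * real i \<noteq> 2 * real j + 1" "2 * real j + 1 \<noteq> 2 * real i" "2 * real j + 2 \<noteq> 2 * real i + 1"
  "2 * real i + 1 \<noteq> 2 * real j + 2" "2 * real j + 2 = 2 * real i \<longleftrightarrow> i = Suc j"
  "2 * real i = 2 * real j + 2 \<longleftrightarrow> i = Suc j"
  by (rule real_nat_cases[of i j]; simp; fail | rule real_nat_cases[of i "Suc j"]; simp; fail | linarith)+

lemma even_odd_m [simp]: "2 * real i \<noteq> m" "m \<noteq> 2 * real i" "2 * real i + 1 = m \<longleftrightarrow> Suc i = n" "m = 2 * real i + 1 \<longleftrightarrow> Suc i = n"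
  using even_odd(1,2)[of i "n - 1"] n_pos unfolding m_def by (auto simp: of_nat_diff algebra_simps)

lemma grid_below [simp]:
  assumes "i < n" and "k \<le> twists i"
  shows "real k \<noteq> h" "h \<noteq> real k" "real k \<noteq> h + 1" "h + 1 \<noteq> real k"
  using twists_less[OF assms(1)] assms(2) by auto

lemma degree_eq_2:
  assumes "a \<in> E" "b \<in> E" "v \<in> a" "v \<in> b" "a \<noteq> b" and "\<And>e. e \<in> E \<Longrightarrow> v \<in> e \<Longrightarrow> e = a \<or> e = b"
  shows "card {e \<in> E. v \<in> e} = 2"
proof -
  have "{e \<in> E. v \<in> e} = {a, b}" using assms by blast
  then show ?thesis using assms(5) by simp
qed

text \<open>
  Every vertex lies on two edges. In a column these are the edge leaving it upwards, which is a strand or,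
  at the top of the twists, a vertical edge, and the edge leaving it downwards, which is a strand or, at
  the bottom, part of a join or of the outer arc.
\<close>

lemma degree_left:
  assumes "i < n" and "k \<le> twists i"
  shows "card {e \<in> E. (2 * real i, real k) \<in> e} = 2"
proof (rule degree_eq_2)
  define up where "up = (if k < twists i then rising i k else {(2 * real i, real (twists i)), (2 * real i, h)})"
  define down where "down = (if k > 0 then falling i (k - 1) else if i = 0 then {(0, - 1), (0, 0)}
      else {(2 * real (i - 1) + 1, 0), (2 * real (i - 1) + 2, 0)})"
  show "up \<in> E"
    using assms strand_edge[OF strand.intros(1), of i k] strand_edge[OF strand.intros(2), of i k] vertical_edge
    by (auto simp: up_def)
  show "down \<in> E"
    using assms strand_edge[OF strand.intros(2), of i "k - 1"] join_edge[of "i - 1" 0] outer_edge by (auto simp: down_def)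
  show "(2 * real i, real k) \<in> up" using assms by (auto simp: up_def rising_def)
  show "(2 * real i, real k) \<in> down" by (cases i) (auto simp: down_def falling_def)
  show "up \<noteq> down"
    using assms h_ge_1 by (auto simp: up_def down_def rising_def falling_def doubleton_eq_iff split: if_splits)
  show "e = up \<or> e = down" if "e \<in> E" "(2 * real i, real k) \<in> e" for e
    using that(1)
  proof (cases rule: edge_cases)
    case (strand j l)
    then show ?thesis
      using that(2) by cases (auto simp: rising_def falling_def up_def down_def)
  next
    case (vertical j x)
    then show ?thesis using that(2) assms by (auto simp: up_def)
  next
    case (join j y)
    then show ?thesis using that(2) assms by (auto simp: down_def)
  next
    case (post x y)
    then have xy: "x = 2 * real i" "real k = y \<or> real k = y + 1" using that(2) by auto
    then have "y = - 1" "k = 0" using post(2) assms twists_less[OF assms(1)] by auto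
    then show ?thesis using post(1,3) xy(1) by (auto simp: down_def)
  next
    case (bar y)
    then have "real k = y" using that(2) by auto
    then show ?thesis using bar(1) assms twists_less[OF assms(1)] by auto
  qed
qed

lemma degree_right:
  assumes "i < n" and "k \<le> twists i"
  shows "card {e \<in> E. (2 * real i + 1, real k) \<in> e} = 2"
proof (rule degree_eq_2)
  define up where "up = (if k < twists i then falling i k else {(2 * real i + 1, real (twists i)), (2 * real i + 1, h)})"
  define down where "down = (if k > 0 then rising i (k - 1) else if Suc i = n then {(m, - 1), (m, 0)}
      else {(2 * real i + 1, 0), (2 * real i + 2, 0)})"
  show "up \<in> E"
    using assms strand_edge[OF strand.intros(1), of i k] strand_edge[OF strand.intros(2), of i k] vertical_edge
    by (auto simp: up_def)
  show "down \<in> E"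
    using assms strand_edge[OF strand.intros(1), of i "k - 1"] join_edge[of i 0] outer_edge by (auto simp: down_def)
  show "(2 * real i + 1, real k) \<in> up" using assms by (auto simp: up_def falling_def)
  show "(2 * real i + 1, real k) \<in> down" by (auto simp: down_def rising_def)
  show "up \<noteq> down"
    using assms h_ge_1 by (auto simp: up_def down_def rising_def falling_def doubleton_eq_iff split: if_splits)
  show "e = up \<or> e = down" if "e \<in> E" "(2 * real i + 1, real k) \<in> e" for e
    using that(1)
  proof (cases rule: edge_cases)
    case (strand j l)
    then show ?thesis
      using that(2) by cases (auto simp: rising_def falling_def up_def down_def)
  next
    case (vertical j x)
    then show ?thesis using that(2) assms by (auto simp: up_def)
  next
    case (join j y)
    then have "2 * real i + 1 = 2 * real j + 1" "real k = y" using that(2) by auto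
    then have "i = j" "k = 0" using join(2) assms by auto
    then show ?thesis using join \<open>real k = y\<close> by (simp add: down_def)
  next
    case (post x y)
    then have xy: "x = 2 * real i + 1" "real k = y \<or> real k = y + 1" using that(2) by auto
    then have "y = - 1" "k = 0" using post(2) assms twists_less[OF assms(1)] by auto
    then show ?thesis using post(1,3) xy(1) by (auto simp: down_def)
  next
    case (bar y)
    then have "real k = y" using that(2) by auto
    then show ?thesis using bar(1) assms twists_less[OF assms(1)] by auto
  qed
qed

lemma degree_top:
  assumes "i < n" and "x = 2 * real i \<or> x = 2 * real i + 1"
  shows "card {e \<in> E. (x, h) \<in> e} = 2"
proof (rule degree_eq_2)
  let ?down = "{(x, real (twists i)), (x, h)}"
  define up where "up = (if x = 0 \<or> x = m then {(x, h), (x, h + 1)}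
     else if x = 2 * real i then {(2 * real (i - 1) + 1, h), (2 * real (i - 1) + 2, h)}
     else {(2 * real i + 1, h), (2 * real i + 2, h)})"
  show "?down \<in> E" using vertical_edge assms by blast
  show "up \<in> E"
    using assms join_edge[of "i - 1" h] join_edge[of i h] outer_edge by (auto simp: up_def)
  show "(x, h) \<in> ?down" by simp
  show "(x, h) \<in> up" using assms by (cases i) (auto simp: up_def)
  show "?down \<noteq> up"
    using assms by (auto simp: up_def doubleton_eq_iff)
  show "e = ?down \<or> e = up" if "e \<in> E" "(x, h) \<in> e" for e
    using that(1)
  proof (cases rule: edge_cases)
    case (strand j l)
    then have "j < n" "Suc l \<le> twists j" by (auto elim: strand.cases)
    then have "h \<noteq> real l" "h \<noteq> real l + 1"
      using grid_below(2)[of j l] grid_below(2)[of j "Suc l"] by (auto simp: add.commute)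
    then show ?thesis
      using that(2) strand by (auto simp: rising_def falling_def elim: strand.cases)
  next
    case (vertical j y)
    then show ?thesis using that(2) assms by auto
  next
    case (join j y)
    have y: "y = h" and x: "x = 2 * real j + 1 \<or> x = 2 * real j + 2" using that(2) join(3) by auto
    from assms(2) show ?thesis
    proof
      assume xi: "x = 2 * real i"
      then have "i = Suc j" using x by auto
      moreover have "x \<noteq> 0" "x \<noteq> m" using xi \<open>i = Suc j\<close> even_odd_m(1)[of i] by auto
      ultimately have "up = e" using xi join(3) y by (simp add: up_def)
      then show ?thesis by simp
    next
      assume xi: "x = 2 * real i + 1"
      then have "i = j" using x by auto
      then have "up = e" using xi join(1,3) y by (simp add: up_def)
      then show ?thesis by simp
    qed
  next
    case (post z y)
    then have xy: "x = z" "h = y \<or> h = y + 1" using that(2) by auto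
    then have "y = h" using post(2) h_ge_1 by auto
    then show ?thesis using post(1,3) xy(1) by (simp add: up_def)
  next
    case (bar y)
    then have "h = y" using that(2) by auto
    then show ?thesis using bar(1) h_ge_1 by auto
  qed
qed

lemma degree_corner:
  assumes "x = 0 \<or> x = m" and "y = - 1 \<or> y = h + 1"
  shows "card {e \<in> E. (x, y) \<in> e} = 2"
proof (rule degree_eq_2)
  define post where "post = (if y = - 1 then {(x, - 1), (x, 0)} else {(x, h), (x, h + 1)})"
  have m: "m \<ge> 1" using n_pos by (simp add: m_def)
  show "{(0, y), (m, y)} \<in> E" "post \<in> E" using assms outer_edge by (auto simp: post_def)
  show "(x, y) \<in> {(0, y), (m, y)}" "(x, y) \<in> post" using assms by (auto simp: post_def)
  show "{(0, y), (m, y)} \<noteq> post" using assms m by (auto simp: post_def doubleton_eq_iff)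
  show "e = {(0, y), (m, y)} \<or> e = post" if "e \<in> E" "(x, y) \<in> e" for e
    using that(1)
  proof (cases rule: edge_cases)
    case (strand j l)
    then have "j < n" "Suc l \<le> twists j" by (auto elim: strand.cases)
    then have "y \<noteq> real l" "y \<noteq> real l + 1"
      using twists_less[of j] assms(2) by (auto simp: add.commute)
    then show ?thesis
      using that(2) strand by (auto simp: rising_def falling_def elim: strand.cases)
  next
    case (vertical j z)
    then have "y = real (twists j) \<or> y = h" using that(2) by auto
    then show ?thesis using assms(2) twists_less[OF vertical(1)] by auto
  next
    case (join j z)
    then have "y = z" using that(2) by auto
    then show ?thesis using assms(2) h_ge_1 join(2) by auto
  next
    case (post z w)
    then have "x = z" "y = w \<or> y = w + 1" using that(2) by auto
    then have "e = post" using assms(2) post h_ge_1 by (auto simp: post_def)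
    then show ?thesis ..
  next
    case (bar z)
    then have "y = z" using that(2) by auto
    then show ?thesis using bar by simp
  qed
qed

lemma plane_curve: "plane_curve E (pretzel_crossings ps)"
proof (rule plane_curveI)
  show "finite E"
    unfolding E_def pretzel_diagram_def twist_edges_def vertical_edges_def joining_edges_def outer_edges_def
    by (simp add: Let_def)
  have m: "m \<ge> 1" using n_pos by (simp add: m_def)
  show "card e = 2" if "e \<in> E" for e
    using that
  proof (cases rule: edge_cases)
    case (strand i k)
    then show ?thesis by cases (auto simp: rising_def falling_def)
  next
    case (vertical i x)
    then show ?thesis using twists_less[of i] by auto
  qed (use m in auto)
  show "card {e \<in> E. v \<in> e} = 2" if v: "v \<in> \<Union>E" for v
  proof -
    obtain e where e: "e \<in> E" "v \<in> e" using v by blast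
    from e(1) show ?thesis
    proof (cases rule: edge_cases)
      case (strand i k)
      then show ?thesis
        using e(2) degree_left[of i k] degree_left[of i "Suc k"] degree_right[of i k] degree_right[of i "Suc k"]
        by cases (auto simp: rising_def falling_def add.commute)
    next
      case (vertical i x)
      then show ?thesis
        using e(2) degree_left[of i "twists i"] degree_right[of i "twists i"] degree_top[of i x] by auto
    next
      case (join i y)
      then show ?thesis
        using e(2) degree_left[of "Suc i" 0] degree_right[of i 0] degree_top[of i "2 * real i + 1"]
          degree_top[of "Suc i" "2 * real i + 2"] by (auto simp: add.commute)
    next
      case (post x y)
      have "m = 2 * real (n - 1) + 1" using n_pos by (simp add: m_def of_nat_diff)
      then show ?thesis
        using e(2) post degree_corner[of x "-1"] degree_corner[of x "h + 1"] degree_left[of 0 0] degree_right[of "n - 1" 0]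
          degree_top[of 0 0] degree_top[of "n - 1" m] n_pos by auto
    next
      case (bar y)
      then show ?thesis using e(2) degree_corner[of 0 y] degree_corner[of m y] by auto
    qed
  qed
  show "pretzel_crossings ps \<subseteq> E \<times> E"
    using strand_edge[OF strand.intros(1)] strand_edge[OF strand.intros(2)]
    by (auto simp: pretzel_crossings_def n_def twists_def split: if_splits)
  show "matching (pretzel_crossings ps)"
    unfolding matching_def
  proof clarify
    fix e f e' f' assume *: "(e, f) \<in> pretzel_crossings ps" "(e', f') \<in> pretzel_crossings ps" "{e, f} \<inter> {e', f'} \<noteq> {}"
    obtain i k where 1: "(e, f) = (if ps ! i > 0 then (rising i k, falling i k) else (falling i k, rising i k))"
      using *(1) unfolding pretzel_crossings_def by blast
    obtain j l where 2: "(e', f') = (if ps ! j > 0 then (rising j l, falling j l) else (falling j l, rising j l))"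
      using *(2) unfolding pretzel_crossings_def by blast
    have "i = j \<and> k = l" using 1 2 *(3) by (auto split: if_splits)
    then have "(e, f) = (e', f')" using 1 2 by (simp only:)
    then show "e = e' \<and> f = f'" by simp
  qed
  show "crosses e f" if "(e, f) \<in> pretzel_crossings ps" for e f
  proof -
    obtain i k where "(e, f) = (rising i k, falling i k) \<or> (e, f) = (falling i k, rising i k)"
      using \<open>(e, f) \<in> pretzel_crossings ps\<close> unfolding pretzel_crossings_def by (auto split: if_splits)
    then show ?thesis
      using crosses_rising_falling crosses_sym[of "falling i k" "rising i k"] by auto
  qed
qed (rule edges_apart)

end

section \<open>Three columns\<close>

lemma segment_bounds:
  assumes "(X, Y) \<in> convex hull {(x1, y1), (x2, y2 :: real)}" and "x1 < (x2 :: real)"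
  obtains t where "0 \<le> t" "t \<le> 1" "X = x1 + t * (x2 - x1)" "Y = (1 - t) * y1 + t * y2"
    "x1 \<le> X" "X \<le> x2" "min y1 y2 \<le> Y" "Y \<le> max y1 y2" "X = x1 \<longrightarrow> t = 0" "X = x2 \<longrightarrow> t = 1"
proof -
  obtain t where t: "0 \<le> t" "t \<le> 1" "X = x1 + t * (x2 - x1)" "Y = y1 + t * (y2 - y1)"
    using assms(1) unfolding in_segment_iff by blast
  have Y: "Y = (1 - t) * y1 + t * y2" using t(4) by (simp add: algebra_simps)
  have "t * (x2 - x1) \<le> 1 * (x2 - x1)" using t assms(2) by (intro mult_right_mono) auto
  moreover have "0 \<le> t * (x2 - x1)" using t assms(2) by simp
  moreover have d: "X - x1 = t * (x2 - x1)" using t(3) by simp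
  ultimately have X: "x1 \<le> X" "X \<le> x2" by simp_all
  have "(1 - t) * min y1 y2 + t * min y1 y2 \<le> Y" "Y \<le> (1 - t) * max y1 y2 + t * max y1 y2"
    unfolding Y using t by (intro add_mono mult_left_mono; simp)+
  then have "min y1 y2 \<le> Y" "Y \<le> max y1 y2" by (simp_all add: algebra_simps)
  moreover have "X = x1 \<longrightarrow> t = 0" "X = x2 \<longrightarrow> t = 1"
    using d assms(2) by auto
  ultimately show ?thesis using that[OF t(1-3) Y X] by blast
qed

lemma touching_segments:
  assumes "x1 < x2" and "x2 < (x3 :: real)"
  shows "convex hull {(x1, y1), (x2, y2)} \<inter> convex hull {(x2, y2), (x3, y3)} \<subseteq> {(x1, y1), (x2, y2)} \<inter> {(x2, y2), (x3, y3 :: real)}"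
proof -
  have "(X, Y) = (x2, y2)"
    if "(X, Y) \<in> convex hull {(x1, y1), (x2, y2)}" "(X, Y) \<in> convex hull {(x2, y2), (x3, y3)}" for X Y
  proof (rule segment_bounds[OF that(1) assms(1)])
    fix t assume t: "X \<le> x2" "X = x2 \<longrightarrow> t = 1" "Y = (1 - t) * y1 + t * y2"
    have "x2 \<le> X" by (rule segment_bounds[OF that(2) assms(2)])
    then show "(X, Y) = (x2, y2)" using t by simp
  qed
  then show ?thesis by auto
qed

lemma separated_segments:
  assumes "x1 < x2" and "x2 < x3" and "x3 < (x4 :: real)"
  shows "convex hull {(x1, y1), (x2, y2)} \<inter> convex hull {(x3, y3), (x4, y4 :: real)} = {}"
proof -
  have False if "(X, Y) \<in> convex hull {(x1, y1), (x2, y2)}" "(X, Y) \<in> convex hull {(x3, y3), (x4, y4)}" for X Y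
  proof -
    have "X \<le> x2" by (rule segment_bounds[OF that(1) assms(1)])
    moreover have "x3 \<le> X" by (rule segment_bounds[OF that(2) assms(3)])
    ultimately show False using assms by simp
  qed
  then show ?thesis by auto
qed

lemma abutting_segments:
  assumes "x1 < x2" and "x2 < (x3 :: real)" and "y2 \<noteq> (y2' :: real)"
  shows "convex hull {(x1, y1), (x2, y2)} \<inter> convex hull {(x2, y2'), (x3, y3)} = {}"
proof -
  have False
    if "(X, Y) \<in> convex hull {(x1, y1), (x2, y2)}" "(X, Y) \<in> convex hull {(x2, y2'), (x3, y3)}" for X Y
  proof (rule segment_bounds[OF that(1) assms(1)], rule segment_bounds[OF that(2) assms(2)])
    fix t s assume t: "X \<le> x2" "X = x2 \<longrightarrow> t = 1" "Y = (1 - t) * y1 + t * y2"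
      and s: "x2 \<le> X" "X = x2 \<longrightarrow> s = 0" "Y = (1 - s) * y2' + s * y3"
    then have "X = x2" by simp
    then have "Y = y2" "Y = y2'" using t s by simp_all
    then show False using assms(3) by simp
  qed
  then show ?thesis by auto
qed

lemma ordered_segments:
  assumes "x1 < (x2 :: real)" and "y1' \<le> y1" and "y2' \<le> y2" and "y1' < y1 \<or> y2' < (y2 :: real)"
  shows "convex hull {(x1, y1), (x2, y2)} \<inter> convex hull {(x1, y1'), (x2, y2')} \<subseteq> {(x1, y1), (x2, y2)} \<inter> {(x1, y1'), (x2, y2')}"
proof -
  have "(X, Y) \<in> {(x1, y1), (x2, y2)} \<inter> {(x1, y1'), (x2, y2')}"
    if "(X, Y) \<in> convex hull {(x1, y1), (x2, y2)}" "(X, Y) \<in> convex hull {(x1, y1'), (x2, y2')}" for X Y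
  proof (rule segment_bounds[OF that(1) assms(1)], rule segment_bounds[OF that(2) assms(1)])
    fix t s assume t: "0 \<le> t" "t \<le> 1" "X = x1 + t * (x2 - x1)" "Y = (1 - t) * y1 + t * y2"
      and s: "X = x1 + s * (x2 - x1)" "Y = (1 - s) * y1' + s * y2'"
    have "t * (x2 - x1) = s * (x2 - x1)" using t(3) s(1) by linarith
    then have "t = s" using assms(1) by simp
    then have "(1 - t) * (y1 - y1') + t * (y2 - y2') = 0" using t(4) s(2) by (simp add: algebra_simps)
    moreover have "0 \<le> (1 - t) * (y1 - y1')" "0 \<le> t * (y2 - y2')" using t(1,2) assms(2,3) by simp_all
    ultimately have 0: "(1 - t) * (y1 - y1') = 0" "t * (y2 - y2') = 0" by linarith+
    show "(X, Y) \<in> {(x1, y1), (x2, y2)} \<inter> {(x1, y1'), (x2, y2')}"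
    proof (cases "t = 1")
      case True
      then have "X = x2" "Y = y2" "y2 = y2'" using t(3,4) 0(2) by simp_all
      then show ?thesis by simp
    next
      case False
      then have "y1 = y1'" using 0(1) by simp
      then have "t = 0" using assms(4) 0(2) by auto
      then have "X = x1" "Y = y1" using t(3,4) by simp_all
      then show ?thesis using \<open>y1 = y1'\<close> by simp
    qed
  qed
  then show ?thesis by auto
qed

locale columns =
  fixes p q r :: nat
  assumes pos: "p \<ge> 1" "q \<ge> 1" "r \<ge> 1"
begin

sublocale pretzel "[- int p, int q, int r]"
  by unfold_locales simp

lemma pretzel_link_eq: "pretzel_link [- int p, int q, int r] = link_of (diagram_of E (pretzel_crossings [- int p, int q, int r]))"
  unfolding pretzel_link_def E_def by (rule arg_cong[OF pretzel_diagram_eq])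

abbreviation C where "C \<equiv> pretzel_crossings [- int p, int q, int r]"

lemma n_eq: "n = 3" by (simp add: n_def)
lemma m_eq: "m = 5" by (simp add: m_def n_eq)
lemma h_eq: "h = 1 + real p + real q + real r" by (simp add: h_def box_height_def numeral_3_eq_3)
lemma twists_eq [simp]: "twists 0 = p" "twists (Suc 0) = q" "twists 2 = r"
  by (simp_all add: twists_def)

lemma less_n_iff: "i < n \<longleftrightarrow> i = 0 \<or> i = Suc 0 \<or> i = 2"
  by (auto simp: n_eq)

lemma twists_shape:
  "rising 0 k = {(0, real k), (1, real k + 1)}" "falling 0 k = {(1, real k), (0, real k + 1)}"
  "rising (Suc 0) k = {(2, real k), (3, real k + 1)}" "falling (Suc 0) k = {(3, real k), (2, real k + 1)}"
  "rising 2 k = {(4, real k), (5, real k + 1)}" "falling 2 k = {(5, real k), (4, real k + 1)}"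
  by (simp_all add: rising_def falling_def)

definition frame where
  "frame = {{(0, real p), (0, h)}, {(1, real p), (1, h)}, {(2, real q), (2, h)}, {(3, real q), (3, h)},
      {(4, real r), (4, h)}, {(5, real r), (5, h)},
      {(1, 0), (2, 0)}, {(3, 0), (4, 0)}, {(1, h), (2, h)}, {(3, h), (4, h)},
      {(0, h), (0, h + 1)}, {(5, h), (5, h + 1)}, {(0, - 1), (0, 0)}, {(5, - 1), (5, 0)},
      {(0, - 1), (5, - 1)}, {(0, h + 1), (5, h + 1)}}"

lemma edge_shapes:
  assumes "e \<in> E"
  shows "(\<exists>k<p. e = rising 0 k \<or> e = falling 0 k) \<or> (\<exists>k<q. e = rising (Suc 0) k \<or> e = falling (Suc 0) k) \<or>
    (\<exists>k<r. e = rising 2 k \<or> e = falling 2 k) \<or>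
    e \<in> frame"
  using assms
proof (cases rule: edge_cases)
  case (strand i k)
  then have e: "e = rising i k \<or> e = falling i k" "k < twists i" "i < n" by (auto elim: strand.cases)
  from e(3) have "i = 0 \<or> i = Suc 0 \<or> i = 2" using less_n_iff by blast
  then have "(\<exists>k<p. e = rising 0 k \<or> e = falling 0 k) \<or> (\<exists>k<q. e = rising (Suc 0) k \<or> e = falling (Suc 0) k) \<or>
    (\<exists>k<r. e = rising 2 k \<or> e = falling 2 k)"
    using e(1,2) twists_eq by metis
  then show ?thesis by argo
next
  case (vertical i x)
  have "i = 0 \<or> i = Suc 0 \<or> i = 2" using vertical(1) less_n_iff by blast
  then have "e \<in> {{(0, real p), (0, h)}, {(1, real p), (1, h)}, {(2, real q), (2, h)}, {(3, real q), (3, h)},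
      {(4, real r), (4, h)}, {(5, real r), (5, h)}}"
    using vertical(2,3) by (elim disjE) simp_all
  then show ?thesis unfolding frame_def insert_iff empty_iff by argo
next
  case (join i y)
  then have "i = 0 \<or> i = Suc 0" by (auto simp: n_eq)
  then have "e \<in> {{(1, 0), (2, 0)}, {(3, 0), (4, 0)}, {(1, h), (2, h)}, {(3, h), (4, h)}}"
    using join(2,3) by (elim disjE) simp_all
  then show ?thesis unfolding frame_def insert_iff empty_iff by argo
next
  case (post x y)
  then have "e \<in> {{(0, h), (0, h + 1)}, {(5, h), (5, h + 1)}, {(0, - 1), (0, 0)}, {(5, - 1), (5, 0)}}"
    unfolding m_eq by (elim disjE) simp_all
  then show ?thesis unfolding frame_def insert_iff empty_iff by argo
next
  case (bar y)
  then have "e \<in> {{(0, - 1), (5, - 1)}, {(0, h + 1), (5, h + 1)}}"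
    unfolding m_eq by (elim disjE) simp_all
  then show ?thesis unfolding frame_def insert_iff empty_iff by argo
qed

lemma edge_members:
  "k < p \<Longrightarrow> rising 0 k \<in> E" "k < p \<Longrightarrow> falling 0 k \<in> E"
  "k < q \<Longrightarrow> rising (Suc 0) k \<in> E" "k < q \<Longrightarrow> falling (Suc 0) k \<in> E"
  "k < r \<Longrightarrow> rising 2 k \<in> E" "k < r \<Longrightarrow> falling 2 k \<in> E"
  "frame \<subseteq> E"
proof -
  show "k < p \<Longrightarrow> rising 0 k \<in> E" "k < p \<Longrightarrow> falling 0 k \<in> E"
  "k < q \<Longrightarrow> rising (Suc 0) k \<in> E" "k < q \<Longrightarrow> falling (Suc 0) k \<in> E"
  "k < r \<Longrightarrow> rising 2 k \<in> E" "k < r \<Longrightarrow> falling 2 k \<in> E"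
    using strand_edge[OF strand.intros(1)] strand_edge[OF strand.intros(2)] by (simp_all add: less_n_iff)
  have v: "{(x, real (twists i)), (x, h)} \<in> E" if "i = 0 \<or> i = Suc 0 \<or> i = 2" "x = 2 * real i \<or> x = 2 * real i + 1" for i x
    using vertical_edge[of i x] that by (simp add: less_n_iff)
  have j: "{(2 * real i + 1, y), (2 * real i + 2, y)} \<in> E" if "i = 0 \<or> i = Suc 0" "y = 0 \<or> y = h" for i y
    using join_edge[of i y] that by (auto simp: n_eq)
  show "frame \<subseteq> E"
    using v[of 0 0] v[of 0 1] v[of "Suc 0" 2] v[of "Suc 0" 3] v[of 2 4] v[of 2 5]
      j[of 0 0] j[of "Suc 0" 0] j[of 0 h] j[of "Suc 0" h] outer_edge unfolding m_eq frame_def by simp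
qed

lemma crossing_shapes:
  "(e, f) \<in> C \<longleftrightarrow> (\<exists>k<p. e = falling 0 k \<and> f = rising 0 k) \<or>
     (\<exists>k<q. e = rising (Suc 0) k \<and> f = falling (Suc 0) k) \<or> (\<exists>k<r. e = rising 2 k \<and> f = falling 2 k)"
proof -
  have set3: "{..<length [- int p, int q, int r]} = {0, Suc 0, 2}" by auto
  show ?thesis using pos unfolding pretzel_crossings_def set3 by auto
qed

lemma vertex_fst_nat: "e \<in> E \<Longrightarrow> v \<in> e \<Longrightarrow> \<exists>k. fst v = real k"
proof -
  assume "e \<in> E" "v \<in> e"
  then have "fst v \<in> {0, 1, 2, 3, 4, 5}"
    using edge_shapes[of e] by (auto simp: twists_shape frame_def)
  then have "fst v \<in> real ` {0, 1, 2, 3, 4, 5}" by simp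
  then show ?thesis by blast
qed

lemma not_vertex:
  assumes "\<And>k. x \<noteq> real k"
  shows "(x, y) \<notin> \<Union>E"
  using vertex_fst_nat assms by force

text \<open>
  A segment in the face between the second and the third column meets the diagram only in end
  points.
\<close>

lemma gap_apart:
  assumes x: "3 \<le> x1" "x1 < x2" "x2 \<le> 4" and y: "0 \<le> y1" "0 \<le> y2" "y1 < h" "y2 < h" "0 < y1 + y2"
    and left: "x1 = 3 \<Longrightarrow> y1 \<le> real q" "y1 = 0 \<Longrightarrow> x1 = 3" and right: "x2 = 4 \<Longrightarrow> y2 \<le> real r" "y2 = 0 \<Longrightarrow> x2 = 4"
    and f: "f \<in> E"
  shows "convex hull {(x1, y1), (x2, y2)} \<inter> convex hull f \<subseteq> {(x1, y1), (x2, y2)} \<inter> f"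
proof
  fix v assume v: "v \<in> convex hull {(x1, y1), (x2, y2)} \<inter> convex hull f"
  obtain X Y where XY: "v = (X, Y)" by (cases v)
  have vf: "(X, Y) \<in> convex hull f" and ve: "(X, Y) \<in> convex hull {(x1, y1), (x2, y2)}" using v XY by auto
  obtain t where t: "0 \<le> t" "t \<le> 1" "X = x1 + t * (x2 - x1)" "Y = (1 - t) * y1 + t * y2"
    "x1 \<le> X" "X \<le> x2" "min y1 y2 \<le> Y" "Y \<le> max y1 y2" "X = x1 \<longrightarrow> t = 0" "X = x2 \<longrightarrow> t = 1"
    using segment_bounds[OF ve x(2)] .
  have X3: "x1 = 3 \<and> (X, Y) = (x1, y1)" if "X = 3"
  proof -
    have "x1 = 3" using that t(5) x(1) by simp
    then show ?thesis using that t(4,9) by simp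
  qed
  have X4: "x2 = 4 \<and> (X, Y) = (x2, y2)" if "X = 4"
  proof -
    have "x2 = 4" using that t(6) x(3) by simp
    then show ?thesis using that t(4,10) by simp
  qed
  have X: "3 \<le> X" "X \<le> 4" using t(5,6) x by auto
  have Yh: "0 \<le> Y" "Y < h" using t(7,8) y by auto
  from f have "(X, Y) \<in> {(x1, y1), (x2, y2)} \<and> (X, Y) \<in> f"
  proof (cases rule: edge_cases)
    case (strand i k)
    note * = in_strand[OF strand vf]
    have "i = 0 \<or> i = Suc 0 \<or> i = 2" using *(6) less_n_iff by blast
    then have "X = 3 \<and> i = Suc 0 \<or> X = 4 \<and> i = 2" using * X by auto
    then show ?thesis
    proof (elim disjE conjE)
      assume "X = 3" "i = Suc 0"
      then show ?thesis using X3 *(5) by simp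
    next
      assume "X = 4" "i = 2"
      then show ?thesis using X4 *(5) by simp
    qed
  next
    case (vertical i z)
    then have z: "X = z" "real (twists i) \<le> Y" using vf twists_less[of i] by (auto simp: in_vertical)
    have "i = 0 \<or> i = Suc 0 \<or> i = 2" using vertical(1) less_n_iff by blast
    then have "X = 3 \<and> i = Suc 0 \<or> X = 4 \<and> i = 2" using z vertical(2) X by auto
    then show ?thesis
    proof (elim disjE conjE)
      assume X: "X = 3" and i: "i = Suc 0"
      then have "Y = real q" using X3 left(1) z(2) by simp
      then show ?thesis using X3 X vertical(3) z(1) i by simp
    next
      assume X: "X = 4" and i: "i = 2"
      then have "Y = real r" using X4 right(1) z(2) by simp
      then show ?thesis using X4 X vertical(3) z(1) i by simp
    qed
  next
    case (join i z)
    then have z: "Y = z" "2 * real i + 1 \<le> X" "X \<le> 2 * real i + 2" using vf by (auto simp: in_horizontal)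
    have i: "i = 0 \<or> i = Suc 0" using join(1) n_eq by auto
    have "Y = 0" using join(2) z Yh by auto
    then have i: "i = Suc 0" and "z = 0" using i z X by auto
    have "0 \<le> (1 - t) * y1" "0 \<le> t * y2" using t(1,2) y(1,2) by simp_all
    then have "(1 - t) * y1 = 0" "t * y2 = 0" using t(4) \<open>Y = 0\<close> by linarith+
    then have "t = 1 \<and> y2 = 0 \<or> t = 0 \<and> y1 = 0" using y(5) by auto
    then have "X = 3 \<or> X = 4"
    proof (elim disjE conjE)
      assume "t = 1" "y2 = 0"
      then have "X = x2" using t(3) by simp
      then show ?thesis using right(2) \<open>y2 = 0\<close> by simp
    next
      assume "t = 0" "y1 = 0"
      then have "X = x1" using t(3) by simp
      then show ?thesis using left(2) \<open>y1 = 0\<close> by simp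
    qed
    then show ?thesis
    proof
      assume "X = 3"
      then show ?thesis using X3 join(3) i \<open>z = 0\<close> \<open>Y = 0\<close> by simp
    next
      assume "X = 4"
      then show ?thesis using X4 join(3) i \<open>z = 0\<close> \<open>Y = 0\<close> by simp
    qed
  next
    case (post z w)
    then have "X = z" using vf by (auto simp: in_vertical)
    then show ?thesis using post(1) X m_eq by auto
  next
    case (bar w)
    then have "Y = w" using vf by (auto simp: in_horizontal m_eq)
    then show ?thesis using bar(1) Yh by auto
  qed
  then show "v \<in> {(x1, y1), (x2, y2)} \<inter> f" using XY by simp
qed

end

section \<open>The first column is a single crossing\<close>

lemma not_nat [simp]: "13 / 4 \<noteq> real k" "15 / 4 \<noteq> real k" "3 / 2 \<noteq> real k" "- 1 \<noteq> real k"
proof -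
  show "13 / 4 \<noteq> real k"
  proof
    assume "13 / 4 = real k"
    then have "real 13 = real (4 * k)" by simp
    then have "13 = 4 * k" by (simp only: of_nat_eq_iff)
    then show False by presburger
  qed
  show "15 / 4 \<noteq> real k"
  proof
    assume "15 / 4 = real k"
    then have "real 15 = real (4 * k)" by simp
    then have "15 = 4 * k" by (simp only: of_nat_eq_iff)
    then show False by presburger
  qed
  show "3 / 2 \<noteq> real k"
  proof
    assume "3 / 2 = real k"
    then have "real 3 = real (2 * k)" by simp
    then have "3 = 2 * k" by (simp only: of_nat_eq_iff)
    then show False by presburger
  qed
qed simp

locale single_crossing = columns 1 q r for q r
begin

text \<open>
  The overpass follows the over strand of the lowest crossing of the second column, that of the first
  column, the outer top arc and the over strand of the highest crossing of the third column.
\<close>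

definition over_old :: "plane list" where
  "over_old = [(3, 1), (2, 0), (1, 0), (0, 1), (0, h), (0, h + 1), (5, h + 1), (5, h), (5, real r), (4, real r - 1)]"

text \<open>
  The new path descends below the height 1 and rises again, so that its middle segment does not depend on
  \<open>q\<close> and \<open>r\<close>; this is where the underpass will cross it.
\<close>

definition over_new :: "plane list" where
  "over_new = [(3, 1), (13 / 4, 1 / 4), (15 / 4, 1 / 2), (4, real r - 1)]"

definition E\<^sub>0 where "E\<^sub>0 = E - path_edges over_old"
definition C\<^sub>0 where "C\<^sub>0 = C \<inter> E\<^sub>0 \<times> E\<^sub>0"
definition E\<^sub>1 where "E\<^sub>1 = E\<^sub>0 \<union> path_edges over_new"

lemma q_pos: "q \<ge> 1" and r_pos: "r \<ge> 1"
  using pos by auto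

lemma h_large: "h \<ge> 2 + real q + real r"
  using h_eq by simp

lemma last_twist: "rising 2 (r - 1) = {(5, real r), (4, real r - 1)}" "falling 2 (r - 1) = {(5, real r - 1), (4, real r)}"
  using r_pos by (auto simp: twists_shape of_nat_diff)

lemma over_old_subset: "path_edges over_old \<subseteq> E"
proof -
  have "rising (Suc 0) 0 \<in> E" "falling 0 0 \<in> E" "rising 2 (r - 1) \<in> E"
    using edge_members(1-6) q_pos r_pos by auto
  then show ?thesis
    using edge_members(7) unfolding over_old_def last_twist frame_def by (simp add: twists_shape insert_commute)
qed

lemma over_old_distinct: "distinct over_old"
  using h_large q_pos r_pos by (auto simp: over_old_def)

lemma over_new_distinct: "distinct over_new"
  by (simp add: over_new_def)

text \<open>
  The new overpass crosses nothing, as it stays in one face.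
\<close>

lemma over_new_apart_old: "e \<in> path_edges over_new \<Longrightarrow> f \<in> E \<Longrightarrow> convex hull e \<inter> convex hull f \<subseteq> e \<inter> f"
proof -
  assume e: "e \<in> path_edges over_new" and f: "f \<in> E"
  have "convex hull {(3, 1), (13 / 4, 1 / 4)} \<inter> convex hull f \<subseteq> {(3, 1), (13 / 4, 1 / 4)} \<inter> f"
    by (rule gap_apart) (use f h_large q_pos r_pos in auto)
  moreover have "convex hull {(13 / 4, 1 / 4), (15 / 4, 1 / 2)} \<inter> convex hull f \<subseteq> {(13 / 4, 1 / 4), (15 / 4, 1 / 2)} \<inter> f"
    by (rule gap_apart) (use f h_large q_pos r_pos in auto)
  moreover have "convex hull {(15 / 4, 1 / 2), (4, real r - 1)} \<inter> convex hull f \<subseteq> {(15 / 4, 1 / 2), (4, real r - 1)} \<inter> f"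
    by (rule gap_apart) (use f h_large q_pos r_pos in auto)
  ultimately show ?thesis using e unfolding over_new_def by auto
qed

lemma over_new_self:
  assumes "e \<in> path_edges over_new" and "f \<in> path_edges over_new" and "e \<noteq> f"
  shows "convex hull e \<inter> convex hull f \<subseteq> e \<inter> f"
proof -
  note 1 = touching_segments[of 3 "13 / 4" "15 / 4" 1 "1 / 4" "1 / 2"]
    and 2 = touching_segments[of "13 / 4" "15 / 4" 4 "1 / 4" "1 / 2" "real r - 1"]
    and 3 = separated_segments[of 3 "13 / 4" "15 / 4" 4 1 "1 / 4" "1 / 2" "real r - 1"]
  show ?thesis
    using assms unfolding over_new_def path_edges.simps insert_iff empty_iff
    by (elim disjE) (use 1 2 3 in \<open>simp_all add: Int_commute\<close>)
qed

lemma over_strand: "(e, f) \<in> C \<Longrightarrow> f \<notin> path_edges over_old"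
proof -
  assume "(e, f) \<in> C"
  then consider k where "f = rising 0 k" | k where "f = falling (Suc 0) k" | k where "f = falling 2 k"
    unfolding crossing_shapes by blast
  then show ?thesis
    by cases (auto simp: over_old_def twists_shape doubleton_eq_iff)
qed

lemma reroute_over: "plane_curve E\<^sub>1 C\<^sub>0" "E\<^sub>0 \<inter> path_edges over_new = {}"
proof -
  have *: "plane_curve (E\<^sub>0 \<union> path_edges over_new) (C\<^sub>0 \<union> {}) \<and> E\<^sub>0 \<inter> path_edges over_new = {}"
  proof (rule plane_curve_reroute[OF plane_curve over_old_distinct _ over_old_subset over_new_distinct])
    show "matching (C\<^sub>0 \<union> {})"
      using plane_curveD(5)[OF plane_curve] by (rule matching_subset) (auto simp: C\<^sub>0_def)
    show "set (butlast (tl over_new)) \<inter> \<Union>E\<^sub>0 = {}"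
      using not_vertex[OF not_nat(1), of "1 / 4"] not_vertex[OF not_nat(2), of "1 / 2"]
      by (auto simp: over_new_def E\<^sub>0_def)
    show "convex hull e \<inter> convex hull f \<subseteq> e \<inter> f"
      if "e \<in> path_edges over_new" "f \<in> path_edges over_new" "e \<noteq> f" for e f
      using over_new_self[OF that] .
    show "convex hull e \<inter> convex hull f \<subseteq> e \<inter> f" if "e \<in> path_edges over_new" "f \<in> E\<^sub>0" for e f
      using over_new_apart_old that E\<^sub>0_def by blast
    show "E\<^sub>0 = E - path_edges over_old" by (rule E\<^sub>0_def)
    show "C\<^sub>0 = C \<inter> E\<^sub>0 \<times> E\<^sub>0" by (rule C\<^sub>0_def)
  qed (simp_all add: over_old_def over_new_def)
  then show "plane_curve E\<^sub>1 C\<^sub>0" "E\<^sub>0 \<inter> path_edges over_new = {}" by (simp_all add: E\<^sub>1_def)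
qed

lemma isotopic_over: "ambient_isotopic S3 (pretzel_link [- 1, int q, int r]) (link_of (diagram_of E\<^sub>1 C\<^sub>0))"
proof -
  have "ambient_isotopic S3 (link_of (diagram_of E C)) (link_of (diagram_of (E\<^sub>0 \<union> path_edges over_new) (C\<^sub>0 \<union> {})))"
  proof (rule ambient_isotopic_reroute[where vs = over_old and u = True, OF plane_curve _ over_old_distinct _ over_old_subset over_new_distinct])
    show "plane_curve (E\<^sub>0 \<union> path_edges over_new) (C\<^sub>0 \<union> {})" "E\<^sub>0 \<inter> path_edges over_new = {}"
      using reroute_over by (simp_all add: E\<^sub>1_def)
    show "(if True then f else e) \<notin> path_edges over_old" if "(e, f) \<in> C" for e f
      using over_strand[OF that] by simp
    show "E\<^sub>0 = E - path_edges over_old" by (rule E\<^sub>0_def)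
    show "C\<^sub>0 = C \<inter> E\<^sub>0 \<times> E\<^sub>0" by (rule C\<^sub>0_def)
  qed (simp_all add: over_old_def over_new_def)
  then show ?thesis
    using pretzel_link_eq by (simp add: E\<^sub>1_def)
qed

end

lemma strand_not_axis_parallel [simp]:
  "rising i k \<noteq> {(x, y), (x, y')}" "falling i k \<noteq> {(x, y), (x, y')}"
  "rising i k \<noteq> {(x, y), (x', y)}" "falling i k \<noteq> {(x, y), (x', y)}"
  "{(x, y), (x, y')} \<noteq> rising i k" "{(x, y), (x, y')} \<noteq> falling i k"
  "{(x, y), (x', y)} \<noteq> rising i k" "{(x, y), (x', y)} \<noteq> falling i k"
  by (auto simp: rising_def falling_def doubleton_eq_iff)

text \<open>
  If the second or the third column consists of a single crossing, rerouting the overpass leaves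
  crossings in one column only.  Here are the flows for these two cases; \<open>Q\<close> and \<open>R\<close> are the numbers
  of crossings of the second and third column and \<open>H\<close> is the height of the boxes.
\<close>

definition flow_right_single :: "real \<Rightarrow> real \<Rightarrow> plane \<Rightarrow> plane set" where
  "flow_right_single Q H = (\<lambda>(x, y).
    if x = 0 then if y = 0 then {(0, - 1), (0, 0)} else {(0, - 1), (5, - 1)}
    else if x = 1 then if y = H then {(1, 1), (1, H)} else {(0, 0), (1, 1)}
    else if x = 2 then if y = H then {(1, H), (2, H)} else if y = Q then {(2, Q), (2, H)} else {(2, y), (3, y + 1)}
    else if x = 3 then if y = H then {(3, Q), (3, H)} else if y = 0 then {(3, 0), (2, 1)}
      else if y = 1 then {(3, 1), (13 / 4, 1 / 4)} else {(2, y - 1), (3, y)}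
    else if x = 13 / 4 then {(13 / 4, 1 / 4), (15 / 4, 1 / 2)}
    else if x = 15 / 4 then {(15 / 4, 1 / 2), (4, 0)}
    else if x = 4 then if y = H then {(3, H), (4, H)} else if y = 0 then {(3, 0), (4, 0)} else {(4, 1), (4, H)}
    else if y = 0 then {(5, 0), (4, 1)} else {(5, - 1), (5, 0)})"

definition flow_left_single :: "real \<Rightarrow> real \<Rightarrow> plane \<Rightarrow> plane set" where
  "flow_left_single R H = (\<lambda>(x, y).
    if x = 0 then if y = 0 then {(0, 0), (1, 1)} else {(0, - 1), (0, 0)}
    else if x = 1 then if y = H then {(1, H), (2, H)} else {(1, 1), (1, H)}
    else if x = 2 then if y = H then {(2, 1), (2, H)} else {(3, 0), (2, 1)}
    else if x = 3 then if y = H then {(3, H), (4, H)} else if y = 1 then {(3, 1), (3, H)} else {(3, 0), (4, 0)}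
    else if x = 13 / 4 then {(3, 1), (13 / 4, 1 / 4)}
    else if x = 15 / 4 then {(13 / 4, 1 / 4), (15 / 4, 1 / 2)}
    else if x = 4 then if y = H then {(4, R), (4, H)} else if y = R then {(5, R - 1), (4, R)}
      else if y = R - 1 then {(15 / 4, 1 / 2), (4, R - 1)} else {(4, y), (5, y + 1)}
    else if y = 0 then {(5, - 1), (5, 0)} else if y = - 1 then {(0, - 1), (5, - 1)} else {(4, y - 1), (5, y)})"

definition directed :: "(plane \<Rightarrow> plane set) \<Rightarrow> plane set \<Rightarrow> bool" where
  "directed \<tau> e \<longleftrightarrow> (\<exists>a b. e = {a, b} \<and> \<tau> a = e \<and> \<tau> b \<noteq> e)"

lemma directed_iff: "directed \<tau> {a, b} \<longleftrightarrow> (\<tau> a = {a, b}) \<noteq> (\<tau> b = {a, b})"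
proof
  assume "directed \<tau> {a, b}"
  then obtain x y where *: "{a, b} = {x, y}" "\<tau> x = {a, b}" "\<tau> y \<noteq> {a, b}"
    unfolding directed_def by blast
  then have "x = a \<and> y = b \<or> x = b \<and> y = a" by (metis doubleton_eq_iff)
  then show "(\<tau> a = {a, b}) \<noteq> (\<tau> b = {a, b})" using *(2,3) by metis
next
  assume "(\<tau> a = {a, b}) \<noteq> (\<tau> b = {a, b})"
  then show "directed \<tau> {a, b}" unfolding directed_def by (metis insert_commute)
qed

lemma flow_right_single_crossings:
  assumes "1 \<le> K" and "K + 1 \<le> Q" and "Q + 3 \<le> H"
  shows "flow_right_single Q H (2, K) = {(2, K), (3, K + 1)}" "flow_right_single Q H (3, K + 1) = {(2, K), (3, K + 1)}"
    "flow_right_single Q H (3, K) \<noteq> {(3, K), (2, K + 1)}" "flow_right_single Q H (2, K + 1) \<noteq> {(3, K), (2, K + 1)}"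
  using assms by (auto simp: flow_right_single_def doubleton_eq_iff)

lemma flow_right_single_arcs:
  assumes "1 \<le> Q" and "Q + 3 \<le> H"
  shows "\<forall>e\<in>{{(3, 0), (2, 1)}, {(5, 0), (4, 1)}, {(0, 0), (1, 1)},
      {(1, 1), (1, H)}, {(2, Q), (2, H)}, {(3, Q), (3, H)}, {(4, 1), (4, H)},
      {(3, 0), (4, 0)}, {(1, H), (2, H)}, {(3, H), (4, H)},
      {(0, - 1), (0, 0)}, {(5, - 1), (5, 0)}, {(0, - 1), (5, - 1)},
      {(3, 1), (13 / 4, 1 / 4)}, {(13 / 4, 1 / 4), (15 / 4, 1 / 2)}, {(15 / 4, 1 / 2), (4, 0)}}.
    directed (flow_right_single Q H) e"
  unfolding ball_simps directed_iff using assms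
  by (intro conjI TrueI; simp add: flow_right_single_def doubleton_eq_iff)

lemma flow_left_single_crossings:
  assumes "0 \<le> K" and "K + 2 \<le> R" and "R + 3 \<le> H"
  shows "flow_left_single R H (4, K) = {(4, K), (5, K + 1)}" "flow_left_single R H (5, K + 1) = {(4, K), (5, K + 1)}"
    "flow_left_single R H (5, K) \<noteq> {(5, K), (4, K + 1)}" "flow_left_single R H (4, K + 1) \<noteq> {(5, K), (4, K + 1)}"
  using assms by (auto simp: flow_left_single_def doubleton_eq_iff)

lemma flow_left_single_arcs:
  assumes "2 \<le> R" and "R + 3 \<le> H"
  shows "\<forall>e\<in>{{(3, 0), (2, 1)}, {(5, R - 1), (4, R)}, {(0, 0), (1, 1)},
      {(1, 1), (1, H)}, {(2, 1), (2, H)}, {(3, 1), (3, H)}, {(4, R), (4, H)},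
      {(3, 0), (4, 0)}, {(1, H), (2, H)}, {(3, H), (4, H)},
      {(0, - 1), (0, 0)}, {(5, - 1), (5, 0)}, {(0, - 1), (5, - 1)},
      {(3, 1), (13 / 4, 1 / 4)}, {(13 / 4, 1 / 4), (15 / 4, 1 / 2)}, {(15 / 4, 1 / 2), (4, R - 1)}}.
    directed (flow_left_single R H) e"
  unfolding ball_simps directed_iff using assms
  by (intro conjI TrueI; simp add: flow_left_single_def doubleton_eq_iff)

context single_crossing
begin

lemma path_over_old: "path_edges over_old = {rising (Suc 0) 0, {(1, 0), (2, 0)}, falling 0 0, {(0, 1), (0, h)},
    {(0, h), (0, h + 1)}, {(0, h + 1), (5, h + 1)}, {(5, h + 1), (5, h)}, {(5, h), (5, real r)}, rising 2 (r - 1)}"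
  unfolding over_old_def last_twist by (simp add: twists_shape insert_commute)

lemma path_over_new: "path_edges over_new = {{(3, 1), (13 / 4, 1 / 4)}, {(13 / 4, 1 / 4), (15 / 4, 1 / 2)},
    {(15 / 4, 1 / 2), (4, real r - 1)}}"
  by (simp add: over_new_def)

lemma C\<^sub>0_I:
  "1 \<le> k \<Longrightarrow> k < q \<Longrightarrow> (rising (Suc 0) k, falling (Suc 0) k) \<in> C\<^sub>0"
  "Suc k < r \<Longrightarrow> (rising 2 k, falling 2 k) \<in> C\<^sub>0"
  using crossing_shapes edge_members(1-6) by (auto simp: C\<^sub>0_def E\<^sub>0_def path_over_old)

lemma C\<^sub>0_cases:
  assumes "(e, f) \<in> C\<^sub>0"
  obtains k where "1 \<le> k" "k < q" "e = rising (Suc 0) k" "f = falling (Suc 0) k"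
  | k where "Suc k < r" "e = rising 2 k" "f = falling 2 k"
proof -
  have ef: "e \<in> E\<^sub>0" "f \<in> E\<^sub>0" "(e, f) \<in> C" using assms by (auto simp: C\<^sub>0_def)
  from ef(3) consider k where "k < 1" "e = falling 0 k" | k where "k < q" "e = rising (Suc 0) k" "f = falling (Suc 0) k"
    | k where "k < r" "e = rising 2 k" "f = falling 2 k"
    unfolding crossing_shapes by blast
  then show ?thesis
  proof cases
    case 1
    then show ?thesis using ef(1) by (simp add: E\<^sub>0_def path_over_old)
  next
    case 2
    then have "k \<noteq> 0" using ef(1) by (auto simp: E\<^sub>0_def path_over_old)
    then show ?thesis using 2 that(1)[of k] by simp
  next
    case 3
    then have "k \<noteq> r - 1" using ef(1) by (auto simp: E\<^sub>0_def path_over_old)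
    then show ?thesis using 3 that(2)[of k] by simp
  qed
qed

lemma E\<^sub>1_arcs:
  assumes e: "e \<in> E\<^sub>1" and nc: "e \<notin> fst ` C\<^sub>0 \<union> snd ` C\<^sub>0"
  shows "e \<in> {falling (Suc 0) 0, falling 2 (r - 1), rising 0 0,
      {(1, 1), (1, h)}, {(2, real q), (2, h)}, {(3, real q), (3, h)}, {(4, real r), (4, h)},
      {(3, 0), (4, 0)}, {(1, h), (2, h)}, {(3, h), (4, h)},
      {(0, - 1), (0, 0)}, {(5, - 1), (5, 0)}, {(0, - 1), (5, - 1)},
      {(3, 1), (13 / 4, 1 / 4)}, {(13 / 4, 1 / 4), (15 / 4, 1 / 2)}, {(15 / 4, 1 / 2), (4, real r - 1)}}"
proof -
  from e consider "e \<in> E" "e \<notin> path_edges over_old" | "e \<in> path_edges over_new"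
    by (auto simp: E\<^sub>1_def E\<^sub>0_def)
  then show ?thesis
  proof cases
    case 1
    from edge_shapes[OF 1(1)] consider k where "k < 1" "e = rising 0 k \<or> e = falling 0 k"
      | k where "k < q" "e = rising (Suc 0) k" | k where "k < q" "e = falling (Suc 0) k"
      | k where "k < r" "e = rising 2 k" | k where "k < r" "e = falling 2 k"
      | "e \<in> frame"
      by blast
    then show ?thesis
    proof cases
      case 1: 1
      then show ?thesis using \<open>e \<notin> path_edges over_old\<close> by (auto simp: path_over_old)
    next
      case 2
      then have "k \<noteq> 0" using \<open>e \<notin> path_edges over_old\<close> by (auto simp: path_over_old)
      then have "(rising (Suc 0) k, falling (Suc 0) k) \<in> C\<^sub>0" using 2 C\<^sub>0_I(1)[of k] by simp
      then have "e \<in> fst ` C\<^sub>0" using 2 image_eqI[of e fst "(rising (Suc 0) k, falling (Suc 0) k)"] by simp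
      then show ?thesis using nc by simp
    next
      case 3
      have "k = 0"
      proof (rule ccontr)
        assume "k \<noteq> 0"
        then have "(rising (Suc 0) k, falling (Suc 0) k) \<in> C\<^sub>0" using 3 C\<^sub>0_I(1)[of k] by simp
        then have "e \<in> snd ` C\<^sub>0" using 3 image_eqI[of e snd "(rising (Suc 0) k, falling (Suc 0) k)"] by simp
        then show False using nc by simp
      qed
      then show ?thesis using 3 by simp
    next
      case 4
      then have "k \<noteq> r - 1" using \<open>e \<notin> path_edges over_old\<close> by (auto simp: path_over_old)
      then have "(rising 2 k, falling 2 k) \<in> C\<^sub>0" using 4 C\<^sub>0_I(2)[of k] by simp
      then have "e \<in> fst ` C\<^sub>0" using 4 image_eqI[of e fst "(rising 2 k, falling 2 k)"] by simp
      then show ?thesis using nc by simp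
    next
      case 5
      have "k = r - 1"
      proof (rule ccontr)
        assume "k \<noteq> r - 1"
        then have "(rising 2 k, falling 2 k) \<in> C\<^sub>0" using 5 C\<^sub>0_I(2)[of k] by simp
        then have "e \<in> snd ` C\<^sub>0" using 5 image_eqI[of e snd "(rising 2 k, falling 2 k)"] by simp
        then show False using nc by simp
      qed
      then show ?thesis using 5 by simp
    next
      case 6
      moreover have "e \<notin> {{(0, 1), (0, h)}, {(5, real r), (5, h)}, {(1, 0), (2, 0)}, {(0, h), (0, h + 1)},
          {(5, h), (5, h + 1)}, {(0, h + 1), (5, h + 1)}}"
        using \<open>e \<notin> path_edges over_old\<close> by (simp add: path_over_old insert_commute)
      ultimately show ?thesis unfolding frame_def insert_iff empty_iff of_nat_1 by argo
    qed
  next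
    case 2
    then show ?thesis unfolding path_over_new insert_iff empty_iff by argo
  qed
qed

lemma last_r: "real (r - 1) = real r - 1"
  using r_pos by (simp add: of_nat_diff)

lemma alternating_right_single:
  assumes "r = 1"
  shows "alternating_diagram (diagram_of E\<^sub>1 C\<^sub>0)"
proof (rule alternating_if_flow[OF reroute_over(1), where \<tau> = "flow_right_single (real q) h"])
  have rr: "real r = 1" using assms by simp
  have H: "real q + 3 \<le> h" "1 \<le> real q" using q_pos h_large rr by auto
  show "(v \<in> e \<longrightarrow> flow_right_single (real q) h v = e) \<and> (v \<in> f \<longrightarrow> flow_right_single (real q) h v \<noteq> f)" if "(e, f) \<in> C\<^sub>0" for e f v
    using that
  proof (cases rule: C\<^sub>0_cases)
    case (1 k)
    then have "1 \<le> real k" "real k + 1 \<le> real q" by auto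
    from flow_right_single_crossings[OF this H(1)] show ?thesis unfolding 1 twists_shape by blast
  next
    case (2 k)
    then show ?thesis using assms by simp
  qed
  show "\<exists>a b. e = {a, b} \<and> flow_right_single (real q) h a = e \<and> flow_right_single (real q) h b \<noteq> e"
    if "e \<in> E\<^sub>1" "e \<notin> fst ` C\<^sub>0 \<union> snd ` C\<^sub>0" for e
    using bspec[OF flow_right_single_arcs[OF H(2,1)], of e] E\<^sub>1_arcs[OF that]
    unfolding last_r twists_shape rr directed_def by (simp only: diff_self diff_add_cancel of_nat_0 add_0)
qed

lemma alternating_left_single:
  assumes "q = 1" and "r \<ge> 2"
  shows "alternating_diagram (diagram_of E\<^sub>1 C\<^sub>0)"
proof (rule alternating_if_flow[OF reroute_over(1), where \<tau> = "flow_left_single (real r) h"])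
  have qq: "real q = 1" using assms by simp
  have H: "real r + 3 \<le> h" "2 \<le> real r" using assms(2) h_large qq by auto
  show "(v \<in> e \<longrightarrow> flow_left_single (real r) h v = e) \<and> (v \<in> f \<longrightarrow> flow_left_single (real r) h v \<noteq> f)" if "(e, f) \<in> C\<^sub>0" for e f v
    using that
  proof (cases rule: C\<^sub>0_cases)
    case (1 k)
    then show ?thesis using assms by simp
  next
    case (2 k)
    then have "0 \<le> real k" "real k + 2 \<le> real r" by auto
    from flow_left_single_crossings[OF this H(1)] show ?thesis unfolding 2 twists_shape by blast
  qed
  show "\<exists>a b. e = {a, b} \<and> flow_left_single (real r) h a = e \<and> flow_left_single (real r) h b \<noteq> e"
    if "e \<in> E\<^sub>1" "e \<notin> fst ` C\<^sub>0 \<union> snd ` C\<^sub>0" for e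
    using bspec[OF flow_left_single_arcs[OF H(2,1)], of e] E\<^sub>1_arcs[OF that]
    unfolding last_r twists_shape qq directed_def by (simp only: diff_self diff_add_cancel of_nat_0 add_0)
qed

end

text \<open>
  The flow on the final diagram, which is that of \<open>L(1, q - 2, r - 2)\<close>. If \<open>Q =
  2\<close> or \<open>R = 2\<close>, the ends of the old overpass and underpass coincide on that side; the
  order of the conditions then selects the edge of the overpass.
\<close>

definition flow_both_twisted :: "real \<Rightarrow> real \<Rightarrow> real \<Rightarrow> plane \<Rightarrow> plane set" where
  "flow_both_twisted Q R H = (\<lambda>(x, y).
    if x = 2 then {(2, y), (3, y + 1)}
    else if x = 3 then if y = 0 then {(3, 0), (2, 1)} else if y = 1 then {(3, 1), (13 / 4, 1 / 4)}
      else if y = Q then {(3, Q), (3, H)} else if y = H then {(3, H), (4, H)} else {(2, y - 1), (3, y)}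
    else if x = 13 / 4 then if y = 1 / 4 then {(13 / 4, 1 / 4), (15 / 4, 1 / 2)} else {(3, Q - 1), (13 / 4, 1 / 2)}
    else if x = 15 / 4 then if y = 1 / 2 then {(13 / 4, 1 / 4), (15 / 4, 1 / 2)} else {(15 / 4, 1 / 4), (4, 1)}
    else if x = 4 then if y = 0 then {(3, 0), (4, 0)} else if y = H then {(4, R), (4, H)}
      else if y = R then {(5, R - 1), (4, R)} else if y = R - 1 then {(15 / 4, 1 / 2), (4, R - 1)} else {(4, y), (5, y + 1)}
    else {(4, y - 1), (5, y)})"

lemma flow_both_twisted_crossings_left:
  assumes "1 \<le> K" and "K + 2 \<le> Q" and "Q + R + 2 \<le> H" and "2 \<le> R"
  shows "flow_both_twisted Q R H (2, K) = {(2, K), (3, K + 1)}" "flow_both_twisted Q R H (3, K + 1) = {(2, K), (3, K + 1)}"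
    "flow_both_twisted Q R H (3, K) \<noteq> {(3, K), (2, K + 1)}" "flow_both_twisted Q R H (2, K + 1) \<noteq> {(3, K), (2, K + 1)}"
  using assms by (auto simp: flow_both_twisted_def doubleton_eq_iff)

lemma flow_both_twisted_crossings_right:
  assumes "1 \<le> K" and "K + 2 \<le> R" and "Q + R + 2 \<le> H" and "2 \<le> Q"
  shows "flow_both_twisted Q R H (4, K) = {(4, K), (5, K + 1)}" "flow_both_twisted Q R H (5, K + 1) = {(4, K), (5, K + 1)}"
    "flow_both_twisted Q R H (5, K) \<noteq> {(5, K), (4, K + 1)}" "flow_both_twisted Q R H (4, K + 1) \<noteq> {(5, K), (4, K + 1)}"
  using assms by (auto simp: flow_both_twisted_def doubleton_eq_iff)

lemma flow_both_twisted_crossing_middle: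
  "flow_both_twisted Q R H (13 / 4, 1 / 4) = {(13 / 4, 1 / 4), (15 / 4, 1 / 2)}"
  "flow_both_twisted Q R H (15 / 4, 1 / 2) = {(13 / 4, 1 / 4), (15 / 4, 1 / 2)}"
  "flow_both_twisted Q R H (13 / 4, 1 / 2) \<noteq> {(13 / 4, 1 / 2), (15 / 4, 1 / 4)}"
  "flow_both_twisted Q R H (15 / 4, 1 / 4) \<noteq> {(13 / 4, 1 / 2), (15 / 4, 1 / 4)}"
  by (auto simp: flow_both_twisted_def doubleton_eq_iff)

lemma flow_both_twisted_arcs:
  assumes "2 \<le> Q" and "2 \<le> R" and "Q + R + 2 \<le> H"
  shows "\<forall>e\<in>{{(3, 0), (2, 1)}, {(2, Q - 1), (3, Q)}, {(4, 0), (5, 1)}, {(5, R - 1), (4, R)},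
      {(3, Q), (3, H)}, {(4, R), (4, H)}, {(3, 0), (4, 0)}, {(3, H), (4, H)},
      {(3, 1), (13 / 4, 1 / 4)}, {(15 / 4, 1 / 2), (4, R - 1)},
      {(3, Q - 1), (13 / 4, 1 / 2)}, {(15 / 4, 1 / 4), (4, 1)}}.
    directed (flow_both_twisted Q R H) e"
  unfolding ball_simps directed_iff using assms
  by (intro conjI TrueI; simp add: flow_both_twisted_def doubleton_eq_iff)

text \<open>
  With at least two crossings in both the second and the third column, the underpass can be rerouted as
  well.
\<close>

locale two_twists = single_crossing +
  assumes q2: "q \<ge> 2" and r2: "r \<ge> 2"
begin

text \<open>
  The underpass follows the under strand of the highest crossing of the second column, the join on top,
  the under strand of the first column, the outer bottom arc and the under strand of the lowest crossing
  of the third column.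
\<close>

definition under_old :: "plane list" where
  "under_old = [(3, real q - 1), (2, real q), (2, h), (1, h), (1, 1), (0, 0), (0, - 1), (5, - 1), (5, 0), (4, 1)]"

definition under_new :: "plane list" where
  "under_new = [(3, real q - 1), (13 / 4, 1 / 2), (15 / 4, 1 / 4), (4, 1)]"

definition E\<^sub>2 where "E\<^sub>2 = E\<^sub>1 - path_edges under_old"
definition C\<^sub>2 where "C\<^sub>2 = C\<^sub>0 \<inter> E\<^sub>2 \<times> E\<^sub>2"
definition middle_crossing :: "(plane set \<times> plane set) set" where
  "middle_crossing = {({(13 / 4, 1 / 4), (15 / 4, 1 / 2)}, {(13 / 4, 1 / 2), (15 / 4, 1 / 4)})}"

lemma last_falling: "falling (Suc 0) (q - 1) = {(3, real q - 1), (2, real q)}"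
  using q_pos by (auto simp: twists_shape of_nat_diff)

lemma path_under_old: "path_edges under_old = {falling (Suc 0) (q - 1), {(2, real q), (2, h)}, {(1, h), (2, h)},
    {(1, 1), (1, h)}, rising 0 0, {(0, - 1), (0, 0)}, {(0, - 1), (5, - 1)}, {(5, - 1), (5, 0)}, falling 2 0}"
  unfolding under_old_def last_falling by (simp add: twists_shape insert_commute)

lemma path_under_new: "path_edges under_new = {{(3, real q - 1), (13 / 4, 1 / 2)}, {(13 / 4, 1 / 2), (15 / 4, 1 / 4)},
    {(15 / 4, 1 / 4), (4, 1)}}"
  by (simp add: under_new_def)

lemma h_eq': "h = 2 + real q + real r"
  using h_eq by simp

lemma under_old_subset: "path_edges under_old \<subseteq> E\<^sub>1"
proof -
  have "path_edges under_old \<subseteq> E"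
    using edge_members(1-6) edge_members(7) q_pos r_pos unfolding path_under_old frame_def by simp
  moreover have "path_edges under_old \<inter> path_edges over_old = {}"
    unfolding path_under_old path_over_old using h_eq' q2 by (simp add: doubleton_eq_iff)
  ultimately show ?thesis by (auto simp: E\<^sub>1_def E\<^sub>0_def)
qed

lemma under_old_distinct: "distinct under_old"
  using h_eq' q2 by (simp add: under_old_def)

lemma under_new_distinct: "distinct under_new"
  by (simp add: under_new_def)

lemma under_new_apart_old: "e \<in> path_edges under_new \<Longrightarrow> f \<in> E \<Longrightarrow> convex hull e \<inter> convex hull f \<subseteq> e \<inter> f"
proof -
  assume e: "e \<in> path_edges under_new" and f: "f \<in> E"
  have large: "real q \<ge> 2" "real r \<ge> 2" using q2 r2 by auto
  have "convex hull {(3, real q - 1), (13 / 4, 1 / 2)} \<inter> convex hull f \<subseteq> {(3, real q - 1), (13 / 4, 1 / 2)} \<inter> f"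
    by (rule gap_apart) (use f h_eq' large in auto)
  moreover have "convex hull {(13 / 4, 1 / 2), (15 / 4, 1 / 4)} \<inter> convex hull f \<subseteq> {(13 / 4, 1 / 2), (15 / 4, 1 / 4)} \<inter> f"
    by (rule gap_apart) (use f h_eq' large in auto)
  moreover have "convex hull {(15 / 4, 1 / 4), (4, 1)} \<inter> convex hull f \<subseteq> {(15 / 4, 1 / 4), (4, 1)} \<inter> f"
    by (rule gap_apart) (use f h_eq' large in auto)
  ultimately show ?thesis using e unfolding path_under_new by auto
qed

text \<open>
  To the left of the new crossing the underpass runs above the overpass in the plane, to the right below
  it; so they meet outside the crossing only if they start or end at the same vertex.
\<close>

lemma under_new_apart_over_new:
  assumes "e \<in> path_edges under_new" and "f \<in> path_edges over_new" and "(f, e) \<notin> middle_crossing"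
  shows "convex hull e \<inter> convex hull f \<subseteq> e \<inter> f"
proof -
  have large: "real q \<ge> 2" "real r \<ge> 2" using q2 r2 by auto
  let ?U1 = "{(3, real q - 1), (13 / 4, 1 / 2)} :: plane set" and ?UX = "{(13 / 4, 1 / 2), (15 / 4, 1 / 4)} :: plane set" and ?U3 = "{(15 / 4, 1 / 4), (4, 1)} :: plane set"
  let ?O1 = "{(3, 1), (13 / 4, 1 / 4)} :: plane set" and ?OX = "{(13 / 4, 1 / 4), (15 / 4, 1 / 2)} :: plane set" and ?O3 = "{(15 / 4, 1 / 2), (4, real r - 1)} :: plane set"
  have 1: "convex hull ?U1 \<inter> convex hull ?O1 \<subseteq> ?U1 \<inter> ?O1" by (rule ordered_segments) (use large in auto)
  have 2: "convex hull ?U1 \<inter> convex hull ?OX = {}" by (rule abutting_segments) auto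
  have 3: "convex hull ?U1 \<inter> convex hull ?O3 = {}" by (rule separated_segments) auto
  have 4: "convex hull ?UX \<inter> convex hull ?O1 = {}" unfolding Int_commute[of "convex hull ?UX"] by (rule abutting_segments) auto
  have 5: "convex hull ?UX \<inter> convex hull ?O3 = {}" by (rule abutting_segments) auto
  have 6: "convex hull ?U3 \<inter> convex hull ?O1 = {}" unfolding Int_commute[of "convex hull ?U3"] by (rule separated_segments) auto
  have 7: "convex hull ?U3 \<inter> convex hull ?OX = {}" unfolding Int_commute[of "convex hull ?U3"] by (rule abutting_segments) auto
  have 8: "convex hull ?O3 \<inter> convex hull ?U3 \<subseteq> ?O3 \<inter> ?U3" by (rule ordered_segments) (use large in auto)
  have 8: "convex hull ?U3 \<inter> convex hull ?O3 \<subseteq> ?U3 \<inter> ?O3" using 8 by (simp only: Int_commute)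
  from assms(1,2) consider "e = ?U1" "f = ?O1" | "e = ?U1" "f = ?OX" | "e = ?U1" "f = ?O3"
    | "e = ?UX" "f = ?O1" | "e = ?UX" "f = ?OX" | "e = ?UX" "f = ?O3"
    | "e = ?U3" "f = ?O1" | "e = ?U3" "f = ?OX" | "e = ?U3" "f = ?O3"
    unfolding path_under_new path_over_new insert_iff empty_iff by argo
  then show ?thesis
  proof cases
    case 5
    then show ?thesis using assms(3) by (simp add: middle_crossing_def)
  qed (use 1 2 3 4 5 6 7 8 in simp_all)
qed

lemma under_new_self:
  assumes "e \<in> path_edges under_new" and "f \<in> path_edges under_new" and "e \<noteq> f"
  shows "convex hull e \<inter> convex hull f \<subseteq> e \<inter> f"
proof -
  note 1 = touching_segments[of 3 "13 / 4" "15 / 4" "real q - 1" "1 / 2" "1 / 4"]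
    and 2 = touching_segments[of "13 / 4" "15 / 4" 4 "1 / 2" "1 / 4" 1]
    and 3 = separated_segments[of 3 "13 / 4" "15 / 4" 4 "real q - 1" "1 / 2" "1 / 4" 1]
  show ?thesis
    using assms unfolding under_new_def path_edges.simps insert_iff empty_iff
    by (elim disjE) (use 1 2 3 in \<open>simp_all add: Int_commute\<close>)
qed

lemma crosses_middle: "crosses {(13 / 4, 1 / 4), (15 / 4, 1 / 2)} {(13 / 4, 1 / 2), (15 / 4, 1 / 4)}"
proof -
  let ?O = "{(13 / 4, 1 / 4), (15 / 4, 1 / 2)} :: plane set" and ?U = "{(13 / 4, 1 / 2), (15 / 4, 1 / 4)} :: plane set"
  have "(X, Y) = (7 / 2, 3 / 8)" if XY: "(X, Y) \<in> convex hull ?O" "(X, Y) \<in> convex hull ?U" for X Y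
  proof -
    obtain t s where "X = 13 / 4 + t * (15 / 4 - 13 / 4)" "Y = 1 / 4 + t * (1 / 2 - 1 / 4)"
      "X = 13 / 4 + s * (15 / 4 - 13 / 4)" "Y = 1 / 2 + s * (1 / 4 - 1 / 2)"
      using XY unfolding in_segment_iff by blast
    then show ?thesis by simp
  qed
  moreover have "(7 / 2, 3 / 8) \<in> convex hull ?O" "(7 / 2, 3 / 8) \<in> convex hull ?U"
    unfolding in_segment_iff by (intro exI[of _ "1 / 2"]; simp)+
  ultimately have "convex hull ?O \<inter> convex hull ?U = {(7 / 2, 3 / 8)}" by auto
  then show ?thesis unfolding crosses_def by (auto simp: doubleton_eq_iff)
qed

lemma under_strand: "(e, f) \<in> C\<^sub>0 \<Longrightarrow> e \<notin> path_edges under_old"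
  by (erule C\<^sub>0_cases) (simp_all add: path_under_old)

lemma reroute_under: "plane_curve (E\<^sub>2 \<union> path_edges under_new) (C\<^sub>2 \<union> middle_crossing) \<and> E\<^sub>2 \<inter> path_edges under_new = {}"
proof (rule plane_curve_reroute[OF reroute_over(1) under_old_distinct _ under_old_subset under_new_distinct])
  show "E\<^sub>2 = E\<^sub>1 - path_edges under_old" by (rule E\<^sub>2_def)
  show "C\<^sub>2 = C\<^sub>0 \<inter> E\<^sub>2 \<times> E\<^sub>2" by (rule C\<^sub>2_def)
  have sub: "E\<^sub>2 \<subseteq> E \<union> path_edges over_new" by (auto simp: E\<^sub>2_def E\<^sub>1_def E\<^sub>0_def)
  show "set (butlast (tl under_new)) \<inter> \<Union>E\<^sub>2 = {}"
  proof -
    have *: "(13 / 4, 1 / 2) \<notin> \<Union>(E \<union> path_edges over_new)" "(15 / 4, 1 / 4) \<notin> \<Union>(E \<union> path_edges over_new)"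
      using not_vertex[OF not_nat(1), of "1 / 2"] not_vertex[OF not_nat(2), of "1 / 4"]
      unfolding Union_Un_distrib Un_iff by (simp_all only: simp_thms) (simp_all add: path_over_new)
    have "(13 / 4, 1 / 2) \<notin> \<Union>E\<^sub>2" "(15 / 4, 1 / 4) \<notin> \<Union>E\<^sub>2"
      using contra_subsetD[OF Union_mono[OF sub] *(1)] contra_subsetD[OF Union_mono[OF sub] *(2)] .
    then show ?thesis by (simp add: under_new_def)
  qed
  show "convex hull e \<inter> convex hull f \<subseteq> e \<inter> f"
    if "e \<in> path_edges under_new" "f \<in> path_edges under_new" "e \<noteq> f" for e f
    using under_new_self[OF that] .
  show "convex hull e \<inter> convex hull f \<subseteq> e \<inter> f"
    if "e \<in> path_edges under_new" "f \<in> E\<^sub>2" "(f, e) \<notin> middle_crossing" for e f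
  proof -
    from sub that(2) have "f \<in> E \<or> f \<in> path_edges over_new" by blast
    then show ?thesis
      using under_new_apart_old[OF that(1)] under_new_apart_over_new[OF that(1) _ that(3)] by (elim disjE)
  qed
  show "e \<in> E\<^sub>2 \<union> path_edges under_new \<and> f \<in> E\<^sub>2 \<union> path_edges under_new \<and> crosses e f" if "(e, f) \<in> middle_crossing" for e f
  proof -
    have ef: "e = {(13 / 4, 1 / 4), (15 / 4, 1 / 2)}" "f = {(13 / 4, 1 / 2), (15 / 4, 1 / 4)}"
      using that by (auto simp: middle_crossing_def)
    have "e \<notin> path_edges under_old"
      unfolding ef path_under_old by (auto simp: twists_shape doubleton_eq_iff)
    then have "e \<in> E\<^sub>2" unfolding E\<^sub>2_def E\<^sub>1_def path_over_new ef by simp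
    then show ?thesis using crosses_middle unfolding ef path_under_new by simp
  qed
  show "matching (C\<^sub>2 \<union> middle_crossing)"
  proof (rule matching_Un)
    show "matching C\<^sub>2"
      by (rule matching_subset[OF plane_curveD(5)[OF reroute_over(1)]]) (auto simp: C\<^sub>2_def)
    show "matching middle_crossing" unfolding middle_crossing_def by (rule matching_singleton)
    show "{e, f} \<inter> {e', f'} = {}" if "(e, f) \<in> C\<^sub>2" "(e', f') \<in> middle_crossing" for e f e' f'
    proof -
      have "e \<in> E" "f \<in> E" using that(1) by (auto simp: C\<^sub>2_def C\<^sub>0_def E\<^sub>0_def)
      moreover have "e' \<notin> E" "f' \<notin> E"
        using that(2) not_vertex[OF not_nat(1), of "1 / 4"] not_vertex[OF not_nat(1), of "1 / 2"]
        by (auto simp: middle_crossing_def)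
      ultimately show ?thesis by blast
    qed
  qed
qed (simp_all add: under_old_def under_new_def)

lemma isotopic_under: "ambient_isotopic S3 (link_of (diagram_of E\<^sub>1 C\<^sub>0))
    (link_of (diagram_of (E\<^sub>2 \<union> path_edges under_new) (C\<^sub>2 \<union> middle_crossing)))"
proof (rule ambient_isotopic_reroute[where vs = under_old and u = False,
      OF reroute_over(1) _ under_old_distinct _ under_old_subset under_new_distinct])
  show "plane_curve (E\<^sub>2 \<union> path_edges under_new) (C\<^sub>2 \<union> middle_crossing)" "E\<^sub>2 \<inter> path_edges under_new = {}"
    using reroute_under by simp_all
  show "(if False then f else e) \<notin> path_edges under_old" if "(e, f) \<in> C\<^sub>0" for e f
    using under_strand[OF that] by simp
  show "(if False then f else e) \<notin> path_edges under_new" if "(e, f) \<in> middle_crossing" for e f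
    using that by (simp add: middle_crossing_def path_under_new doubleton_eq_iff)
  show "e \<in> path_edges under_new \<or> f \<in> path_edges under_new" if "(e, f) \<in> middle_crossing" for e f
    using that by (simp add: middle_crossing_def path_under_new)
  show "E\<^sub>2 = E\<^sub>1 - path_edges under_old" by (rule E\<^sub>2_def)
  show "C\<^sub>2 = C\<^sub>0 \<inter> E\<^sub>2 \<times> E\<^sub>2" by (rule C\<^sub>2_def)
qed (simp_all add: under_old_def under_new_def)

lemma C\<^sub>2_cases:
  assumes "(e, f) \<in> C\<^sub>2"
  obtains k where "1 \<le> k" "Suc k < q" "e = rising (Suc 0) k" "f = falling (Suc 0) k"
  | k where "1 \<le> k" "Suc k < r" "e = rising 2 k" "f = falling 2 k"
proof -
  have ef: "(e, f) \<in> C\<^sub>0" "f \<notin> path_edges under_old" using assms by (auto simp: C\<^sub>2_def E\<^sub>2_def)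
  from ef(1) show ?thesis
  proof (cases rule: C\<^sub>0_cases)
    case (1 k)
    then have "k \<noteq> q - 1" using ef(2) by (auto simp: path_under_old)
    then show ?thesis using 1 that(1)[of k] by simp
  next
    case (2 k)
    then have "k \<noteq> 0" using ef(2) by (auto simp: path_under_old)
    then show ?thesis using 2 that(2)[of k] by simp
  qed
qed

lemma C\<^sub>2_I:
  assumes "(e, f) \<in> C\<^sub>0" and "f \<notin> path_edges under_old"
  shows "(e, f) \<in> C\<^sub>2"
  using assms under_strand[OF assms(1)] by (auto simp: C\<^sub>2_def C\<^sub>0_def E\<^sub>2_def E\<^sub>1_def)

lemma E\<^sub>2_arcs:
  assumes e: "e \<in> E\<^sub>2 \<union> path_edges under_new" and nc: "e \<notin> fst ` (C\<^sub>2 \<union> middle_crossing) \<union> snd ` (C\<^sub>2 \<union> middle_crossing)"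
  shows "e \<in> {falling (Suc 0) 0, rising (Suc 0) (q - 1), rising 2 0, falling 2 (r - 1),
      {(3, real q), (3, h)}, {(4, real r), (4, h)}, {(3, 0), (4, 0)}, {(3, h), (4, h)},
      {(3, 1), (13 / 4, 1 / 4)}, {(15 / 4, 1 / 2), (4, real r - 1)},
      {(3, real q - 1), (13 / 4, 1 / 2)}, {(15 / 4, 1 / 4), (4, 1)}}"
proof -
  have nN: "e \<noteq> {(13 / 4, 1 / 4), (15 / 4, 1 / 2)}" "e \<noteq> {(13 / 4, 1 / 2), (15 / 4, 1 / 4)}"
    using nc by (auto simp: middle_crossing_def)
  have nC: "e \<noteq> a \<and> e \<noteq> b" if "(a, b) \<in> C\<^sub>2" for a b
    using nc image_eqI[of a fst "(a, b)"] image_eqI[of b snd "(a, b)"] that by auto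
  from e consider "e \<in> path_edges under_new" | "e \<in> E\<^sub>1" "e \<notin> path_edges under_old"
    by (auto simp: E\<^sub>2_def)
  then show ?thesis
  proof cases
    case 1
    then show ?thesis using nN(2) unfolding path_under_new insert_iff empty_iff by argo
  next
    case 2
    show ?thesis
    proof (cases "e \<in> fst ` C\<^sub>0 \<union> snd ` C\<^sub>0")
      case False
      have "e \<notin> {{(2, real q), (2, h)}, {(1, h), (2, h)}, {(1, 1), (1, h)}, rising 0 0, {(0, - 1), (0, 0)},
          {(0, - 1), (5, - 1)}, {(5, - 1), (5, 0)}}"
        using 2(2) by (simp add: path_under_old)
      with E\<^sub>1_arcs[OF 2(1) False] nN(1) show ?thesis
        unfolding insert_iff empty_iff by argo
    next
      case True
      then obtain a b where ab: "(a, b) \<in> C\<^sub>0" "e = a \<or> e = b" by force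
      then have "b \<in> path_edges under_old" using C\<^sub>2_I[OF ab(1)] nC by blast
      then have "e = a" using ab(2) 2(2) by blast
      from ab(1) show ?thesis
      proof (cases rule: C\<^sub>0_cases)
        case (1 k)
        then have "k = q - 1" using \<open>b \<in> path_edges under_old\<close> by (simp add: path_under_old)
        then show ?thesis using 1 \<open>e = a\<close> by simp
      next
        case (2 k)
        then have "k = 0" using \<open>b \<in> path_edges under_old\<close> by (simp add: path_under_old)
        then show ?thesis using 2 \<open>e = a\<close> by simp
      qed
    qed
  qed
qed

lemma alternating_under: "alternating_diagram (diagram_of (E\<^sub>2 \<union> path_edges under_new) (C\<^sub>2 \<union> middle_crossing))"
proof (rule alternating_if_flow[where \<tau> = "flow_both_twisted (real q) (real r) h"])
  show "plane_curve (E\<^sub>2 \<union> path_edges under_new) (C\<^sub>2 \<union> middle_crossing)" using reroute_under ..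
  have H: "2 \<le> real q" "2 \<le> real r" "real q + real r + 2 \<le> h" using q2 r2 h_eq' by auto
  show "(v \<in> e \<longrightarrow> flow_both_twisted (real q) (real r) h v = e) \<and> (v \<in> f \<longrightarrow> flow_both_twisted (real q) (real r) h v \<noteq> f)"
    if "(e, f) \<in> C\<^sub>2 \<union> middle_crossing" for e f v
  proof -
    from that consider "(e, f) \<in> C\<^sub>2" | "e = {(13 / 4, 1 / 4), (15 / 4, 1 / 2)}" "f = {(13 / 4, 1 / 2), (15 / 4, 1 / 4)}"
      by (auto simp: middle_crossing_def)
    then show ?thesis
    proof cases
      case 1
      then show ?thesis
      proof (cases rule: C\<^sub>2_cases)
        case (1 k)
        then have "1 \<le> real k" "real k + 2 \<le> real q" by auto
        from flow_both_twisted_crossings_left[OF this H(3,2)] show ?thesis unfolding 1 twists_shape by blast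
      next
        case (2 k)
        then have "1 \<le> real k" "real k + 2 \<le> real r" by auto
        from flow_both_twisted_crossings_right[OF this H(3,1)] show ?thesis unfolding 2 twists_shape by blast
      qed
    next
      case 2
      show ?thesis unfolding 2 using flow_both_twisted_crossing_middle by blast
    qed
  qed
  have last: "real (q - 1) = real q - 1" using q_pos by (simp add: of_nat_diff)
  show "\<exists>a b. e = {a, b} \<and> flow_both_twisted (real q) (real r) h a = e \<and> flow_both_twisted (real q) (real r) h b \<noteq> e"
    if "e \<in> E\<^sub>2 \<union> path_edges under_new" "e \<notin> fst ` (C\<^sub>2 \<union> middle_crossing) \<union> snd ` (C\<^sub>2 \<union> middle_crossing)" for e
    using bspec[OF flow_both_twisted_arcs[OF H], of e] E\<^sub>2_arcs[OF that]
    unfolding last last_r twists_shape directed_def by (simp only: diff_self diff_add_cancel of_nat_0 add_0)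
qed

end

text \<open>
  Only the case of two or more crossings in both of the other columns requires the second replacement.
\<close>

theorem single_crossing_alternating:
  assumes "q \<ge> 1" and "r \<ge> 1"
  shows "alternating_link (pretzel_link [- 1, int q, int r])"
proof -
  interpret single_crossing q r by unfold_locales (use assms in auto)
  consider "r = 1" | "q = 1" "r \<ge> 2" | "q \<ge> 2" "r \<ge> 2" using assms by linarith
  then show ?thesis
  proof cases
    case 1
    then show ?thesis
      using isotopic_over plane_curve_link_diagram[OF reroute_over(1)] alternating_right_single
      unfolding alternating_link_def has_diagram_def by blast
  next
    case 2
    then show ?thesis
      using isotopic_over plane_curve_link_diagram[OF reroute_over(1)] alternating_left_single
      unfolding alternating_link_def has_diagram_def by blast
  next
    case 3
    then interpret two_twists q r by unfold_locales
    show ?thesis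
      using ambient_isotopic_trans[OF isotopic_over isotopic_under]
        plane_curve_link_diagram[OF conjunct1[OF reroute_under]] alternating_under
      unfolding alternating_link_def has_diagram_def by blast
  qed
qed

section \<open>The first column is negative\<close>

text \<open>
  The flow on the diagram with the crossing changed. If \<open>P = 1\<close>, the new overpass starts at
  the vertex \<open>(1, 0)\<close> of the bottom join instead of crossing it, and the flow arrives there
  through the join.
\<close>

definition flow_neg :: "real \<Rightarrow> real \<Rightarrow> real \<Rightarrow> real \<Rightarrow> plane \<Rightarrow> plane set" where
  "flow_neg P Q R H = (\<lambda>(x, y).
    if x = 0 then if y = 0 then {(0, - 1), (0, 0)} else if y = - 1 then {(0, - 1), (5, - 1)}
      else if y = H + 1 then {(0, H + 1), (5, H + 1)} else {(1, y - 1), (0, y)}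
    else if x = 1 then if y = H then {(1, P), (1, H)} else if y = P then {(0, P - 1), (1, P)}
      else if y = P - 1 then if P = 1 then {(1, 0), (2, 0)} else {(1, P - 1), (3 / 2, - 1 / 2)}
      else {(1, y), (0, y + 1)}
    else if x = 2 then if y = H then {(1, H), (2, H)} else if y = Q then {(2, Q), (2, H)} else {(2, y), (3, y + 1)}
    else if x = 3 then if y = H then {(3, Q), (3, H)} else if y = 0 then {(3, 0), (4, 0)} else {(2, y - 1), (3, y)}
    else if x = 4 then if y = H then {(3, H), (4, H)} else if y = R then {(4, R), (4, H)} else {(4, y), (5, y + 1)}
    else if x = 5 then if y = H then {(5, R), (5, H)} else if y = H + 1 then {(5, H), (5, H + 1)}
      else if y = 0 then {(5, - 1), (5, 0)} else if y = - 1 then {(0, - 1), (5, - 1)} else {(4, y - 1), (5, y)}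
    else if x = - 1 then {(- 1, - 2), (0, H + 1)}
    else {(1, P - 1), (3 / 2, - 1 / 2)})"

lemma flow_neg_crossings_0:
  assumes "0 \<le> K" and "K + 2 \<le> P" and "P + 2 \<le> H"
  shows "flow_neg P Q R H (1, K) = {(1, K), (0, K + 1)}" "flow_neg P Q R H (0, K + 1) = {(1, K), (0, K + 1)}"
    "flow_neg P Q R H (0, K) \<noteq> {(0, K), (1, K + 1)}" "flow_neg P Q R H (1, K + 1) \<noteq> {(0, K), (1, K + 1)}"
  using assms by (auto simp: flow_neg_def doubleton_eq_iff)

lemma flow_neg_crossings_1:
  assumes "0 \<le> K" and "K + 1 \<le> Q" and "Q + 2 \<le> H"
  shows "flow_neg P Q R H (2, K) = {(2, K), (3, K + 1)}" "flow_neg P Q R H (3, K + 1) = {(2, K), (3, K + 1)}"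
    "flow_neg P Q R H (3, K) \<noteq> {(3, K), (2, K + 1)}" "flow_neg P Q R H (2, K + 1) \<noteq> {(3, K), (2, K + 1)}"
  using assms by (auto simp: flow_neg_def doubleton_eq_iff)

lemma flow_neg_crossings_2:
  assumes "0 \<le> K" and "K + 1 \<le> R" and "R + 2 \<le> H"
  shows "flow_neg P Q R H (4, K) = {(4, K), (5, K + 1)}" "flow_neg P Q R H (5, K + 1) = {(4, K), (5, K + 1)}"
    "flow_neg P Q R H (5, K) \<noteq> {(5, K), (4, K + 1)}" "flow_neg P Q R H (4, K + 1) \<noteq> {(5, K), (4, K + 1)}"
  using assms by (auto simp: flow_neg_def doubleton_eq_iff)

lemma flow_neg_crossing_bar:
  assumes "1 \<le> P" and "1 \<le> H"
  shows "flow_neg P Q R H (0, - 1) = {(0, - 1), (5, - 1)}" "flow_neg P Q R H (5, - 1) = {(0, - 1), (5, - 1)}"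
    "flow_neg P Q R H (3 / 2, - 1 / 2) \<noteq> {(3 / 2, - 1 / 2), (- 1, - 2)}" "flow_neg P Q R H (- 1, - 2) \<noteq> {(3 / 2, - 1 / 2), (- 1, - 2)}"
  using assms by (auto simp: flow_neg_def doubleton_eq_iff)

lemma flow_neg_crossing_join:
  assumes "2 \<le> P" and "1 \<le> Q" and "P + 1 \<le> H"
  shows "flow_neg P Q R H (1, P - 1) = {(1, P - 1), (3 / 2, - 1 / 2)}" "flow_neg P Q R H (3 / 2, - 1 / 2) = {(1, P - 1), (3 / 2, - 1 / 2)}"
    "flow_neg P Q R H (1, 0) \<noteq> {(1, 0), (2, 0)}" "flow_neg P Q R H (2, 0) \<noteq> {(1, 0), (2, 0)}"
  using assms by (auto simp: flow_neg_def doubleton_eq_iff)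

lemma flow_neg_arcs:
  assumes "1 \<le> P" and "1 \<le> Q" and "1 \<le> R" and "P + 2 \<le> H" and "Q + 2 \<le> H" and "R + 2 \<le> H"
  shows "\<forall>e\<in>{{(0, P - 1), (1, P)}, {(1, P), (1, H)}, {(2, Q), (2, H)}, {(3, Q), (3, H)}, {(4, R), (4, H)}, {(5, R), (5, H)},
      {(3, 0), (4, 0)}, {(1, H), (2, H)}, {(3, H), (4, H)}, {(5, H), (5, H + 1)}, {(0, H + 1), (5, H + 1)},
      {(0, - 1), (0, 0)}, {(5, - 1), (5, 0)}, {(- 1, - 2), (0, H + 1)}}.
    directed (flow_neg P Q R H) e"
  unfolding ball_simps directed_iff using assms
  by (intro conjI TrueI; simp add: flow_neg_def doubleton_eq_iff)

lemma flow_neg_arcs_1: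
  assumes "1 \<le> Q" and "3 \<le> H"
  shows "\<forall>e\<in>{{(1, 0), (2, 0)}, {(1, 0), (3 / 2, - 1 / 2)}}. directed (flow_neg 1 Q R H) e"
  unfolding ball_simps directed_iff using assms
  by (intro conjI TrueI; simp add: flow_neg_def doubleton_eq_iff)

lemma Int_eq_singletonI:
  assumes "\<And>x y. (x, y) \<in> A \<Longrightarrow> (x, y) \<in> B \<Longrightarrow> (x, y) = c" and "c \<in> A" and "c \<in> B"
  shows "A \<inter> B = {c}"
proof (rule set_eqI)
  show "v \<in> A \<inter> B \<longleftrightarrow> v \<in> {c}" for v using assms by (cases v) blast
qed

lemma Int_subset_IntI:
  assumes "\<And>x y. (x, y) \<in> B \<Longrightarrow> (x, y) \<in> A \<Longrightarrow> (x, y) \<in> A' \<and> (x, y) \<in> B'"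
  shows "A \<inter> B \<subseteq> A' \<inter> B'"
proof
  show "v \<in> A' \<inter> B'" if "v \<in> A \<inter> B" for v using assms that by (cases v) blast
qed

context columns
begin

text \<open>
  The overpass follows the over strand of the highest crossing of the first column up to the left corner
  of the outer top arc.
\<close>

definition neg_old :: "plane list" where
  "neg_old = [(1, real p - 1), (0, real p), (0, h), (0, h + 1)]"

text \<open>
  The first edge descends between the first two columns and crosses their bottom join, the second one
  crosses the outer bottom arc to the lower left of the diagram, and the third one returns to the corner.
\<close>

definition neg_new :: "plane list" where
  "neg_new = [(1, real p - 1), (3 / 2, - 1 / 2), (- 1, - 2), (0, h + 1)]"

definition E\<^sub>3 where "E\<^sub>3 = E - path_edges neg_old"
definition C\<^sub>3 where "C\<^sub>3 = C \<inter> E\<^sub>3 \<times> E\<^sub>3"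

definition neg_new_crossings :: "(plane set \<times> plane set) set" where
  "neg_new_crossings = insert ({(3 / 2, - 1 / 2), (- 1, - 2)}, {(0, - 1), (5, - 1)})
     (if p \<ge> 2 then {({(1, real p - 1), (3 / 2, - 1 / 2)}, {(1, 0), (2, 0)})} else {})"

lemma last_neg: "falling 0 (p - 1) = {(1, real p - 1), (0, real p)}" "rising 0 (p - 1) = {(0, real p - 1), (1, real p)}"
  using pos by (auto simp: twists_shape of_nat_diff)

lemma path_neg_old: "path_edges neg_old = {falling 0 (p - 1), {(0, real p), (0, h)}, {(0, h), (0, h + 1)}}"
  unfolding neg_old_def last_neg by simp

lemma path_neg_new: "path_edges neg_new = {{(1, real p - 1), (3 / 2, - 1 / 2)}, {(3 / 2, - 1 / 2), (- 1, - 2)}, {(- 1, - 2), (0, h + 1)}}"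
  unfolding neg_new_def by simp

lemma h_bounds: "real p + 2 \<le> h" "real q + 2 \<le> h" "real r + 2 \<le> h" "3 \<le> h" "1 \<le> real p" "1 \<le> real q" "1 \<le> real r"
  using h_eq pos by auto

lemma neg_old_subset: "path_edges neg_old \<subseteq> E"
  using edge_members(2)[of "p - 1"] edge_members(7) pos unfolding path_neg_old frame_def by simp

lemma neg_distinct: "distinct neg_old" "distinct neg_new"
  using h_bounds by (auto simp: neg_old_def neg_new_def)

lemma descent_apart:
  assumes f: "f \<in> E" "2 \<le> p \<Longrightarrow> f \<noteq> {(1, 0), (2, 0)}"
  shows "convex hull {(1, real p - 1), (3 / 2, - 1 / 2)} \<inter> convex hull f \<subseteq> {(1, real p - 1), (3 / 2, - 1 / 2)} \<inter> f"
proof -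
  have "(X, Y) \<in> {(1, real p - 1), (3 / 2, - 1 / 2)} \<and> (X, Y) \<in> f"
    if vf: "(X, Y) \<in> convex hull f" and ve: "(X, Y) \<in> convex hull {(1, real p - 1), (3 / 2, - 1 / 2)}" for X Y
  proof -
    have x: "1 < (3 / 2 :: real)" by simp
    obtain t where t: "0 \<le> t" "t \<le> 1" "X = 1 + t * (3 / 2 - 1)" "Y = (1 - t) * (real p - 1) + t * (- 1 / 2)"
      "1 \<le> X" "X \<le> 3 / 2" "min (real p - 1) (- 1 / 2) \<le> Y" "Y \<le> max (real p - 1) (- 1 / 2)" "X = 1 \<longrightarrow> t = 0" "X = 3 / 2 \<longrightarrow> t = 1"
      using segment_bounds[OF ve x] .
    have Y: "- 1 / 2 \<le> Y" "Y \<le> real p - 1" using t(7,8) h_bounds(5) by auto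
    have left: "(X, Y) = (1, real p - 1)" if "X = 1" using that t(4,9) by simp
    from f(1) show ?thesis
    proof (cases rule: edge_cases)
      case (strand i k)
      note * = in_strand[OF strand vf]
      have "i = 0" using *(1) t(6) by (cases i) auto
      then have "X = 1" using *(2) t(5) by simp
      then show ?thesis using left *(5) \<open>i = 0\<close> by simp
    next
      case (vertical i x)
      then have z: "X = x" "real (twists i) \<le> Y" using vf twists_less[of i] by (auto simp: in_vertical)
      have "i = 0" using vertical(2) z(1) t(6) by (cases i) auto
      then show ?thesis using z(2) Y(2) by simp
    next
      case (join i y)
      then have z: "Y = y" "2 * real i + 1 \<le> X" using vf by (auto simp: in_horizontal)
      have i: "i = 0" using z(2) t(6) by (cases i) auto
      have "y = 0" using join(2) z(1) Y(2) h_bounds(1) by auto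
      then have fJ: "f = {(1, 0), (2, 0)}" using join(3) i by simp
      then have "p = 1" using f(2) pos by auto
      then have "t = 0" using t(4) z(1) \<open>y = 0\<close> by simp
      then have "X = 1" using t(3) by simp
      then show ?thesis using left \<open>p = 1\<close> fJ by simp
    next
      case (post x y)
      then have "X = x" using vf by (auto simp: in_vertical)
      then show ?thesis using post(1) t(5,6) m_eq by auto
    next
      case (bar y)
      then have "Y = y" using vf by (auto simp: in_horizontal m_eq)
      then show ?thesis using bar(1) Y h_bounds(1) by auto
    qed
  qed
  then show ?thesis by (rule Int_subset_IntI)
qed

lemma underneath_apart:
  assumes f: "f \<in> E" "f \<noteq> {(0, - 1), (5, - 1)}"
  shows "convex hull {(- 1, - 2), (3 / 2, - 1 / 2)} \<inter> convex hull f = {}"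
proof -
  have False
    if vf: "(X, Y) \<in> convex hull f" and ve: "(X, Y) \<in> convex hull {(- 1, - 2), (3 / 2, - 1 / 2 :: real)}" for X Y
  proof -
    obtain t where t: "0 \<le> t" "t \<le> 1" "X = - 1 + t * (3 / 2 - - 1)" "Y = - 2 + t * (- 1 / 2 - - 2)"
      using ve unfolding in_segment_iff by blast
    have Y: "Y < 0" using t by simp
    from f(1) show ?thesis
    proof (cases rule: edge_cases)
      case (strand i k)
      then show ?thesis using in_strand(3)[OF strand vf] Y by simp
    next
      case (vertical i x)
      then have "real (twists i) \<le> Y" using vf twists_less[of i] by (auto simp: in_vertical)
      then show ?thesis using Y by simp
    next
      case (join i y)
      then have "Y = y" using vf by (auto simp: in_horizontal)
      then show ?thesis using join(2) Y h_bounds(4) by auto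
    next
      case (post x y)
      then have z: "X = x" "y \<le> Y" using vf by (auto simp: in_vertical)
      have "y = - 1" using post(2) z(2) Y h_bounds(4) by auto
      then show ?thesis using post(1) z t m_eq by auto
    next
      case (bar y)
      then have "Y = y" using vf by (auto simp: in_horizontal m_eq)
      then show ?thesis using bar f(2) Y h_bounds(4) m_eq by auto
    qed
  qed
  then show ?thesis by auto
qed

lemma ascent_apart:
  assumes f: "f \<in> E"
  shows "convex hull {(- 1, - 2), (0, h + 1)} \<inter> convex hull f \<subseteq> {(- 1, - 2), (0, h + 1)} \<inter> f"
proof -
  have "(X, Y) \<in> {(- 1, - 2), (0, h + 1)} \<and> (X, Y) \<in> f"
    if vf: "(X, Y) \<in> convex hull f" and ve: "(X, Y) \<in> convex hull {(- 1, - 2), (0, h + 1)}" for X Y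
  proof -
    obtain t where t: "0 \<le> t" "t \<le> 1" "X = - 1 + t * (0 - - 1)" "Y = - 2 + t * (h + 1 - - 2)"
      using ve unfolding in_segment_iff by blast
    have right: "X = 0 \<and> Y = h + 1" if "0 \<le> X" using that t by simp
    from f show ?thesis
    proof (cases rule: edge_cases)
      case (strand i k)
      note * = in_strand[OF strand vf]
      have "Y = h + 1" using right *(1) by simp
      then show ?thesis using *(4,7) twists_less[OF *(6)] by simp
    next
      case (vertical i x)
      then have "X = x" "Y \<le> h" using vf twists_less[of i] by (auto simp: in_vertical)
      then show ?thesis using right vertical(2) by auto
    next
      case (join i y)
      then have "1 \<le> X" using vf by (auto simp: in_horizontal)
      then show ?thesis using right by simp
    next
      case (post x y)
      then have z: "X = x" "Y \<le> y + 1" using vf by (auto simp: in_vertical)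
      then have "X = 0" "Y = h + 1" using right post(1) m_eq by auto
      then show ?thesis using z post h_bounds(4) by auto
    next
      case (bar y)
      then have "Y = y" "0 \<le> X" using vf by (auto simp: in_horizontal m_eq)
      then show ?thesis using right bar(2) by auto
    qed
  qed
  then show ?thesis by (rule Int_subset_IntI)
qed

lemma neg_new_self:
  assumes "e \<in> path_edges neg_new" and "f \<in> path_edges neg_new" and "e \<noteq> f"
  shows "convex hull e \<inter> convex hull f \<subseteq> e \<inter> f"
proof -
  let ?A = "{(1, real p - 1), (3 / 2, - 1 / 2)} :: plane set" and ?B = "{(3 / 2, - 1 / 2), (- 1, - 2)} :: plane set"
    and ?D = "{(- 1, - 2), (0, h + 1)} :: plane set"
  have AB: "(X, Y) = (3 / 2, - 1 / 2)" if v: "(X, Y) \<in> convex hull ?A" "(X, Y) \<in> convex hull ?B" for X Y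
  proof -
    obtain t s where t: "0 \<le> t" "t \<le> 1" "X = 1 + t * (3 / 2 - 1)" "Y = real p - 1 + t * (- 1 / 2 - (real p - 1))"
      and s: "0 \<le> s" "Y = - 1 / 2 + s * (- 2 - - 1 / 2)"
      using v unfolding in_segment_iff by blast
    have "(1 - t) * (real p - 1 / 2) = - 3 / 2 * s" using t(4) s(2) by (simp add: field_simps)
    moreover have "0 \<le> (1 - t) * (real p - 1 / 2)" using t(2) h_bounds(5) by simp
    ultimately have "(1 - t) * (real p - 1 / 2) = 0" "s = 0" using s(1) by auto
    then have "t = 1" using h_bounds(5) by simp
    then show ?thesis using t by simp
  qed
  have BD: "(X, Y) = (- 1, - 2)" if v: "(X, Y) \<in> convex hull ?B" "(X, Y) \<in> convex hull ?D" for X Y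
  proof -
    obtain t s where t: "t \<le> 1" "X = 3 / 2 + t * (- 1 - 3 / 2)" "Y = - 1 / 2 + t * (- 2 - - 1 / 2)"
      and s: "X = - 1 + s * (0 - - 1)" "Y = - 2 + s * (h + 1 - - 2)"
      using v unfolding in_segment_iff by blast
    have s': "s = 5 / 2 * (1 - t)" using t(2) s(1) by (simp add: algebra_simps)
    have "3 / 2 * (1 - t) = s * (h + 3)" using t(3) s(2) by (simp add: algebra_simps)
    then have "6 - 6 * t = (5 - 5 * t) * (h + 3) * 2" unfolding s' by simp
    then have "(1 - t) * 3 = (1 - t) * (5 * (h + 3))" by (simp add: algebra_simps)
    moreover have "3 \<noteq> 5 * (h + 3)" using h_bounds(4) by simp
    ultimately have "t = 1" unfolding mult_cancel_left by linarith
    then show ?thesis using t by simp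
  qed
  have AD: False if v: "(X, Y) \<in> convex hull ?A" "(X, Y) \<in> convex hull ?D" for X Y
  proof -
    obtain t s where "0 \<le> t" "X = 1 + t * (3 / 2 - 1)" "s \<le> 1" "X = - 1 + s * (0 - - 1)"
      using v unfolding in_segment_iff by blast
    then show False by simp
  qed
  have 1: "convex hull ?A \<inter> convex hull ?B \<subseteq> ?A \<inter> ?B" using AB by auto
  have 2: "convex hull ?B \<inter> convex hull ?D \<subseteq> ?B \<inter> ?D" using BD by auto
  have 3: "convex hull ?A \<inter> convex hull ?D \<subseteq> ?A \<inter> ?D" using AD by auto
  from assms(1,2) consider "e = f" | "e = ?A" "f = ?B" | "e = ?B" "f = ?A" | "e = ?B" "f = ?D" | "e = ?D" "f = ?B"
    | "e = ?A" "f = ?D" | "e = ?D" "f = ?A"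
    unfolding path_neg_new insert_iff empty_iff by argo
  then show ?thesis
    using 1 2 3 assms(3) by cases (simp_all only: Int_commute simp_thms)
qed

lemma crosses_bar: "crosses {(3 / 2, - 1 / 2), (- 1, - 2)} {(0, - 1), (5, - 1)}"
proof -
  let ?B = "{(3 / 2, - 1 / 2), (- 1, - 2)} :: plane set" and ?F = "{(0, - 1), (5, - 1)} :: plane set"
  have "(X, Y) = (2 / 3, - 1)" if v: "(X, Y) \<in> convex hull ?B" "(X, Y) \<in> convex hull ?F" for X Y
  proof -
    obtain t where t: "X = 3 / 2 + t * (- 1 - 3 / 2)" "Y = - 1 / 2 + t * (- 2 - - 1 / 2)"
      using v(1) unfolding in_segment_iff by blast
    have "Y = - 1" using v(2) by (simp add: in_horizontal)
    then show ?thesis using t by simp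
  qed
  moreover have "(2 / 3, - 1) \<in> convex hull ?B" unfolding in_segment_iff by (intro exI[of _ "1 / 3"]) simp
  moreover have "(2 / 3, - 1) \<in> convex hull ?F" by (simp add: in_horizontal)
  ultimately have "convex hull ?B \<inter> convex hull ?F = {(2 / 3, - 1)}" by (rule Int_eq_singletonI)
  then show ?thesis unfolding crosses_def by (auto simp: doubleton_eq_iff)
qed

lemma crosses_join:
  assumes "2 \<le> p"
  shows "crosses {(1, real p - 1), (3 / 2, - 1 / 2)} {(1, 0), (2, 0)}"
proof -
  let ?A = "{(1, real p - 1), (3 / 2, - 1 / 2)} :: plane set" and ?F = "{(1, 0), (2, 0)} :: plane set"
  \<comment> \<open>the position on the descending edge where its height is 0\<close>
  define t where "t = (real p - 1) / (real p - 1 / 2)"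
  have p2: "real p \<ge> 2" using assms by simp
  have t01: "0 < t" "t < 1" using p2 by (auto simp: t_def field_simps)
  have tp: "t * (real p - 1 / 2) = real p - 1" using p2 by (simp add: t_def)
  have "(X, Y) = (1 + t / 2, 0)" if v: "(X, Y) \<in> convex hull ?A" "(X, Y) \<in> convex hull ?F" for X Y
  proof -
    obtain s where s: "X = 1 + s * (3 / 2 - 1)" "Y = real p - 1 + s * (- 1 / 2 - (real p - 1))"
      using v(1) unfolding in_segment_iff by blast
    have "Y = 0" using v(2) by (simp add: in_horizontal)
    then have "s * (real p - 1 / 2) = t * (real p - 1 / 2)" using s(2) tp by (simp add: algebra_simps)
    then have "s = t" using p2 by simp
    then show ?thesis using s(1) \<open>Y = 0\<close> by simp
  qed
  moreover have "(1 + t / 2, 0) \<in> convex hull ?A"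
    unfolding in_segment_iff using t01 tp by (intro exI[of _ t]) (simp add: algebra_simps)
  moreover have "(1 + t / 2, 0) \<in> convex hull ?F" using t01 by (simp add: in_horizontal)
  ultimately have "convex hull ?A \<inter> convex hull ?F = {(1 + t / 2, 0)}" by (rule Int_eq_singletonI)
  moreover have "(1 + t / 2, 0) \<notin> ?A" "(1 + t / 2, 0) \<notin> ?F" "?A \<noteq> ?F"
    using t01 p2 by (auto simp: doubleton_eq_iff)
  ultimately show ?thesis unfolding crosses_def by blast
qed

lemma neg_strand: "(e, f) \<in> C \<Longrightarrow> f \<notin> path_edges neg_old"
  unfolding crossing_shapes path_neg_old by (elim disjE exE conjE) simp_all

lemma neg_new_crossings_cases:
  assumes "(e, f) \<in> neg_new_crossings"
  obtains "e = {(3 / 2, - 1 / 2), (- 1, - 2)}" "f = {(0, - 1), (5, - 1)}"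
  | "2 \<le> p" "e = {(1, real p - 1), (3 / 2, - 1 / 2)}" "f = {(1, 0), (2, 0)}"
  using assms by (auto simp: neg_new_crossings_def split: if_splits)

lemma reroute_neg: "plane_curve (E\<^sub>3 \<union> path_edges neg_new) (C\<^sub>3 \<union> neg_new_crossings) \<and> E\<^sub>3 \<inter> path_edges neg_new = {}"
proof (rule plane_curve_reroute[OF plane_curve neg_distinct(1) _ neg_old_subset neg_distinct(2)])
  show "E\<^sub>3 = E - path_edges neg_old" by (rule E\<^sub>3_def)
  show "C\<^sub>3 = C \<inter> E\<^sub>3 \<times> E\<^sub>3" by (rule C\<^sub>3_def)
  have nv: "(3 / 2, - 1 / 2) \<notin> \<Union>E" "(- 1, - 2) \<notin> \<Union>E"
    by (rule not_vertex[OF not_nat(3)], rule not_vertex[OF not_nat(4)])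
  have sub: "E\<^sub>3 \<subseteq> E" by (auto simp: E\<^sub>3_def)
  show "set (butlast (tl neg_new)) \<inter> \<Union>E\<^sub>3 = {}"
    using contra_subsetD[OF Union_mono[OF sub] nv(1)] contra_subsetD[OF Union_mono[OF sub] nv(2)]
    by (simp add: neg_new_def)
  show "convex hull e \<inter> convex hull f \<subseteq> e \<inter> f"
    if "e \<in> path_edges neg_new" "f \<in> path_edges neg_new" "e \<noteq> f" for e f
    using neg_new_self[OF that] .
  show "convex hull e \<inter> convex hull f \<subseteq> e \<inter> f"
    if "e \<in> path_edges neg_new" "f \<in> E\<^sub>3" "(e, f) \<notin> neg_new_crossings" for e f
  proof -
    have f: "f \<in> E" using that(2) sub by blast
    from that(1) consider "e = {(1, real p - 1), (3 / 2, - 1 / 2)}" | "e = {(3 / 2, - 1 / 2), (- 1, - 2)}"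
      | "e = {(- 1, - 2), (0, h + 1)}"
      unfolding path_neg_new insert_iff empty_iff by argo
    then show ?thesis
    proof cases
      case 1
      then have "2 \<le> p \<Longrightarrow> f \<noteq> {(1, 0), (2, 0)}" using that(3) by (auto simp: neg_new_crossings_def)
      then show ?thesis using descent_apart[OF f] 1 by simp
    next
      case 2
      then have "f \<noteq> {(0, - 1), (5, - 1)}" using that(3) by (auto simp: neg_new_crossings_def)
      then show ?thesis using underneath_apart[OF f] 2 by (simp add: insert_commute)
    next
      case 3
      then show ?thesis using ascent_apart[OF f] by simp
    qed
  qed
  have old: "{(0, - 1), (5, - 1)} \<in> E\<^sub>3" "{(1, 0), (2, 0)} \<in> E\<^sub>3"
    using edge_members(7) h_bounds unfolding E\<^sub>3_def path_neg_old frame_def by (simp_all add: doubleton_eq_iff)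
  show "e \<in> E\<^sub>3 \<union> path_edges neg_new \<and> f \<in> E\<^sub>3 \<union> path_edges neg_new \<and> crosses e f" if "(e, f) \<in> neg_new_crossings" for e f
    using that
  proof (cases rule: neg_new_crossings_cases)
    case 1
    then show ?thesis using old(1) crosses_bar by (simp add: path_neg_new)
  next
    case 2
    then show ?thesis using old(2) crosses_join by (simp add: path_neg_new)
  qed
  show "matching (C\<^sub>3 \<union> neg_new_crossings)"
  proof (rule matching_Un)
    show "matching C\<^sub>3"
      by (rule matching_subset[OF plane_curveD(5)[OF plane_curve]]) (auto simp: C\<^sub>3_def)
    show "matching neg_new_crossings"
    proof (rule matchingI)
      fix e f e' f' assume *: "(e, f) \<in> neg_new_crossings" "(e', f') \<in> neg_new_crossings" "{e, f} \<inter> {e', f'} \<noteq> {}"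
      show "e = e' \<and> f = f'"
        using *(1)
      proof (cases rule: neg_new_crossings_cases)
        case e: 1
        from *(2) show ?thesis
          by (cases rule: neg_new_crossings_cases) (use e *(3) in \<open>simp_all add: doubleton_eq_iff\<close>)
      next
        case e: 2
        from *(2) show ?thesis
          by (cases rule: neg_new_crossings_cases) (use e *(3) in \<open>simp_all add: doubleton_eq_iff\<close>)
      qed
    qed
    show "{e, f} \<inter> {e', f'} = {}" if C: "(e, f) \<in> C\<^sub>3" and N: "(e', f') \<in> neg_new_crossings" for e f e' f'
    proof -
      have ef: "e \<in> E" "f \<in> E" "(e, f) \<in> C" using C by (auto simp: C\<^sub>3_def E\<^sub>3_def)
      have "e' \<notin> E" using N by (cases rule: neg_new_crossings_cases) (use nv(1) in auto)
      moreover have "f' \<noteq> e" "f' \<noteq> f"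
        using N ef(3) unfolding crossing_shapes by (cases rule: neg_new_crossings_cases; elim disjE exE conjE; simp)+
      ultimately show ?thesis using ef(1,2) by auto
    qed
  qed
qed (simp_all add: neg_old_def neg_new_def)

lemma isotopic_neg: "ambient_isotopic S3 (pretzel_link [- int p, int q, int r])
    (link_of (diagram_of (E\<^sub>3 \<union> path_edges neg_new) (C\<^sub>3 \<union> neg_new_crossings)))"
  unfolding pretzel_link_eq
proof (rule ambient_isotopic_reroute[where vs = neg_old and u = True,
      OF plane_curve _ neg_distinct(1) _ neg_old_subset neg_distinct(2)])
  show "plane_curve (E\<^sub>3 \<union> path_edges neg_new) (C\<^sub>3 \<union> neg_new_crossings)" "E\<^sub>3 \<inter> path_edges neg_new = {}"
    using reroute_neg by simp_all
  show "(if True then f else e) \<notin> path_edges neg_old" if "(e, f) \<in> C" for e f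
    using neg_strand[OF that] by simp
  show "(if True then f else e) \<notin> path_edges neg_new" if "(e, f) \<in> neg_new_crossings" for e f
    using that by (cases rule: neg_new_crossings_cases) (simp_all add: path_neg_new doubleton_eq_iff)
  show "e \<in> path_edges neg_new \<or> f \<in> path_edges neg_new" if "(e, f) \<in> neg_new_crossings" for e f
    using that by (cases rule: neg_new_crossings_cases) (simp_all add: path_neg_new)
  show "E\<^sub>3 = E - path_edges neg_old" by (rule E\<^sub>3_def)
  show "C\<^sub>3 = C \<inter> E\<^sub>3 \<times> E\<^sub>3" by (rule C\<^sub>3_def)
qed (simp_all add: neg_old_def neg_new_def)

lemma C\<^sub>3_cases:
  assumes "(e, f) \<in> C\<^sub>3"
  obtains k where "Suc k < p" "e = falling 0 k" "f = rising 0 k"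
  | k where "k < q" "e = rising (Suc 0) k" "f = falling (Suc 0) k"
  | k where "k < r" "e = rising 2 k" "f = falling 2 k"
proof -
  have ef: "(e, f) \<in> C" "e \<notin> path_edges neg_old" using assms by (auto simp: C\<^sub>3_def E\<^sub>3_def)
  from ef(1) consider k where "k < p" "e = falling 0 k" "f = rising 0 k"
    | k where "k < q" "e = rising (Suc 0) k" "f = falling (Suc 0) k"
    | k where "k < r" "e = rising 2 k" "f = falling 2 k"
    unfolding crossing_shapes by blast
  then show ?thesis
  proof cases
    case (1 k)
    then have "k \<noteq> p - 1" using ef(2) by (auto simp: path_neg_old)
    then show ?thesis using 1 that(1)[of k] by simp
  qed (use that in blast)+
qed

lemma C\<^sub>3_I:
  "Suc k < p \<Longrightarrow> (falling 0 k, rising 0 k) \<in> C\<^sub>3"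
  "k < q \<Longrightarrow> (rising (Suc 0) k, falling (Suc 0) k) \<in> C\<^sub>3"
  "k < r \<Longrightarrow> (rising 2 k, falling 2 k) \<in> C\<^sub>3"
  using crossing_shapes edge_members(1-6) by (auto simp: C\<^sub>3_def E\<^sub>3_def path_neg_old)

text \<open>
  The edges without crossings. The last two occur only for \<open>p = 1\<close>, where they share the
  vertex \<open>(1, 0)\<close>.
\<close>

lemma E\<^sub>3_arcs:
  assumes e: "e \<in> E\<^sub>3 \<union> path_edges neg_new" and nc: "\<And>a b. (a, b) \<in> C\<^sub>3 \<union> neg_new_crossings \<Longrightarrow> e \<noteq> a \<and> e \<noteq> b"
  shows "e \<in> {rising 0 (p - 1), {(1, real p), (1, h)}, {(2, real q), (2, h)}, {(3, real q), (3, h)},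
      {(4, real r), (4, h)}, {(5, real r), (5, h)}, {(3, 0), (4, 0)}, {(1, h), (2, h)}, {(3, h), (4, h)},
      {(5, h), (5, h + 1)}, {(0, h + 1), (5, h + 1)}, {(0, - 1), (0, 0)}, {(5, - 1), (5, 0)}, {(- 1, - 2), (0, h + 1)}} \<or>
    p = 1 \<and> e \<in> {{(1, 0), (2, 0)}, {(1, real p - 1), (3 / 2, - 1 / 2)}}"
proof -
  have nN: "e \<noteq> {(3 / 2, - 1 / 2), (- 1, - 2)}" "e \<noteq> {(0, - 1), (5, - 1)}"
    "p = 1 \<or> e \<noteq> {(1, real p - 1), (3 / 2, - 1 / 2)} \<and> e \<noteq> {(1, 0), (2, 0)}"
  proof -
    have "({(3 / 2, - 1 / 2), (- 1, - 2)}, {(0, - 1), (5, - 1)}) \<in> C\<^sub>3 \<union> neg_new_crossings" by (simp add: neg_new_crossings_def)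
    from nc[OF this] show "e \<noteq> {(3 / 2, - 1 / 2), (- 1, - 2)}" "e \<noteq> {(0, - 1), (5, - 1)}" by simp_all
    have "({(1, real p - 1), (3 / 2, - 1 / 2)}, {(1, 0), (2, 0)}) \<in> C\<^sub>3 \<union> neg_new_crossings" if "p \<noteq> 1"
      using that pos by (simp add: neg_new_crossings_def)
    then show "p = 1 \<or> e \<noteq> {(1, real p - 1), (3 / 2, - 1 / 2)} \<and> e \<noteq> {(1, 0), (2, 0)}" using nc by blast
  qed
  from e consider "e \<in> path_edges neg_new" | "e \<in> E" "e \<notin> path_edges neg_old" by (auto simp: E\<^sub>3_def)
  then show ?thesis
  proof cases
    case 1
    then show ?thesis using nN(1,3) unfolding path_neg_new insert_iff empty_iff by argo
  next
    case 2
    from edge_shapes[OF 2(1)] consider k where "k < p" "e = rising 0 k" | k where "k < p" "e = falling 0 k"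
      | k where "k < q" "e = rising (Suc 0) k \<or> e = falling (Suc 0) k"
      | k where "k < r" "e = rising 2 k \<or> e = falling 2 k" | "e \<in> frame"
      by blast
    then show ?thesis
    proof cases
      case (1 k)
      have "k = p - 1"
      proof (rule ccontr)
        assume "k \<noteq> p - 1"
        then have "Suc k < p" using 1(1) by arith
        then show False using nc[OF UnI1[OF C\<^sub>3_I(1)[of k]]] 1 by simp
      qed
      then show ?thesis using 1 by simp
    next
      case (2 k)
      then have "k \<noteq> p - 1" using \<open>e \<notin> path_edges neg_old\<close> by (auto simp: path_neg_old)
      then have "Suc k < p" using 2(1) by arith
      then show ?thesis using nc[OF UnI1[OF C\<^sub>3_I(1)[of k]]] 2 by simp
    next
      case (3 k)
      then show ?thesis using nc[OF UnI1[OF C\<^sub>3_I(2)[of k]]] by simp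
    next
      case (4 k)
      then show ?thesis using nc[OF UnI1[OF C\<^sub>3_I(3)[of k]]] by simp
    next
      case 5
      moreover have "e \<notin> {{(0, real p), (0, h)}, {(0, h), (0, h + 1)}}"
        using 2(2) by (simp add: path_neg_old)
      ultimately show ?thesis using nN(2,3) unfolding frame_def insert_iff empty_iff by argo
    qed
  qed
qed

text \<open>
  The crossing to be changed is the one with the outer bottom arc.
\<close>

lemma almost_alternating_neg:
  "almost_alternating_diagram (diagram_of (E\<^sub>3 \<union> path_edges neg_new) (C\<^sub>3 \<union> neg_new_crossings))"
proof -
  let ?E = "E\<^sub>3 \<union> path_edges neg_new" and ?C = "C\<^sub>3 \<union> neg_new_crossings"
  let ?B = "{(3 / 2, - 1 / 2), (- 1, - 2)} :: plane set" and ?F = "{(0, - 1), (5, - 1)} :: plane set"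
  let ?C' = "insert (?F, ?B) (?C - {(?B, ?F)})"
  note curve = conjunct1[OF reroute_neg]
  have BF: "(?B, ?F) \<in> ?C" by (simp add: neg_new_crossings_def)
  have "alternating_diagram (diagram_of ?E ?C')"
  proof (rule alternating_if_flow[where \<tau> = "flow_neg (real p) (real q) (real r) h"])
    show "plane_curve ?E ?C'" by (rule plane_curve_flip(1)[OF curve BF])
    show "(v \<in> e \<longrightarrow> flow_neg (real p) (real q) (real r) h v = e) \<and> (v \<in> f \<longrightarrow> flow_neg (real p) (real q) (real r) h v \<noteq> f)"
      if ef: "(e, f) \<in> ?C'" for e f v
    proof -
      from ef consider "(e, f) \<in> C\<^sub>3" | "e = ?F" "f = ?B" | "(e, f) \<in> neg_new_crossings" "(e, f) \<noteq> (?B, ?F)" by blast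
      then show ?thesis
      proof cases
        case 1
        then show ?thesis
        proof (cases rule: C\<^sub>3_cases)
          case (1 k)
          then have "0 \<le> real k" "real k + 2 \<le> real p" by auto
          from flow_neg_crossings_0[OF this h_bounds(1)] show ?thesis unfolding 1 twists_shape by (metis insertE singletonD)
        next
          case (2 k)
          then have "0 \<le> real k" "real k + 1 \<le> real q" by auto
          from flow_neg_crossings_1[OF this h_bounds(2)] show ?thesis unfolding 2 twists_shape by (metis insertE singletonD)
        next
          case (3 k)
          then have "0 \<le> real k" "real k + 1 \<le> real r" by auto
          from flow_neg_crossings_2[OF this h_bounds(3)] show ?thesis unfolding 3 twists_shape by (metis insertE singletonD)
        qed
      next
        case 2
        have "1 \<le> h" using h_bounds(4) by simp
        from flow_neg_crossing_bar[OF h_bounds(5) this] show ?thesis unfolding 2 by (metis insertE singletonD)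
      next
        case 3
        from 3(1) show ?thesis
        proof (cases rule: neg_new_crossings_cases)
          case 1
          then show ?thesis using 3(2) by simp
        next
          case 2
          have "2 \<le> real p" "real p + 1 \<le> h" using 2(1) h_bounds(1) by auto
          from flow_neg_crossing_join[OF this(1) h_bounds(6) this(2)] show ?thesis unfolding 2(2,3) by (metis insertE singletonD)
        qed
      qed
    qed
    show "\<exists>a b. e = {a, b} \<and> flow_neg (real p) (real q) (real r) h a = e \<and> flow_neg (real p) (real q) (real r) h b \<noteq> e"
      if e: "e \<in> ?E" "e \<notin> fst ` ?C' \<union> snd ` ?C'" for e
    proof -
      have "e \<noteq> a \<and> e \<noteq> b" if "(a, b) \<in> ?C" for a b
      proof (cases "(a, b) = (?B, ?F)")
        case True
        then show ?thesis using e(2) by (simp only: image_insert) simp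
      next
        case False
        then have "(a, b) \<in> ?C'" using that by blast
        then show ?thesis using e(2) image_eqI[of a fst "(a, b)" ?C'] image_eqI[of b snd "(a, b)" ?C'] by (simp only: fst_conv snd_conv) blast
      qed
      from E\<^sub>3_arcs[OF e(1) this] have "directed (flow_neg (real p) (real q) (real r) h) e"
      proof
        assume "e \<in> {rising 0 (p - 1), {(1, real p), (1, h)}, {(2, real q), (2, h)}, {(3, real q), (3, h)},
          {(4, real r), (4, h)}, {(5, real r), (5, h)}, {(3, 0), (4, 0)}, {(1, h), (2, h)}, {(3, h), (4, h)},
          {(5, h), (5, h + 1)}, {(0, h + 1), (5, h + 1)}, {(0, - 1), (0, 0)}, {(5, - 1), (5, 0)}, {(- 1, - 2), (0, h + 1)}}"
        then show ?thesis
          unfolding last_neg by (rule bspec[OF flow_neg_arcs[OF h_bounds(5,6,7,1,2,3)]])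
      next
        assume *: "p = 1 \<and> e \<in> {{(1, 0), (2, 0)}, {(1, real p - 1), (3 / 2, - 1 / 2)}}"
        then have p1: "real p = 1" by simp
        have "e \<in> {{(1, 0), (2, 0)}, {(1, 0), (3 / 2, - 1 / 2)}}"
          using conjunct2[OF *] unfolding p1 by (simp only: diff_self)
        then show ?thesis
          unfolding p1 by (rule bspec[OF flow_neg_arcs_1[OF h_bounds(6,4)]])
      qed
      then show ?thesis by (simp only: directed_def)
    qed
  qed
  then have "alternating_diagram (change_crossing (diagram_of ?E ?C) ?B ?F)"
    unfolding plane_curve_flip(2)[OF curve BF] .
  moreover have "?B \<in> ?E" "?F \<in> ?E" "crosses ?B ?F"
    using plane_curveD(4)[OF curve] BF crosses_bar by auto
  ultimately show ?thesis unfolding almost_alternating_diagram_def diagram_of_simps by blast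
qed

end

theorem negative_column_almost_alternating:
  assumes "p \<ge> 1" and "q \<ge> 1" and "r \<ge> 1"
  shows "has_almost_alternating_diagram (pretzel_link [- int p, int q, int r])"
proof -
  interpret columns p q r by unfold_locales (use assms in auto)
  show ?thesis
    using isotopic_neg plane_curve_link_diagram[OF conjunct1[OF reroute_neg]] almost_alternating_neg
    unfolding has_almost_alternating_diagram_def has_diagram_def by blast
qed

theorem theorem2p1:
  fixes p q r :: int
  assumes "p > 0" and "q > 0" and "r > 0"
  shows "alternating_link (pretzel_link [-1, q, r]) \<and>
         has_almost_alternating_diagram (pretzel_link [-p, q, r])"
proof -
  obtain p' q' r' :: nat where nat: "p = int p'" "q = int q'" "r = int r'" "p' \<ge> 1" "q' \<ge> 1" "r' \<ge> 1"
    using assms by (metis One_nat_def Suc_leI of_nat_0_less_iff zero_less_imp_eq_int)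
  then show ?thesis
    using single_crossing_alternating[of q' r'] negative_column_almost_alternating[of p' q' r'] by simp
qed


end
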